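(* Let $A,B>0$ be constants such that $$|\zeta(\sigma+it)| \le A |t|^{B(1-\sigma)^{3/2}} (\log |t|)^{2/3}\qquad \text{for all real } t,\sigma \text{ with } |t|\ge 3,\ \tfrac12\le\sigma\le 1 .$$ Then there is $T>0$ such that for all real $t$ with $|t|\ge T$ and all real $\beta$ with $$1-\beta \le \frac{0.05507\, B^{-2/3}}{(\log |t|)^{2/3} (\log\log |t|)^{1/3}}$$ we have $\zeta(\beta+it)\ne 0$.
   Context: $\zeta$ is the Riemann zeta function. *)

theory Defs
  imports "HOL-Complex_Analysis.Complex_Analysis"
begin

(* The value at the pole 1 is left unspecified. *)
definition zeta :: "complex \<Rightarrow> complex" where
  "zeta = (SOME f. f holomorphic_on - {1} \<and>
             (\<forall>s. Re s > 1 \<longrightarrow> (\<lambda>n. 1 / of_nat (Suc n) powr s) sums f s))"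

text \<open>
  The rest of this theory shows that such an \<open>f\<close> exists and is unique on the punctured plane,
  so that the choice operator above does define the Riemann zeta function there.
\<close>

lemma gbinomial_remainder_bound:
  fixes M :: real and K :: nat
  assumes "M \<ge> 0"
  obtains C where "\<And>a x :: complex. norm a \<le> M \<Longrightarrow> norm x \<le> 1 / 2 \<Longrightarrow>
    norm ((1 + x) powr a - (\<Sum>j<K. (a gchoose j) * x ^ j)) \<le> C * norm x ^ K"
proof -
  define b where "b j = pochhammer M j / fact j" for j :: nat
  have b_bound: "norm (a gchoose j) \<le> b j" if "norm a \<le> M" for a :: complex and j
  proof -
    have "norm (a gchoose j) = (\<Prod>i<j. norm (- a + of_nat i)) / fact j"
      by (simp add: gbinomial_pochhammer norm_mult norm_divide norm_power pochhammer_prod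
            prod_norm[symmetric] lessThan_atLeast0)
    also have "\<dots> \<le> (\<Prod>i<j. M + of_nat i) / fact j"
    proof (intro divide_right_mono prod_mono conjI)
      fix i
      show "norm (- a + of_nat i) \<le> M + of_nat i"
        by (rule order.trans[OF norm_triangle_ineq]) (use that in simp)
    qed auto
    finally show ?thesis by (simp add: b_def pochhammer_prod lessThan_atLeast0)
  qed
  have "(\<lambda>j. ((- M) gchoose j) * (- (1 / 2)) ^ j) sums (1 + (- (1 / 2))) powr (- M)"
    by (rule gen_binomial_real) auto
  also have "(\<lambda>j. ((- M) gchoose j) * (- (1 / 2)) ^ j) = (\<lambda>j. b j * (1 / 2) ^ j)"
  proof
    fix j
    have "(- 1) ^ j * (- (1 / 2)) ^ j = ((- 1) * (- (1 / 2)) :: real) ^ j"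
      by (rule power_mult_distrib[symmetric])
    then have "(- 1) ^ j * (- (1 / 2)) ^ j = ((1 / 2) ^ j :: real)" by simp
    then show "((- M) gchoose j) * (- (1 / 2)) ^ j = b j * (1 / 2) ^ j"
      by (simp add: b_def gbinomial_pochhammer)
  qed
  finally have sb: "summable (\<lambda>j. b j * (1 / 2) ^ j)" by (simp add: sums_iff)
  have sbK: "summable (\<lambda>j. b (j + K) * (1 / 2) ^ j)"
  proof -
    have "summable (\<lambda>j. 2 ^ K * (b (j + K) * (1 / 2) ^ (j + K)))"
      by (intro summable_mult summable_ignore_initial_segment[OF sb])
    then show ?thesis by (simp add: power_add power_divide field_simps)
  qed
  show ?thesis
  proof (rule that)
    fix a x :: complex assume a: "norm a \<le> M" and x: "norm x \<le> 1 / 2"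
    have s: "(\<lambda>j. (a gchoose j) * x ^ j) sums (1 + x) powr a"
      by (rule gen_binomial_complex) (use x in auto)
    have "(\<lambda>j. (a gchoose (j + K)) * x ^ (j + K)) sums
            ((1 + x) powr a - (\<Sum>j<K. (a gchoose j) * x ^ j))"
      using sums_split_initial_segment[OF s, of K] .
    then have eq: "(1 + x) powr a - (\<Sum>j<K. (a gchoose j) * x ^ j) =
                     (\<Sum>j. (a gchoose (j + K)) * x ^ (j + K))"
      by (simp add: sums_iff)
    have le: "norm ((a gchoose (j + K)) * x ^ (j + K)) \<le> b (j + K) * (1 / 2) ^ j * norm x ^ K" for j
    proof -
      have "norm ((a gchoose (j + K)) * x ^ (j + K)) =
              norm (a gchoose (j + K)) * norm x ^ j * norm x ^ K"
        by (simp add: norm_mult norm_power power_add)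
      also have "\<dots> \<le> b (j + K) * (1 / 2) ^ j * norm x ^ K"
        by (intro mult_right_mono mult_mono b_bound a power_mono x)
           (auto intro: order.trans[OF norm_ge_zero b_bound[OF a]])
      finally show ?thesis .
    qed
    have "norm (\<Sum>j. (a gchoose (j + K)) * x ^ (j + K)) \<le>
            (\<Sum>j. b (j + K) * (1 / 2) ^ j * norm x ^ K)"
      by (rule norm_suminf_le[OF le]) (intro summable_mult2 sbK)
    also have "\<dots> = (\<Sum>j. b (j + K) * (1 / 2) ^ j) * norm x ^ K"
      by (rule suminf_mult2[OF sbK, symmetric])
    finally show "norm ((1 + x) powr a - (\<Sum>j<K. (a gchoose j) * x ^ j)) \<le>
      (\<Sum>j. b (j + K) * (1 / 2) ^ j) * norm x ^ K" by (simp add: eq)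
  qed
qed

text \<open>
  The remainder of the truncated binomial expansion of \<open>(n + 2) powr (1 - s)\<close> in powers of \<open>n + 1\<close>.
  For \<open>Re s > 1\<close>, summing it over \<open>n\<close> expresses \<open>(s - 1) * zeta s\<close> through the values of zeta at
  \<open>s + 1, \<dots>, s + K - 2\<close>, which moves the half-plane of holomorphy to the left by one at a time.
\<close>

definition zeta_diff :: "nat \<Rightarrow> nat \<Rightarrow> complex \<Rightarrow> complex" where
  "zeta_diff K n s = of_nat (Suc (Suc n)) powr (1 - s) -
     (\<Sum>j<K. ((1 - s) gchoose j) * of_nat (Suc n) powr (1 - s - of_nat j))"

lemma zeta_diff_bound:
  fixes M :: real and K :: nat
  assumes "M \<ge> 0"
  obtains C where "\<And>s n. norm (1 - s) \<le> M \<Longrightarrow> n \<ge> 1 \<Longrightarrow>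
    norm (zeta_diff K n s) \<le> C * real (Suc n) powr (1 - Re s - real K)"
proof -
  obtain C where C: "\<And>a x :: complex. norm a \<le> M \<Longrightarrow> norm x \<le> 1 / 2 \<Longrightarrow>
    norm ((1 + x) powr a - (\<Sum>j<K. (a gchoose j) * x ^ j)) \<le> C * norm x ^ K"
    using gbinomial_remainder_bound[OF assms] by blast
  show ?thesis
  proof (rule that)
    fix s :: complex and n :: nat
    assume s: "norm (1 - s) \<le> M" and n: "n \<ge> 1"
    define N where "N = real (Suc n)"
    have N: "N \<ge> 2" using n by (simp add: N_def)
    define x where "x = complex_of_real (1 / N)"
    have nx: "norm x = 1 / N" using N by (simp add: x_def norm_divide)
    have Nx: "complex_of_real N * (1 + x) = of_real (N + 1)"
      using N by (simp add: x_def field_simps)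
    have "of_nat (Suc (Suc n)) = complex_of_real N * (1 + x)"
      unfolding Nx by (simp add: N_def)
    moreover have "(complex_of_real N * complex_of_real (1 + 1 / N)) powr (1 - s) =
            complex_of_real N powr (1 - s) * complex_of_real (1 + 1 / N) powr (1 - s)"
      by (rule powr_times_real) (use N in auto)
    ultimately have 1: "of_nat (Suc (Suc n)) powr (1 - s) =
                         complex_of_real N powr (1 - s) * (1 + x) powr (1 - s)"
      by (simp add: x_def)
    have 2: "of_nat (Suc n) powr (1 - s - of_nat j) = complex_of_real N powr (1 - s) * x ^ j" for j
    proof -
      have "of_nat (Suc n) powr (1 - s - of_nat j) =
              complex_of_real N powr (1 - s) / complex_of_real N powr of_nat j"
        unfolding N_def of_real_of_nat_eq by (rule powr_diff)
      also have "complex_of_real N powr of_nat j = complex_of_real N ^ j"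
        using N by (intro powr_nat') auto
      finally show ?thesis by (simp add: x_def power_divide)
    qed
    have "zeta_diff K n s = complex_of_real N powr (1 - s) *
            ((1 + x) powr (1 - s) - (\<Sum>j<K. ((1 - s) gchoose j) * x ^ j))"
      unfolding zeta_diff_def 1 2 by (simp add: algebra_simps sum_distrib_left)
    then have "norm (zeta_diff K n s) = N powr (1 - Re s) *
            norm ((1 + x) powr (1 - s) - (\<Sum>j<K. ((1 - s) gchoose j) * x ^ j))"
      using N by (simp add: norm_mult norm_powr_real_powr)
    also have "\<dots> \<le> N powr (1 - Re s) * (C * norm x ^ K)"
      by (intro mult_left_mono C s) (use N nx in auto)
    also have "\<dots> = C * (N powr (1 - Re s) / N ^ K)" by (simp add: nx power_divide)
    also have "N powr (1 - Re s) / N ^ K = N powr (1 - Re s - real K)"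
      using N by (simp add: powr_diff powr_realpow)
    finally show "norm (zeta_diff K n s) \<le> C * real (Suc n) powr (1 - Re s - real K)"
      by (simp add: N_def)
  qed
qed

lemma holomorphic_gbinomial [holomorphic_intros]:
  "f holomorphic_on A \<Longrightarrow> (\<lambda>s. f s gchoose k) holomorphic_on A"
  unfolding gbinomial_prod_rev by (intro holomorphic_intros) auto

lemma zeta_diff_holomorphic: "zeta_diff K n holomorphic_on A"
  unfolding zeta_diff_def by (intro holomorphic_intros)

lemma open_Re_gt: "open {s. Re s > c}"
  by (rule open_halfspace_Re_gt)

lemma zeta_diff_sum_holomorphic:
  "(\<lambda>s. \<Sum>n. zeta_diff K n s) holomorphic_on {s. Re s > 2 - real K}"
proof -
  let ?S = "{s. Re s > 2 - real K}"
  have "\<exists>g g'. \<forall>x\<in>?S. (\<lambda>n. zeta_diff K n x) sums g x \<and>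
          (\<lambda>n. deriv (zeta_diff K n) x) sums g' x \<and> (g has_field_derivative g' x) (at x)"
  proof (rule series_and_derivative_comparison_local)
    show "open ?S" by (rule open_Re_gt)
  next
    fix n x
    show "(zeta_diff K n has_field_derivative deriv (zeta_diff K n) x) (at x)"
      by (rule holomorphic_derivI[OF zeta_diff_holomorphic open_UNIV]) simp
  next
    fix x assume x: "x \<in> ?S"
    define d where "d = (Re x - (2 - real K)) / 2"
    have d: "d > 0" using x by (simp add: d_def)
    define M where "M = norm (1 - x) + d"
    have "M \<ge> 0" using d by (simp add: M_def)
    then obtain C where C: "\<And>s n. norm (1 - s) \<le> M \<Longrightarrow> n \<ge> 1 \<Longrightarrow>
      norm (zeta_diff K n s) \<le> C * real (Suc n) powr (1 - Re s - real K)"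
      using zeta_diff_bound by blast
    define h where "h n = \<bar>C\<bar> * real (Suc n) powr (1 - Re x + d - real K)" for n
    have "summable h"
      unfolding h_def
    proof (rule summable_mult)
      have "summable (\<lambda>n. real n powr (1 - Re x + d - real K))"
        by (subst summable_real_powr_iff) (use x in \<open>auto simp: d_def field_simps\<close>)
      then show "summable (\<lambda>n. real (Suc n) powr (1 - Re x + d - real K))"
        by (subst summable_Suc_iff)
    qed
    moreover have "\<forall>\<^sub>F n in sequentially. \<forall>y\<in>ball x d \<inter> ?S. norm (zeta_diff K n y) \<le> h n"
      using eventually_ge_at_top[of 1]
    proof (eventually_elim, intro ballI)
      fix n y assume n: "(n::nat) \<ge> 1" and y: "y \<in> ball x d \<inter> ?S"
      have dxy: "norm (x - y) < d" using y by (simp add: dist_norm)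
      have "norm (1 - y) \<le> norm (1 - x) + norm (x - y)"
        by (rule order.trans[OF _ norm_triangle_ineq]) simp
      then have "norm (1 - y) \<le> M" using dxy by (simp add: M_def)
      then have "norm (zeta_diff K n y) \<le> C * real (Suc n) powr (1 - Re y - real K)"
        using n by (rule C)
      also have "\<dots> \<le> \<bar>C\<bar> * real (Suc n) powr (1 - Re x + d - real K)"
      proof (intro mult_mono powr_mono)
        show "1 - Re y - real K \<le> 1 - Re x + d - real K"
          using abs_Re_le_cmod[of "x - y"] dxy by simp
      qed auto
      finally show "norm (zeta_diff K n y) \<le> h n" by (simp add: h_def)
    qed
    ultimately show "\<exists>d h. 0 < d \<and> summable h \<and>
       (\<forall>\<^sub>F n in sequentially. \<forall>y\<in>ball x d \<inter> ?S. norm (zeta_diff K n y) \<le> h n)"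
      using d by blast
  qed
  then obtain g g' where g: "\<And>x. x \<in> ?S \<Longrightarrow> (\<lambda>n. zeta_diff K n x) sums g x"
      "\<And>x. x \<in> ?S \<Longrightarrow> (g has_field_derivative g' x) (at x)" by blast
  have "g holomorphic_on ?S"
    using g(2) open_Re_gt holomorphic_on_open by blast
  then show ?thesis
    by (rule holomorphic_transform) (use g(1) in \<open>auto simp: sums_iff\<close>)
qed

definition dirichlet_zeta :: "complex \<Rightarrow> complex" where
  "dirichlet_zeta s = (\<Sum>n. of_nat (Suc n) powr (- s))"

lemma dirichlet_zeta_sums:
  assumes "Re s > 1"
  shows "(\<lambda>n. of_nat (Suc n) powr (- s)) sums dirichlet_zeta s"
  unfolding dirichlet_zeta_def
proof (rule summable_sums, rule summable_norm_cancel)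
  have "summable (\<lambda>n. real n powr (- Re s))"
    by (subst summable_real_powr_iff) (use assms in auto)
  then have "summable (\<lambda>n. real (Suc n) powr (- Re s))"
    by (subst summable_Suc_iff)
  then show "summable (\<lambda>n. norm (of_nat (Suc n) powr (- s) :: complex))"
    by (simp add: norm_powr_real_powr del: of_nat_Suc)
qed

lemma zeta_diff_sum_eq:
  assumes s: "Re s > 1" and K: "K \<ge> 2"
  shows "(s - 1) * dirichlet_zeta s = 1 + (\<Sum>n. zeta_diff K n s) -
     (\<Sum>j=2..<K. ((1 - s) gchoose (j - 1)) / of_nat j *
        ((s + of_nat j - 2) * dirichlet_zeta (s + of_nat j - 1)))"
proof -
  let ?a = "1 - s"
  let ?Z = "\<lambda>j. dirichlet_zeta (s + of_nat j - 1)"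
  have "(\<lambda>n. of_nat (Suc n) powr ?a) \<longlonglongrightarrow> 0"
  proof (rule tendsto_norm_zero_cancel)
    have "(\<lambda>n. real n powr (1 - Re s)) \<longlonglongrightarrow> 0"
      by (rule tendsto_neg_powr) (use s in \<open>auto simp: filterlim_real_sequentially\<close>)
    then have "(\<lambda>n. real (Suc n) powr (1 - Re s)) \<longlonglongrightarrow> 0"
      by (rule LIMSEQ_Suc)
    then show "(\<lambda>n. norm (of_nat (Suc n) powr ?a :: complex)) \<longlonglongrightarrow> 0"
      by (simp add: norm_powr_real_powr del: of_nat_Suc)
  qed
  then have 1: "(\<lambda>n. of_nat (Suc (Suc n)) powr ?a - of_nat (Suc n) powr ?a) sums (0 - of_nat (Suc 0) powr ?a)"
    by (rule telescope_sums)
  have 2: "(\<lambda>n. of_nat (Suc n) powr (?a - of_nat j)) sums ?Z j" if "j \<ge> 1" for j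
  proof -
    have "Re (s + of_nat j - 1) > 1" using s that by simp
    from dirichlet_zeta_sums[OF this] show ?thesis by (simp add: algebra_simps)
  qed
  have 3: "(\<lambda>n. (of_nat (Suc (Suc n)) powr ?a - of_nat (Suc n) powr ?a) -
          (\<Sum>j=1..<K. (?a gchoose j) * of_nat (Suc n) powr (?a - of_nat j)))
        sums ((0 - of_nat (Suc 0) powr ?a) - (\<Sum>j=1..<K. (?a gchoose j) * ?Z j))"
    by (intro sums_diff 1 sums_sum sums_mult 2) auto
  have "(\<Sum>j<K. g j) = g 0 + (\<Sum>j=1..<K. g j)" for g :: "nat \<Rightarrow> complex"
    using K by (simp add: lessThan_atLeast0 sum.atLeast_Suc_lessThan)
  then have "zeta_diff K n s = (of_nat (Suc (Suc n)) powr ?a - of_nat (Suc n) powr ?a) -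
          (\<Sum>j=1..<K. (?a gchoose j) * of_nat (Suc n) powr (?a - of_nat j))" for n
    unfolding zeta_diff_def by (simp add: algebra_simps)
  with 3 have sum_eq: "(\<Sum>n. zeta_diff K n s) = - 1 - (\<Sum>j=1..<K. (?a gchoose j) * ?Z j)"
    by (simp add: sums_iff)
  have "(\<Sum>j=1..<K. (?a gchoose j) * ?Z j) =
          (1 - s) * dirichlet_zeta s + (\<Sum>j=2..<K. (?a gchoose j) * ?Z j)"
    using K by (subst sum.atLeast_Suc_lessThan) (auto simp: numeral_2_eq_2)
  moreover have "(\<Sum>j=2..<K. (?a gchoose j) * ?Z j) =
     - (\<Sum>j=2..<K. (?a gchoose (j - 1)) / of_nat j * ((s + of_nat j - 2) * ?Z j))"
    unfolding sum_negf[symmetric]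
  proof (rule sum.cong)
    fix j assume j: "j \<in> {2..<K}"
    obtain i where i: "j = Suc i" using j by (cases j) auto
    have "of_nat (Suc i) * (?a gchoose Suc i) = (?a - of_nat i) * (?a gchoose i)"
      using gbinomial_mult_1[of ?a i] by (simp add: algebra_simps)
    then have "(?a gchoose j) = - ((?a gchoose (j - 1)) / of_nat j * (s + of_nat j - 2))"
      unfolding i by (simp add: field_simps del: of_nat_Suc) (simp add: algebra_simps)
    then show "(?a gchoose j) * ?Z j = - ((?a gchoose (j - 1)) / of_nat j * ((s + of_nat j - 2) * ?Z j))"
      by simp
  qed simp
  ultimately show ?thesis unfolding sum_eq by (simp add: algebra_simps)
qed

lemma zeta_continuation_halfplane:
  "\<exists>F. F holomorphic_on {s. Re s > - real m} \<and> (\<forall>s. Re s > 1 \<longrightarrow> F s = (s - 1) * dirichlet_zeta s)"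
proof (induction m)
  case 0
  have "(\<lambda>s. 1 + (\<Sum>n. zeta_diff 2 n s)) holomorphic_on {s. Re s > 0}"
    using zeta_diff_sum_holomorphic[of 2] by (intro holomorphic_intros) simp
  moreover have "1 + (\<Sum>n. zeta_diff 2 n s) = (s - 1) * dirichlet_zeta s" if "Re s > 1" for s
    using zeta_diff_sum_eq[of s 2] that by simp
  ultimately show ?case by auto
next
  case (Suc m)
  then obtain F where F: "F holomorphic_on {s. Re s > - real m}"
    "\<And>s. Re s > 1 \<Longrightarrow> F s = (s - 1) * dirichlet_zeta s" by blast
  define K where "K = m + 3"
  define G where "G s = 1 + (\<Sum>n. zeta_diff K n s) -
     (\<Sum>j=2..<K. ((1 - s) gchoose (j - 1)) / of_nat j * F (s + of_nat j - 1))" for s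
  have "(\<lambda>s. F (s + of_nat j - 1)) holomorphic_on {s. Re s > - real (Suc m)}"
    if "j \<in> {2..<K}" for j
  proof -
    have "F \<circ> (\<lambda>s. s + of_nat j - 1) holomorphic_on {s. Re s > - real (Suc m)}"
      by (rule holomorphic_on_compose_gen[OF _ F(1)]) (use that in \<open>auto intro!: holomorphic_intros\<close>)
    then show ?thesis by (simp add: o_def)
  qed
  moreover have "(\<lambda>s. \<Sum>n. zeta_diff K n s) holomorphic_on {s. Re s > - real (Suc m)}"
    using zeta_diff_sum_holomorphic[of K] by (simp add: K_def)
  ultimately have "G holomorphic_on {s. Re s > - real (Suc m)}"
    unfolding G_def by (intro holomorphic_intros) auto
  moreover have "G s = (s - 1) * dirichlet_zeta s" if "Re s > 1" for s
  proof -
    have "F (s + of_nat j - 1) = (s + of_nat j - 2) * dirichlet_zeta (s + of_nat j - 1)"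
      if "j \<in> {2..<K}" for j
      using F(2)[of "s + of_nat j - 1"] that \<open>Re s > 1\<close> by (simp add: algebra_simps)
    then show ?thesis
      unfolding G_def using zeta_diff_sum_eq[OF that, of K] by (simp add: K_def)
  qed
  ultimately show ?case by blast
qed

lemma zeta_continuation_exists:
  "\<exists>f. f holomorphic_on - {1} \<and> (\<forall>s. Re s > 1 \<longrightarrow> (\<lambda>n. 1 / of_nat (Suc n) powr s) sums f s)"
proof -
  obtain F where F: "\<And>m. F m holomorphic_on {s. Re s > - real m}"
    "\<And>m s. Re s > 1 \<Longrightarrow> F m s = (s - 1) * dirichlet_zeta s"
    using zeta_continuation_halfplane by metis
  have agree: "F m s = F k s" if "m \<le> k" "Re s > - real m" for m k s
  proof (rule analytic_continuation_open[where f = "F m" and g = "F k"])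
    show "open {s. Re s > 1}" "open {s. Re s > - real m}" by (rule open_Re_gt)+
    show "connected {s. Re s > - real m}"
      by (intro convex_connected convex_halfspace_Re_gt)
    show "{s. Re s > 1} \<noteq> {}" by (auto intro!: exI[of _ 2])
    show "F k holomorphic_on {s. Re s > - real m}"
      by (rule holomorphic_on_subset[OF F(1)]) (use that in auto)
  qed (use F that in auto)
  define G where "G s = F (nat \<lceil>- Re s\<rceil> + 1) s" for s
  have G_eq: "G s = F m s" if "Re s > - real m" for m s
  proof -
    have "Re s > - real (nat \<lceil>- Re s\<rceil> + 1)" by linarith
    with that show ?thesis
      unfolding G_def by (metis agree nle_le)
  qed
  have "G holomorphic_on (\<Union>m. {s. Re s > - real m})"
  proof (rule holomorphic_on_UN_open)
    fix m
    show "G holomorphic_on {s. Re s > - real m}"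
      by (rule holomorphic_transform[OF F(1)[of m]]) (use G_eq in auto)
  qed (rule open_Re_gt)
  moreover have "(\<Union>m. {s. Re s > - real m}) = UNIV"
  proof (intro set_eqI iffI UNIV_I)
    fix s :: complex
    obtain m where "real m > - Re s" using reals_Archimedean2 by blast
    then have "s \<in> {s. Re s > - real m}" by simp
    then show "s \<in> (\<Union>m. {s. Re s > - real m})" by blast
  qed
  ultimately have G_hol: "G holomorphic_on - {1}"
    by (metis holomorphic_on_subset subset_UNIV)
  have "(\<lambda>s. G s / (s - 1)) holomorphic_on - {1}"
    by (intro holomorphic_intros G_hol) auto
  moreover have "(\<lambda>n. 1 / of_nat (Suc n) powr s) sums (G s / (s - 1))" if "Re s > 1" for s
  proof -
    have "s \<noteq> 1" using that by auto
    moreover have "G s = (s - 1) * dirichlet_zeta s"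
      using G_eq[of 0 s] F(2)[OF that] that by simp
    ultimately have "G s / (s - 1) = dirichlet_zeta s" by simp
    then show ?thesis
      using dirichlet_zeta_sums[OF that] by (simp add: powr_minus divide_inverse)
  qed
  ultimately show ?thesis by blast
qed

lemma zeta_holomorphic: "zeta holomorphic_on - {1}"
  and zeta_sums: "Re s > 1 \<Longrightarrow> (\<lambda>n. 1 / of_nat (Suc n) powr s) sums zeta s"
  using someI_ex[OF zeta_continuation_exists] unfolding zeta_def[symmetric] by auto

lemma zeta_unique:
  assumes "f holomorphic_on - {1}"
    and "\<And>s. Re s > 1 \<Longrightarrow> (\<lambda>n. 1 / of_nat (Suc n) powr s) sums f s"
    and "s \<noteq> 1"
  shows "f s = zeta s"
proof (rule analytic_continuation_open[where f = f and g = zeta])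
  show "open {s. Re s > 1}" by (rule open_Re_gt)
  show "{s. Re s > 1} \<noteq> {}" by (auto intro!: exI[of _ 2])
  show "connected (- {1 :: complex})" by (rule connected_punctured_universe) simp
  show "f z = zeta z" if "z \<in> {s. Re s > 1}" for z
    using sums_unique2[OF assms(2) zeta_sums] that by simp
qed (use assms zeta_holomorphic in auto)

end

(*
Suppose zeta vanishes at b + i t with 1 - b small, and put s_j = 1 + \<lambda> + i j t. The map
z |-> s_j + q arctan z takes the unit disc onto a vertical strip of half-width (pi / 4) q, so that the
half circles |z| = r, Re z < 0 and Re z > 0 lie to the left and to the right of Re s = 1 + \<lambda>.
The Borel-Caratheodory and Jensen formulas in the disc, for the product of the functions
zeta (s_j + q arctan z) ^ b_j, express a combination, with coefficients c_i, of its logarithmic derivatives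
at z = 0, \<epsilon>, ..., N \<epsilon> through its zeros and through the values of log |zeta| on the two half circles.
On the left half circle the growth hypothesis applies. On the right half circle log |zeta| is a Dirichlet
series whose coefficients, combined with those of the logarithmic derivatives, stay nonnegative, so
that 609 + 1057 cos v + ... >= 0 lets them be compared with the pole at s = 1.
The c_i are chosen so that sum c_i / (w + i) has nonnegative real part for Re w >= 2: zeros outside the
region already known then contribute with a favourable sign, and the assumed zero is detected.
Comparing the two sides enlarges a zero-free region with constant m by a fixed factor as long as
m <= 0.0551. Iterating from a small initial m gives the constant 0.0551 > 0.05507.
*)
theory Submission
  imports Defs "HOL-Number_Theory.Prime_Powers" "HOL-Real_Asymp.Real_Asymp"
begin

section \<open>The detecting kernel\<close>

text \<open>The obstacle is the right half circle: estimating each log |zeta| there by log zeta (1 +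
  \<lambda>), which has size (2/3) ln ln t, would spoil the constant. The lower bound used there
  contains instead the same prime sum that the logarithmic derivatives produce, and the weight pi r
  / 2 is such that this sum cancels in the final inequality; only j = 0 has to be paid for. In units
  of \<lambda> the centre is at distance 1 from the pole, and a zero at distance w to the left of
  the centre is seen as sum c_i / (w + i), the Laplace transform at w of sum c_i exp (- i u). Up to
  a small constant term in the latter, its product with exp (- 2 u) is an autocorrelation, whence
  the sign for Re w >= 2. This suits the problem because \<lambda> is taken about as large as the
  width of the region already known, so that known zeros have Re w >= 2 while the assumed one has w
  just above 2. Polynomials in exp (- u) are used so that finitely many logarithmic derivatives
  suffice in place of an integral.\<close>

lemma has_integral_power01: "((\<lambda>x::real. x ^ n) has_integral 1 / real (Suc n)) {0..1}"
proof -
  have "((\<lambda>x::real. x ^ n) has_integral (1 ^ Suc n / real (Suc n) - 0 ^ Suc n / real (Suc n))) {0..1}"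
    by (rule fundamental_theorem_of_calculus)
       (auto intro!: derivative_eq_intros simp: has_real_derivative_iff_has_vector_derivative[symmetric]
          simp del: power_Suc of_nat_Suc)
  then show ?thesis by simp
qed

text \<open>Lets the double sums below be read as integrals of products of two polynomials, so that
  signs and limits can be taken under the integral.\<close>

lemma has_integral_double_sum01:
  fixes a b :: "nat \<Rightarrow> real"
  shows "((\<lambda>x. x ^ m * (\<Sum>i\<le>N. a i * x ^ i) * (\<Sum>j\<le>N. b j * x ^ j)) has_integral
           (\<Sum>i\<le>N. \<Sum>j\<le>N. a i * b j / real (Suc (m + i + j)))) {0..1}"
proof -
  have "((\<lambda>x. \<Sum>i\<le>N. \<Sum>j\<le>N. a i * b j * x ^ (m + i + j)) has_integral
           (\<Sum>i\<le>N. \<Sum>j\<le>N. a i * b j * (1 / real (Suc (m + i + j))))) {0..1}"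
    by (intro has_integral_sum has_integral_mult_right has_integral_power01) auto
  moreover have "(\<Sum>i\<le>N. \<Sum>j\<le>N. a i * b j * x ^ (m + i + j)) =
        x ^ m * (\<Sum>i\<le>N. a i * x ^ i) * (\<Sum>j\<le>N. b j * x ^ j)" for x
    by (simp add: mult.assoc sum_product) (simp add: sum_distrib_left power_add algebra_simps)
  ultimately show ?thesis by simp
qed

text \<open>1 / (i + j + 4) is the integral of x^(i + j + 3) over the unit interval, so the form is
  the integral of x^3 times the squared modulus of the polynomial with coefficients
  \<open>w\<close>. Real and imaginary parts are treated separately.\<close>

lemma hilbert_form_nonneg:
  fixes w :: "nat \<Rightarrow> complex"
  shows "0 \<le> Re (\<Sum>i\<le>N. \<Sum>j\<le>N. w i * cnj (w j) / of_nat (i + j + 4))"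
proof -
  have *: "0 \<le> (\<Sum>i\<le>N. \<Sum>j\<le>N. v i * v j / real (Suc (3 + i + j)))" for v :: "nat \<Rightarrow> real"
  proof (rule has_integral_nonneg[OF has_integral_double_sum01])
    fix x :: real assume "x \<in> {0..1}"
    then show "0 \<le> x ^ 3 * (\<Sum>i\<le>N. v i * x ^ i) * (\<Sum>j\<le>N. v j * x ^ j)"
      by (simp add: mult.assoc)
  qed
  have "Re (w i * cnj (w j) / of_nat (i + j + 4)) =
      Re (w i) * Re (w j) / real (Suc (3 + i + j)) + Im (w i) * Im (w j) / real (Suc (3 + i + j))" for i j
    by (subst of_nat_Suc[symmetric] | simp only: Re_divide_of_nat)+
       (simp add: add_divide_distrib algebra_simps)
  then show ?thesis
    using *[of "\<lambda>i. Re (w i)"] *[of "\<lambda>i. Im (w i)"] by (simp add: sum.distrib)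
qed

text \<open>With P the polynomial with coefficients \<open>w\<close>, the sum is the Laplace
  transform at \<open>z\<close> of the autocorrelation of exp (- 2 v) P (exp (- v)). Its sign is
  seen algebraically: twice the real part is |sum a_i|^2 plus 2 Re z times a Hilbert form in
  \<open>a\<close>.\<close>

lemma autocorrelation_Laplace_nonneg:
  fixes w :: "nat \<Rightarrow> real" and z :: complex
  assumes z: "Re z \<ge> 0"
  shows "0 \<le> Re (\<Sum>i\<le>N. (w i * (\<Sum>j\<le>N. w j / real (i + j + 4))) / (z + of_nat (i + 2)))"
proof -
  define a where "a i = w i / (z + of_nat (i + 2))" for i
  have nz: "z + of_nat (i + 2) \<noteq> 0" for i
  proof
    assume "z + of_nat (i + 2) = 0"
    then have "Re (z + of_nat (i + 2)) = 0" by simp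
    then show False using z by simp
  qed
  define c where "c i j = complex_of_real (w i) * complex_of_real (w j) / of_nat (i + j + 4)" for i j
  have c_sym: "c i j = c j i" for i j by (simp add: c_def mult.commute add.commute)
  define S where "S = (\<Sum>i\<le>N. \<Sum>j\<le>N. c i j / (z + of_nat (i + 2)))"
  have S: "(\<Sum>i\<le>N. (w i * (\<Sum>j\<le>N. w j / real (i + j + 4))) / (z + of_nat (i + 2))) = S"
    unfolding S_def c_def by (intro sum.cong refl) (simp add: sum_distrib_left sum_divide_distrib)
  have "cnj S = (\<Sum>i\<le>N. \<Sum>j\<le>N. c i j / cnj (z + of_nat (i + 2)))"
    unfolding S_def c_def by simp
  also have "\<dots> = (\<Sum>j\<le>N. \<Sum>i\<le>N. c i j / cnj (z + of_nat (i + 2)))"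
    by (rule sum.swap)
  also have "\<dots> = (\<Sum>i\<le>N. \<Sum>j\<le>N. c i j / cnj (z + of_nat (j + 2)))"
    by (simp only: c_sym)
  finally have "S + cnj S = (\<Sum>i\<le>N. \<Sum>j\<le>N. c i j / (z + of_nat (i + 2)) + c i j / cnj (z + of_nat (j + 2)))"
    unfolding S_def by (simp only: sum.distrib)
  also have "\<dots> = (\<Sum>i\<le>N. \<Sum>j\<le>N. a i * cnj (a j) + of_real (2 * Re z) * (a i * cnj (a j) / of_nat (i + j + 4)))"
  proof (intro sum.cong refl)
    fix i j
    define u where "u = z + of_nat (i + 2)"
    define v where "v = cnj (z + of_nat (j + 2))"
    define C where "C = (of_nat (i + j + 4) :: complex)"
    define X where "X = complex_of_real (2 * Re z)"
    have "u \<noteq> 0" "v \<noteq> 0" using nz[of i] nz[of j] unfolding u_def v_def complex_cnj_zero_iff by auto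
    moreover have "C \<noteq> 0" unfolding C_def of_nat_eq_0_iff by simp
    ultimately have 1: "C * inverse C = 1" "u * inverse u = 1" "v * inverse v = 1" by auto
    \<comment> \<open>The identity behind the lemma: 1/u + 1/v = (u + v) / (u v), and u + v splits
      into C, which cancels the denominator, and 2 Re z, which keeps it.\<close>
    have 2: "u + v = C + X" by (simp add: complex_eq_iff u_def v_def C_def X_def)
    have "W * inverse C * inverse u + W * inverse C * inverse v =
          W * (inverse u * inverse v) + X * (W * (inverse u * inverse v) * inverse C)" for W
      using 1 2 by algebra
    then have "W / C / u + W / C / v = W / (u * v) + X * (W / (u * v) / C)" for W
      by (simp only: divide_inverse inverse_mult_distrib)
    from this[of "w i * w j"] show "c i j / (z + of_nat (i + 2)) + c i j / cnj (z + of_nat (j + 2)) =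
        a i * cnj (a j) + of_real (2 * Re z) * (a i * cnj (a j) / of_nat (i + j + 4))"
      unfolding c_def a_def u_def[symmetric] v_def[symmetric] C_def[symmetric] X_def[symmetric]
      by (simp add: u_def v_def)
  qed
  also have "\<dots> = (\<Sum>i\<le>N. a i) * cnj (\<Sum>i\<le>N. a i) +
        of_real (2 * Re z) * (\<Sum>i\<le>N. \<Sum>j\<le>N. a i * cnj (a j) / of_nat (i + j + 4))"
  proof -
    have "(\<Sum>i\<le>N. a i) * cnj (\<Sum>i\<le>N. a i) = (\<Sum>i\<le>N. \<Sum>j\<le>N. a i * cnj (a j))"
      by (simp only: cnj_sum sum_product)
    then show ?thesis by (simp only: sum.distrib sum_distrib_left)
  qed
  finally have eq: "S + cnj S = (\<Sum>i\<le>N. a i) * cnj (\<Sum>i\<le>N. a i) +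
        of_real (2 * Re z) * (\<Sum>i\<le>N. \<Sum>j\<le>N. a i * cnj (a j) / of_nat (i + j + 4))" .
  have "2 * Re S = Re (S + cnj S)" by simp
  also have "\<dots> = (cmod (\<Sum>i\<le>N. a i))\<^sup>2 +
        (2 * Re z) * Re (\<Sum>i\<le>N. \<Sum>j\<le>N. a i * cnj (a j) / of_nat (i + j + 4))"
    unfolding eq complex_norm_square[symmetric] by simp
  also have "\<dots> \<ge> 0"
    by (intro add_nonneg_nonneg mult_nonneg_nonneg hilbert_form_nonneg) (use z in auto)
  finally show ?thesis unfolding S by simp
qed

section \<open>From a weight function to a finite kernel\<close>

text \<open>Polynomials approximating \<open>W\<close> give kernels as in
  \<open>autocorrelation_Laplace_nonneg\<close>. Before normalisation the sum of their coefficients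
  and the sums with weights 1 / (i + 2) and 1 / (i + 1) tend to u, v^2 / 2 and z. As the inequality
  for \<open>K\<close> is strict, it holds for some approximation, and division by the sum of the
  coefficients normalises the kernel.\<close>

lemma kernel_of_nonneg_function:
  fixes W S :: "real \<Rightarrow> real" and p q K :: real
  assumes W: "continuous_on {0..1} W" "\<And>x. x \<in> {0..1} \<Longrightarrow> W x \<ge> 0"
    and S: "continuous_on {0..1} S" "\<And>x. x \<in> {0..1} \<Longrightarrow> (W has_integral S x) {0..x}"
    and I0: "((\<lambda>x. x ^ 3 * W x * W x) has_integral u) {0..1}" and u: "u > 0"
    and I1: "((\<lambda>x. x * W x) has_integral v) {0..1}"
    and I2: "((\<lambda>x. x\<^sup>2 * S x * W x) has_integral z) {0..1}"
    and K: "K * u < p * (v\<^sup>2 / 2) - q * z"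
  shows "\<exists>N c \<mu>. \<mu> > 0 \<and> (\<forall>y\<in>{0..1}. (\<Sum>i\<le>N. c i * y ^ i) \<ge> \<mu>) \<and>
     (\<forall>w::complex. Re w \<ge> 2 \<longrightarrow> \<mu> * Re (1 / w) \<le> Re (\<Sum>i\<le>N. c i / (w + of_nat i))) \<and>
     (\<Sum>i\<le>N. c i) = 1 \<and>
     K < p * (\<Sum>i\<le>N. c i / real (i + 2)) - q * (\<Sum>i\<le>N. c i / real (i + 1))"
proof -
  have "\<exists>a N. \<forall>x\<in>{0..1}. \<bar>W x - (\<Sum>i\<le>N. a i * x ^ i)\<bar> < 1 / real (Suc n)" for n
  proof -
    obtain g where g: "real_polynomial_function g" "\<And>x. x \<in> {0..1} \<Longrightarrow> \<bar>W x - g x\<bar> < 1 / real (Suc n)"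
      using Stone_Weierstrass_real_polynomial_function[of "{0..1::real}" W "1 / real (Suc n)"] W(1) by auto
    then show ?thesis unfolding real_polynomial_function_iff_sum by blast
  qed
  then obtain a N where aN: "\<And>n x. x \<in> {0..1} \<Longrightarrow> \<bar>W x - (\<Sum>i\<le>N n. a n i * x ^ i)\<bar> < 1 / real (Suc n)"
    by metis
  \<comment> \<open>Raising the constant coefficient by the approximation error makes the
    polynomials nonnegative on the unit interval, as \<open>W\<close> is.\<close>
  define w where "w n i = a n i + (if i = 0 then 1 / real (Suc n) else 0)" for n i
  define P where "P n x = (\<Sum>i\<le>N n. w n i * x ^ i)" for n x
  \<comment> \<open>x times \<open>Q n x\<close> is the antiderivative of \<open>P n\<close>
    vanishing at 0, the counterpart of \<open>S\<close>.\<close>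
  define Q where "Q n x = (\<Sum>i\<le>N n. w n i / real (i + 1) * x ^ i)" for n x
  have P_eq: "P n x = (\<Sum>i\<le>N n. a n i * x ^ i) + 1 / real (Suc n)" for n x
  proof -
    have "P n x = (\<Sum>i\<le>N n. a n i * x ^ i + (if i = 0 then 1 / real (Suc n) else 0))"
      unfolding P_def w_def by (intro sum.cong) (auto simp: algebra_simps)
    then show ?thesis by (simp add: sum.distrib sum.delta')
  qed
  have P_nonneg: "P n x \<ge> 0" if "x \<in> {0..1}" for n x
    using aN[OF that, of n] W(2)[OF that] unfolding P_eq by linarith
  have P_close: "\<bar>P n x - W x\<bar> \<le> 2 * inverse (real (Suc n))" if "x \<in> {0..1}" for n x
    using aN[OF that, of n] unfolding P_eq by (simp add: inverse_eq_divide)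
  have small: "(\<lambda>n. 2 * inverse (real (Suc n))) \<longlonglongrightarrow> 0"
    using tendsto_mult[OF tendsto_const[of 2] LIMSEQ_inverse_real_of_nat] by simp
  have small': "\<forall>\<^sub>F n in sequentially. 2 * inverse (real (Suc n)) < e" if "e > 0" for e
    using order_tendstoD(2)[OF small that] .
  have lim_P: "uniform_limit {0..1} P W sequentially"
    unfolding uniform_limit_iff
  proof (intro allI impI)
    fix e :: real assume "e > 0"
    from small'[OF this] show "\<forall>\<^sub>F n in sequentially. \<forall>x\<in>{0..1}. dist (P n x) (W x) < e"
    proof eventually_elim
      case (elim n)
      then show ?case unfolding dist_real_def using le_less_trans[OF P_close] by blast
    qed
  qed
  have int_P: "(P n has_integral x * Q n x) {0..x}" if "x \<in> {0..1}" for n x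
  proof -
    have "(P n has_integral (x * Q n x - 0 * Q n 0)) {0..x}"
    proof (rule fundamental_theorem_of_calculus)
      show "0 \<le> x" using that by simp
      fix y :: real
      have "((\<lambda>y. \<Sum>i\<le>N n. w n i / real (i + 1) * y ^ Suc i) has_real_derivative
              (\<Sum>i\<le>N n. w n i / real (i + 1) * (real (Suc i) * y ^ i))) (at y within {0..x})"
      proof (intro DERIV_sum DERIV_cmult)
        show "((\<lambda>y. y ^ Suc i) has_real_derivative real (Suc i) * y ^ i) (at y within {0..x})" for i
          using DERIV_pow[of "Suc i" y] by simp
      qed
      also have "(\<lambda>y. \<Sum>i\<le>N n. w n i / real (i + 1) * y ^ Suc i) = (\<lambda>y. y * Q n y)"
        unfolding Q_def by (auto simp: sum_distrib_left mult_ac)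
      also have "(\<Sum>i\<le>N n. w n i / real (i + 1) * (real (Suc i) * y ^ i)) = P n y"
        unfolding P_def by (rule sum.cong) auto
      finally show "((\<lambda>y. y * Q n y) has_vector_derivative P n y) (at y within {0..x})"
        by (simp add: has_real_derivative_iff_has_vector_derivative)
    qed
    then show ?thesis by simp
  qed
  have lim_Q: "uniform_limit {0..1} (\<lambda>n x. x * Q n x) S sequentially"
    unfolding uniform_limit_iff
  proof (intro allI impI)
    fix e :: real assume "e > 0"
    from small'[OF this] show "\<forall>\<^sub>F n in sequentially. \<forall>x\<in>{0..1}. dist (x * Q n x) (S x) < e"
    proof eventually_elim
      case (elim n)
      show ?case
      proof
        fix x :: real assume x: "x \<in> {0..1}"
        have "((\<lambda>y. P n y - W y) has_integral (x * Q n x - S x)) (cbox 0 x)"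
          using has_integral_diff[OF int_P[OF x] S(2)[OF x]] by simp
        then have "norm (x * Q n x - S x) \<le> 2 * inverse (real (Suc n)) * measure lborel (cbox 0 x)"
          by (rule has_integral_bound[rotated]) (use P_close x in auto)
        also have "\<dots> \<le> 2 * inverse (real (Suc n)) * 1"
          using x by (intro mult_left_mono) auto
        finally show "dist (x * Q n x) (S x) < e" using elim by (simp add: dist_real_def)
      qed
    qed
  qed
  have bW: "bounded (W ` {0..1})" and bS: "bounded (S ` {0..1})"
    using W(1) S(1) by (auto intro!: compact_imp_bounded compact_continuous_image)
  have bx: "bounded ((\<lambda>x::real. x ^ k) ` {0..1})" for k
    by (auto intro!: compact_imp_bounded compact_continuous_image continuous_intros)
  have contP: "continuous_on {0..1} (P n)" and contQ: "continuous_on {0..1} (Q n)" for n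
    unfolding P_def Q_def by (intro continuous_intros)+
  have prod_lim: "I \<longlonglongrightarrow> J"
    if "uniform_limit {0..1} F G sequentially" "\<And>n. continuous_on {0..1} (F n)"
      "\<And>n. (F n has_integral I n) {0..1}" "(G has_integral J) {0..1}"
    for F :: "nat \<Rightarrow> real \<Rightarrow> real" and G I J
  proof -
    note asm = that
    obtain I' J' where IJ: "\<And>n. (F n has_integral I' n) {0..1}" "(G has_integral J') {0..1}" "I' \<longlonglongrightarrow> J'"
      using uniform_limit_integral[OF asm(1,2)] by auto
    have "I' = I" "J' = J" using IJ asm(3,4) by (auto intro: has_integral_unique)
    then show ?thesis using IJ(3) by simp
  qed
  have ulx: "uniform_limit {0..1} (\<lambda>n x. x ^ k) (\<lambda>x::real. x ^ k) sequentially" for k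
    by (rule uniform_limit_const)
  have bxW: "bounded ((\<lambda>x. x ^ k * W x) ` {0..1})" "bounded ((\<lambda>x. x ^ k * S x) ` {0..1})" for k
    using W(1) S(1) by (auto intro!: compact_imp_bounded compact_continuous_image continuous_intros)
  define A where "A n = (\<Sum>i\<le>N n. \<Sum>j\<le>N n. w n i * w n j / real (i + j + 4))" for n
  define B where "B n = (\<Sum>i\<le>N n. w n i / real (i + 2))" for n
  define D where "D n = (\<Sum>i\<le>N n. \<Sum>j\<le>N n. w n i / real (i + 1) * w n j / real (i + j + 4))" for n
  have A_int: "((\<lambda>x. x ^ 3 * P n x * P n x) has_integral A n) {0..1}" for n
    using has_integral_double_sum01[where m = 3 and N = "N n" and a = "w n" and b = "w n"]
    unfolding P_def A_def by (simp add: algebra_simps)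
  have D_int: "((\<lambda>x. x\<^sup>2 * (x * Q n x) * P n x) has_integral D n) {0..1}" for n
    using has_integral_double_sum01[where m = 3 and N = "N n" and b = "w n" and a = "\<lambda>i. w n i / real (i + 1)"]
    unfolding P_def D_def Q_def by (simp add: algebra_simps eval_nat_numeral)
  have B_int: "((\<lambda>x. x ^ 1 * P n x) has_integral B n) {0..1}" for n
  proof -
    have "((\<lambda>x. \<Sum>i\<le>N n. w n i * x ^ (i + 1)) has_integral (\<Sum>i\<le>N n. w n i * (1 / real (Suc (i + 1))))) {0..1}"
      by (intro has_integral_sum has_integral_mult_right has_integral_power01) auto
    moreover have "(\<Sum>i\<le>N n. w n i * x ^ (i + 1)) = x ^ 1 * P n x" for x
      unfolding P_def by (simp add: sum_distrib_left algebra_simps)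
    ultimately show ?thesis by (simp add: B_def)
  qed
  have limA: "A \<longlonglongrightarrow> u"
    by (rule prod_lim[OF _ _ A_int I0])
       (auto intro!: uniform_lim_mult ulx lim_P bW bx bxW continuous_intros contP)
  have limB: "B \<longlonglongrightarrow> v"
    by (rule prod_lim[OF uniform_lim_mult[OF ulx[of 1] lim_P bx[of 1] bW] _ B_int])
       (use I1 in \<open>auto intro!: continuous_intros contP\<close>)
  have limD: "D \<longlonglongrightarrow> z"
    by (rule prod_lim[OF _ _ D_int I2])
       (auto intro!: uniform_lim_mult ulx lim_P lim_Q bW bS bx bxW continuous_intros contP contQ)
  \<comment> \<open>A small extra weight at i = 0 makes the lower bound for the kernel polynomial
    strictly positive and supplies the multiple of Re (1 / w) in the Laplace bound; it disappears in
    the limit.\<close>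
  define \<tau> where "\<tau> n = inverse (real (Suc n))" for n
  have \<tau>: "\<tau> \<longlonglongrightarrow> 0" unfolding \<tau>_def by (rule LIMSEQ_inverse_real_of_nat)
  have "(\<lambda>n. p * ((B n)\<^sup>2 / 2 + \<tau> n / 2) - q * (D n + \<tau> n) - K * (A n + \<tau> n)) \<longlonglongrightarrow>
          p * (v\<^sup>2 / 2 + 0 / 2) - q * (z + 0) - K * (u + 0)"
    by (intro tendsto_intros limA limB limD \<tau>) simp_all
  then have "\<forall>\<^sub>F n in sequentially. p * ((B n)\<^sup>2 / 2 + \<tau> n / 2) - q * (D n + \<tau> n) - K * (A n + \<tau> n) > 0"
    by (rule order_tendstoD(1)) (use K in simp)
  moreover have "\<forall>\<^sub>F n in sequentially. A n > 0"
    by (rule order_tendstoD(1)[OF limA u])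
  ultimately have "\<forall>\<^sub>F n in sequentially. A n > 0 \<and> p * ((B n)\<^sup>2 / 2 + \<tau> n / 2) - q * (D n + \<tau> n) - K * (A n + \<tau> n) > 0"
    by eventually_elim simp
  then obtain n where n: "A n > 0" "p * ((B n)\<^sup>2 / 2 + \<tau> n / 2) - q * (D n + \<tau> n) - K * (A n + \<tau> n) > 0"
    using eventually_happens'[OF sequentially_bot] by blast
  have \<tau>n: "\<tau> n > 0" by (simp add: \<tau>_def)
  define C where "C = A n + \<tau> n"
  have C: "C > 0" using n \<tau>n by (simp add: C_def)
  define c0 where "c0 i = w n i * (\<Sum>j\<le>N n. w n j / real (i + j + 4))" for i
  define c where "c i = (c0 i + (if i = 0 then \<tau> n else 0)) / C" for i
  have c_sum: "(\<Sum>i\<le>N n. c i * f i) = ((\<Sum>i\<le>N n. c0 i * f i) + \<tau> n * f 0) / C" for f :: "nat \<Rightarrow> real"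
  proof -
    have "(\<Sum>i\<le>N n. c i * f i) = (\<Sum>i\<le>N n. c0 i * f i / C + (if i = 0 then \<tau> n * f 0 / C else 0))"
      unfolding c_def by (intro sum.cong) (auto simp: add_divide_distrib algebra_simps)
    also have "\<dots> = (\<Sum>i\<le>N n. c0 i * f i) / C + \<tau> n * f 0 / C"
      by (simp add: sum.distrib sum_divide_distrib)
    finally show ?thesis by (simp only: add_divide_distrib)
  qed
  have c0_sum: "(\<Sum>i\<le>N n. c0 i * f i) = (\<Sum>i\<le>N n. \<Sum>j\<le>N n. w n i * w n j * f i / real (i + j + 4))"
    for f :: "nat \<Rightarrow> real"
    unfolding c0_def by (intro sum.cong refl) (simp add: sum_distrib_left sum_distrib_right algebra_simps)
  have pos: "(\<Sum>i\<le>N n. c i * y ^ i) \<ge> \<tau> n / C" if y: "y \<in> {0..1}" for y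
  proof -
    \<comment> \<open>The kernel polynomial at y is the integral of x^3 P (y x) P x, a correlation
      of P with its dilate, so it inherits the sign of P.\<close>
    have "((\<lambda>x. x ^ 3 * (\<Sum>i\<le>N n. (w n i * y ^ i) * x ^ i) * (\<Sum>j\<le>N n. w n j * x ^ j)) has_integral
           (\<Sum>i\<le>N n. \<Sum>j\<le>N n. (w n i * y ^ i) * w n j / real (Suc (3 + i + j)))) {0..1}"
      by (rule has_integral_double_sum01)
    also have "(\<lambda>x. x ^ 3 * (\<Sum>i\<le>N n. (w n i * y ^ i) * x ^ i) * (\<Sum>j\<le>N n. w n j * x ^ j)) =
               (\<lambda>x. x ^ 3 * P n (y * x) * P n x)"
      unfolding P_def by (simp add: power_mult_distrib algebra_simps)
    finally have "0 \<le> (\<Sum>i\<le>N n. \<Sum>j\<le>N n. (w n i * y ^ i) * w n j / real (Suc (3 + i + j)))"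
    proof (rule has_integral_nonneg)
      fix x :: real assume x: "x \<in> {0..1}"
      have "y * x \<in> {0..1}" using x y by (auto intro: mult_le_one)
      then show "0 \<le> x ^ 3 * P n (y * x) * P n x" using P_nonneg x by auto
    qed
    then have "0 \<le> (\<Sum>i\<le>N n. c0 i * y ^ i)"
      unfolding c0_sum by (simp add: algebra_simps)
    then show ?thesis unfolding c_sum using C by (simp add: divide_right_mono)
  qed
  have lap: "\<tau> n / C * Re (1 / w) \<le> Re (\<Sum>i\<le>N n. c i / (w + of_nat i))" if w: "Re w \<ge> 2" for w :: complex
  proof -
    have "0 \<le> Re (\<Sum>i\<le>N n. c0 i / ((w - 2) + of_nat (i + 2)))"
      unfolding c0_def by (rule autocorrelation_Laplace_nonneg) (use w in simp)
    moreover have "(w - 2) + of_nat (i + 2) = w + of_nat i" for i by simp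
    ultimately have 1: "0 \<le> Re (\<Sum>i\<le>N n. c0 i / (w + of_nat i))" by simp
    have "(\<Sum>i\<le>N n. complex_of_real (c i) / (w + of_nat i)) =
         (\<Sum>i\<le>N n. (c0 i / (w + of_nat i)) / C + (if i = 0 then of_real (\<tau> n / C) / w else 0))"
      unfolding c_def by (intro sum.cong) (auto simp: add_divide_distrib)
    also have "\<dots> = (\<Sum>i\<le>N n. c0 i / (w + of_nat i)) / of_real C + of_real (\<tau> n / C) * (1 / w)"
      by (simp add: sum.distrib sum_divide_distrib sum.delta')
    finally have "Re (\<Sum>i\<le>N n. c i / (w + of_nat i)) = Re (\<Sum>i\<le>N n. c0 i / (w + of_nat i)) / C + \<tau> n / C * Re (1 / w)"
      by (simp only: plus_complex.sel Re_divide_of_real times_complex.sel Re_complex_of_real Im_complex_of_real)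
    then show ?thesis using 1 C by simp
  qed
  have sum1: "(\<Sum>i\<le>N n. c i) = 1"
    using c_sum[of "\<lambda>_. 1"] c0_sum[of "\<lambda>_. 1"] C by (simp add: C_def A_def)
  have s2: "(\<Sum>i\<le>N n. c i / real (i + 2)) = ((B n)\<^sup>2 / 2 + \<tau> n / 2) / C"
  proof -
    let ?s = "\<Sum>i\<le>N n. \<Sum>j\<le>N n. w n i * w n j * (1 / real (i + 2)) / real (i + j + 4)"
    have "?s = (\<Sum>j\<le>N n. \<Sum>i\<le>N n. w n i * w n j * (1 / real (i + 2)) / real (i + j + 4))"
      by (rule sum.swap)
    \<comment> \<open>Symmetrising in i and j replaces 1 / (i + 2) by (i + j + 4) / (2 (i + 2) (j +
      2)); the factor i + j + 4 cancels and the double sum becomes half a square.\<close>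
    then have "2 * ?s = (\<Sum>i\<le>N n. \<Sum>j\<le>N n. w n i * w n j * (1 / real (i + 2)) / real (i + j + 4)
        + w n j * w n i * (1 / real (j + 2)) / real (j + i + 4))"
      by (simp add: sum.distrib)
    also have "\<dots> = (\<Sum>i\<le>N n. \<Sum>j\<le>N n. (w n i / real (i + 2)) * (w n j / real (j + 2)))"
      by (intro sum.cong refl) (simp add: divide_simps, simp add: algebra_simps)
    also have "\<dots> = (B n)\<^sup>2"
      unfolding B_def power2_eq_square by (simp add: sum_product)
    finally have "?s = (B n)\<^sup>2 / 2" by simp
    then show ?thesis using c_sum[of "\<lambda>i. 1 / real (i + 2)"] c0_sum[of "\<lambda>i. 1 / real (i + 2)"] by simp
  qed
  have s1: "(\<Sum>i\<le>N n. c i / real (i + 1)) = (D n + \<tau> n) / C"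
    using c_sum[of "\<lambda>i. 1 / real (i + 1)"] c0_sum[of "\<lambda>i. 1 / real (i + 1)"]
    by (simp add: D_def algebra_simps)
  have "K * C < p * ((B n)\<^sup>2 / 2 + \<tau> n / 2) - q * (D n + \<tau> n)"
    using n(2) by (simp add: C_def)
  then have "K < (p * ((B n)\<^sup>2 / 2 + \<tau> n / 2) - q * (D n + \<tau> n)) / C"
    using C by (simp add: pos_less_divide_eq)
  also have "\<dots> = p * (\<Sum>i\<le>N n. c i / real (i + 2)) - q * (\<Sum>i\<le>N n. c i / real (i + 1))"
    unfolding s1 s2 by (simp add: diff_divide_distrib)
  finally show ?thesis
    using pos lap sum1 C \<tau>n by (intro exI[of _ "N n"] exI[of _ c] exI[of _ "\<tau> n / C"]) auto
qed

text \<open>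
  In terms of \<open>u = - ln x\<close> the function below, supported on \<open>0.35 \<le> x \<le> 1\<close>, is a polynomial
  approximation to the extremal weight; it comes within 0.2 percent of the optimum.
\<close>

lemma kernel_exists:
  "\<exists>N c \<mu>. \<mu> > 0 \<and> (\<forall>y\<in>{0..1}. (\<Sum>i\<le>N. c i * y ^ i) \<ge> \<mu>) \<and>
     (\<forall>w::complex. Re w \<ge> 2 \<longrightarrow> \<mu> * Re (1 / w) \<le> Re (\<Sum>i\<le>N. c i / (w + of_nat i))) \<and>
     (\<Sum>i\<le>N. c i) = 1 \<and>
     106.3 < 1057 * (\<Sum>i\<le>N. c i / real (i + 2)) - 609 * (\<Sum>i\<le>N. c i / real (i + 1))"
proof -
  define W where "W x = max 0 (x - 7/20) * ((1 - x) * (250 - 534 * x + 301 * x\<^sup>2))" for x :: real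
  \<comment> \<open>Antiderivative of the polynomial that \<open>W\<close> equals from 7/20 on. The
    constant term makes it vanish at 7/20, so that \<open>S\<close> is the integral of
    \<open>W\<close> from 0.\<close>
  define G where "G x = - 301/5 * x^5 + 18807/80 * x^4 - 1435/4 * x^3 + 1311/5 * x\<^sup>2 - 175/2 * x
      + 683219593/64000000" for x :: real
  define S where "S x = (if x \<le> 7/20 then 0 else G x)" for x :: real
  have W1: "W x = 0" if "x \<le> 7/20" for x
    unfolding W_def using that by (simp only: max_absorb1 diff_le_0_iff_le mult_zero_left)
  have W2: "W x = - 301 * x^4 + 18807/20 * x^3 - 4305/4 * x\<^sup>2 + 2622/5 * x - 175/2" if "x \<ge> 7/20" for x
  proof -
    have "W x = (x - 7/20) * ((1 - x) * (250 - 534 * x + 301 * x\<^sup>2))"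
      unfolding W_def using that by (simp only: max_absorb2 diff_ge_0_iff_ge)
    also have "\<dots> = - 301 * x^4 + 18807/20 * x^3 - 4305/4 * x\<^sup>2 + 2622/5 * x - 175/2"
      by (simp add: algebra_simps power2_eq_square power3_eq_cube power4_eq_xxxx)
    finally show ?thesis .
  qed
  have contW: "continuous_on {0..1} W" unfolding W_def by (intro continuous_intros)
  have posW: "W x \<ge> 0" if "x \<in> {0..1}" for x
  proof -
    have "301 * (250 - 534 * x + 301 * x\<^sup>2) = (301 * x - 267)\<^sup>2 + 3961"
      by (simp add: power2_eq_square algebra_simps)
    then have "301 * (250 - 534 * x + 301 * x\<^sup>2) \<ge> 0"
      by (metis add_nonneg_nonneg zero_le_numeral zero_le_power2)
    then have "250 - 534 * x + 301 * x\<^sup>2 \<ge> 0"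
      by (simp only: zero_le_mult_iff) linarith
    then show ?thesis unfolding W_def using that by (intro mult_nonneg_nonneg) auto
  qed
  have G0: "G (7/20) = 0" by (simp add: G_def power_divide)
  have split: "(f has_integral J) {0..b}"
    if "\<And>x. x \<in> {0..7/20} \<Longrightarrow> f x = 0" "(f has_integral J) {7/20..b}" "7/20 \<le> b"
    for f :: "real \<Rightarrow> real" and J b
  proof -
    have left: "(f has_integral 0) {0..7/20}"
      by (rule has_integral_eq[OF _ has_integral_0]) (simp add: that(1))
    have "(f has_integral 0 + J) {0..b}"
      by (rule has_integral_combine[OF _ that(3) left that(2)]) simp
    then show ?thesis by (simp only: add_0_left)
  qed
  have ftc: "(f has_integral (H b - H (7/20))) {0..b}"
    if "\<And>x. (H has_real_derivative h x) (at x)" "\<And>x. x \<ge> 7/20 \<Longrightarrow> f x = h x"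
       "\<And>x. x \<in> {0..7/20} \<Longrightarrow> f x = 0" "7/20 \<le> b"
    for f h H :: "real \<Rightarrow> real" and b
  proof (rule split)
    have "(h has_integral (H b - H (7/20))) {7/20..b}"
    proof (rule fundamental_theorem_of_calculus[OF that(4)])
      fix x
      show "(H has_vector_derivative h x) (at x within {7/20..b})"
        using has_field_derivative_at_within[OF that(1)]
        by (simp only: has_real_derivative_iff_has_vector_derivative)
    qed
    then show "(f has_integral (H b - H (7/20))) {7/20..b}"
      by (rule has_integral_eq[rotated]) (simp add: that(2))
  qed (rule that(3), assumption, rule that(4))
  have dG: "(G has_real_derivative (- 301 * x^4 + 18807/20 * x^3 - 4305/4 * x\<^sup>2 + 2622/5 * x - 175/2)) (at x)" for x
    unfolding G_def by (auto intro!: derivative_eq_intros)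
  have contS: "continuous_on {0..1} S"
  proof -
    have "continuous_on ({0..7/20} \<union> {7/20..1}) (\<lambda>x. if x \<le> 7/20 then 0 else G x)"
    proof (rule continuous_on_If)
      show "continuous_on {7/20..1} G" unfolding G_def[abs_def] by (intro continuous_intros)
      show "0 = G x" if "x \<in> {7/20..1}" "x \<le> 7/20" for x
        using that G0 by (metis atLeastAtMost_iff antisym)
    qed simp_all
    also have "{0..7/20} \<union> {7/20..1} = {0..1::real}" by (rule ivl_disj_un_two_touch) simp_all
    finally show ?thesis unfolding S_def[abs_def] .
  qed
  have intS: "(W has_integral S x) {0..x}" if "x \<in> {0..1}" for x
  proof (cases "x \<le> 7/20")
    case True
    have "((\<lambda>_. 0::real) has_integral 0) {0..x}" by (rule has_integral_0)
    then have "(W has_integral 0) {0..x}"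
      by (rule has_integral_eq[rotated]) (use True W1 in auto)
    then show ?thesis using True by (simp add: S_def)
  next
    case False
    then show ?thesis using ftc[OF dG W2 W1, of x] by (simp add: S_def G0)
  qed
  define H0 where "H0 x = 90601/12 * x^12 - 5660907/110 * x^11 + 612864249/4000 * x^10 - 93591687/360 * x^9
     + 878891257/3200 * x^8 - 5173329/28 * x^7 + 46333911/600 * x^6 - 91770/5 * x^5 + 30625/16 * x^4" for x :: real
  have I0: "((\<lambda>x. x ^ 3 * W x * W x) has_integral (H0 1 - H0 (7/20))) {0..1}"
  proof (rule ftc)
    fix x
    show "(H0 has_real_derivative (90601 * x^11 - 5660907/10 * x^10 + 612864249/400 * x^9 - 93591687/40 * x^8
     + 878891257/400 * x^7 - 5173329/4 * x^6 + 46333911/100 * x^5 - 91770 * x^4 + 30625/4 * x^3)) (at x)"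
      unfolding H0_def by (auto intro!: derivative_eq_intros)
  next
    fix x :: real assume "x \<ge> 7/20"
    show "x ^ 3 * W x * W x = (90601 * x^11 - 5660907/10 * x^10 + 612864249/400 * x^9 - 93591687/40 * x^8
     + 878891257/400 * x^7 - 5173329/4 * x^6 + 46333911/100 * x^5 - 91770 * x^4 + 30625/4 * x^3)"
      unfolding W2[OF \<open>x \<ge> 7/20\<close>] by algebra
  qed (simp_all add: W1)
  define H1 where "H1 x = - 301/6 * x^6 + 18807/100 * x^5 - 4305/16 * x^4 + 2622/15 * x^3 - 175/4 * x\<^sup>2" for x :: real
  have I1: "((\<lambda>x. x * W x) has_integral (H1 1 - H1 (7/20))) {0..1}"
  proof (rule ftc)
    fix x
    show "(H1 has_real_derivative (- 301 * x^5 + 18807/20 * x^4 - 4305/4 * x^3 + 2622/5 * x\<^sup>2 - 175/2 * x)) (at x)"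
      unfolding H1_def by (auto intro!: derivative_eq_intros)
  next
    fix x :: real assume "x \<ge> 7/20"
    show "x * W x = (- 301 * x^5 + 18807/20 * x^4 - 4305/4 * x^3 + 2622/5 * x\<^sup>2 - 175/2 * x)"
      unfolding W2[OF \<open>x \<ge> 7/20\<close>] by algebra
  qed (simp_all add: W1)
  define H2 where "H2 x = 90601/60 * x^12 - 50948163/4400 * x^11 + 630141649/16000 * x^10 - 1121367303/14400 * x^9
    + 315019737/3200 * x^8 - 36888659097493/448000000 * x^7 + 349566341285551/7680000000 * x^6
    - 4112220069573/256000000 * x^5 + 2120700886423/640000000 * x^4 - 4782537151/15360000 * x^3" for x :: real
  have I2: "((\<lambda>x. x\<^sup>2 * S x * W x) has_integral (H2 1 - H2 (7/20))) {0..1}"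
  proof (rule ftc)
    fix x
    show "(H2 has_real_derivative (90601/5 * x^11 - 50948163/400 * x^10 + 630141649/1600 * x^9 - 1121367303/1600 * x^8
    + 315019737/400 * x^7 - 36888659097493/64000000 * x^6 + 349566341285551/1280000000 * x^5
    - 4112220069573/51200000 * x^4 + 2120700886423/160000000 * x^3 - 4782537151/5120000 * x\<^sup>2)) (at x)"
      unfolding H2_def by (auto intro!: derivative_eq_intros)
  next
    fix x :: real assume x: "x \<ge> 7/20"
    have "S x = G x"
    proof (cases "x = 7/20")
      case True
      then show ?thesis unfolding S_def True G0 by simp
    next
      case False
      then show ?thesis using x by (simp add: S_def)
    qed
    show "x\<^sup>2 * S x * W x = (90601/5 * x^11 - 50948163/400 * x^10 + 630141649/1600 * x^9 - 1121367303/1600 * x^8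
    + 315019737/400 * x^7 - 36888659097493/64000000 * x^6 + 349566341285551/1280000000 * x^5
    - 4112220069573/51200000 * x^4 + 2120700886423/160000000 * x^3 - 4782537151/5120000 * x\<^sup>2)"
      unfolding W2[OF \<open>x \<ge> 7/20\<close>] \<open>S x = G x\<close> G_def by algebra
  qed (simp_all add: W1)
  \<comment> \<open>With the three integrals evaluated, an inequality between explicit rational
    numbers is left.\<close>
  show ?thesis
    by (rule kernel_of_nonneg_function[OF contW posW contS intS I0 _ I1 I2])
       (simp_all add: H0_def H1_def H2_def power_divide)
qed

section \<open>Logarithmic derivatives on a disc\<close>

lemma has_integral_abs_cos: "((\<lambda>t. \<bar>cos t\<bar>) has_integral 4) {0..2 * pi}"
proof -
  have 1: "((\<lambda>t. \<bar>cos t\<bar>) has_integral (sin (pi / 2) - sin 0)) {0..pi / 2}"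
  proof (rule has_integral_eq[rotated])
    show "(cos has_integral (sin (pi / 2) - sin 0)) {0..pi / 2}"
      by (rule fundamental_theorem_of_calculus)
         (auto intro!: derivative_eq_intros simp: has_real_derivative_iff_has_vector_derivative[symmetric])
    fix t assume "t \<in> {0..pi / 2}"
    then have "cos t \<ge> 0" by (intro cos_ge_zero) auto
    then show "cos t = \<bar>cos t\<bar>" by simp
  qed
  have 2: "((\<lambda>t. \<bar>cos t\<bar>) has_integral (- sin (3 * pi / 2) - - sin (pi / 2))) {pi / 2..3 * pi / 2}"
  proof (rule has_integral_eq[rotated])
    show "((\<lambda>t. - cos t) has_integral (- sin (3 * pi / 2) - - sin (pi / 2))) {pi / 2..3 * pi / 2}"
      by (rule fundamental_theorem_of_calculus)
         (auto intro!: derivative_eq_intros simp: has_real_derivative_iff_has_vector_derivative[symmetric])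
    fix t assume "t \<in> {pi / 2..3 * pi / 2}"
    then have "cos (t - pi) \<ge> 0" by (intro cos_ge_zero) auto
    then show "- cos t = \<bar>cos t\<bar>" by (simp add: cos_diff)
  qed
  have 3: "((\<lambda>t. \<bar>cos t\<bar>) has_integral (sin (2 * pi) - sin (3 * pi / 2))) {3 * pi / 2..2 * pi}"
  proof (rule has_integral_eq[rotated])
    show "(cos has_integral (sin (2 * pi) - sin (3 * pi / 2))) {3 * pi / 2..2 * pi}"
      by (rule fundamental_theorem_of_calculus)
         (auto intro!: derivative_eq_intros simp: has_real_derivative_iff_has_vector_derivative[symmetric])
    fix t assume "t \<in> {3 * pi / 2..2 * pi}"
    then have "cos (2 * pi - t) \<ge> 0" by (intro cos_ge_zero) auto
    then show "cos t = \<bar>cos t\<bar>" by (simp add: cos_diff)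
  qed
  have s3: "sin (3 * pi / 2) = - 1" using sin_3over2_pi by (simp add: mult.commute)
  have "((\<lambda>t. \<bar>cos t\<bar>) has_integral (sin (pi / 2) - sin 0) + (- sin (3 * pi / 2) - - sin (pi / 2))) {0..3 * pi / 2}"
    by (rule has_integral_combine[OF _ _ 1 2]) auto
  from has_integral_combine[OF _ _ this 3] show ?thesis by (simp add: s3)
qed

text \<open>Adding the Cauchy integrals of g against exp (- i t) and exp (i t), the second being 0,
  leaves pi r Re (g' 0) as the integral of Re g times cos t. Since cos t is negative on the left and
  positive on the right half circle, an upper bound is needed only on the left and a lower bound
  only on the right.\<close>

lemma Re_deriv_ge_of_half_circles:
  assumes g: "g holomorphic_on ball 0 R" and r: "0 < r" "r < R"
    and U: "\<And>z. norm z = r \<Longrightarrow> Re z \<le> 0 \<Longrightarrow> Re (g z) \<le> U"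
    and V: "\<And>z. norm z = r \<Longrightarrow> Re z \<ge> 0 \<Longrightarrow> Re (g z) \<ge> - V"
  shows "Re (deriv g 0) \<ge> - (2 / (pi * r)) * (U + V)"
proof -
  have cont: "continuous_on (cball 0 r) g" and hol: "g holomorphic_on ball 0 r"
    using r by (auto intro!: holomorphic_on_imp_continuous_on holomorphic_on_subset[OF g])
  define p where "p t = of_real r * cis t" for t
  have "((\<lambda>u. g u / (u - 0) ^ Suc 1) has_contour_integral (2 * pi * \<i>) / fact 1 * (deriv ^^ 1) g 0) (circlepath 0 r)"
    by (rule Cauchy_has_contour_integral_higher_derivative_circlepath[OF cont hol]) (use r in auto)
  then have "((\<lambda>t. g (p t) / (p t) ^ 2 * r * \<i> * cis t) has_integral 2 * pi * \<i> * deriv g 0) {0..2 * pi}"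
    unfolding circlepath_def by (subst (asm) has_contour_integral_part_circlepath_iff)
       (simp_all add: p_def power2_eq_square mult_ac)
  from has_integral_mult_right[OF this, of "r / \<i>"]
  have "((\<lambda>t. r / \<i> * (g (p t) / (p t) ^ 2 * r * \<i> * cis t)) has_integral r / \<i> * (2 * pi * \<i> * deriv g 0)) {0..2 * pi}" .
  moreover have "r / \<i> * (g (p t) / (p t) ^ 2 * r * \<i> * cis t) = g (p t) * cis (- t)" for t
  proof -
    have "cis t * cis (- t) = 1" by (simp add: cis_mult)
    then have "inverse (cis t) = cis (- t)" by (simp add: inverse_unique)
    then have "1 / cis t = cis (- t)" by (simp add: divide_inverse)
    moreover have "r / \<i> * (g (p t) / (p t) ^ 2 * r * \<i> * cis t) = g (p t) * (1 / cis t)"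
      using r by (simp add: p_def power2_eq_square field_simps)
    ultimately show ?thesis by simp
  qed
  moreover have "r / \<i> * (2 * pi * \<i> * deriv g 0) = 2 * pi * r * deriv g 0" by simp
  ultimately have 1: "((\<lambda>t. g (p t) * cis (- t)) has_integral 2 * pi * r * deriv g 0) {0..2 * pi}"
    by (simp only:)
  have "(g has_contour_integral 0) (circlepath 0 r)"
    by (rule Cauchy_theorem_convex_simple[OF g convex_ball]) (use r in auto)
  then have "((\<lambda>t. g (p t) * r * \<i> * cis t) has_integral 0) {0..2 * pi}"
    unfolding circlepath_def by (subst (asm) has_contour_integral_part_circlepath_iff) (auto simp: p_def)
  from has_integral_mult_right[OF this, of "1 / (r * \<i>)"]
  have "((\<lambda>t. 1 / (r * \<i>) * (g (p t) * r * \<i> * cis t)) has_integral 0) {0..2 * pi}" by simp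
  moreover have "1 / (r * \<i>) * (g (p t) * r * \<i> * cis t) = g (p t) * cis t" for t
    using r by (simp add: field_simps)
  ultimately have 2: "((\<lambda>t. g (p t) * cis t) has_integral 0) {0..2 * pi}" by simp
  have "((\<lambda>t. Re (g (p t) * cis (- t) + g (p t) * cis t)) has_integral Re (2 * pi * r * deriv g 0 + 0)) {0..2 * pi}"
    by (intro has_integral_Re has_integral_add 1 2)
  moreover have "Re (g (p t) * cis (- t) + g (p t) * cis t) = 2 * (Re (g (p t)) * cos t)" for t
    by simp
  moreover have "Re (2 * pi * r * deriv g 0 + 0) = 2 * pi * r * Re (deriv g 0)"
    by simp
  ultimately have A: "((\<lambda>t. 2 * (Re (g (p t)) * cos t)) has_integral 2 * pi * r * Re (deriv g 0)) {0..2 * pi}"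
    by (simp only:)
  have "(cos has_integral (sin (2 * pi) - sin 0)) {0..2 * pi}"
    by (rule fundamental_theorem_of_calculus)
       (auto intro!: derivative_eq_intros simp: has_real_derivative_iff_has_vector_derivative[symmetric])
  then have c: "(cos has_integral 0) {0..2 * pi}" by simp
  \<comment> \<open>One formula for the comparison function: 2 U cos t where cos t < 0, and - 2 V
    cos t where cos t >= 0.\<close>
  have B: "((\<lambda>t. (U - V) * cos t - (U + V) * \<bar>cos t\<bar>) has_integral (U - V) * 0 - (U + V) * 4) {0..2 * pi}"
    by (intro has_integral_diff has_integral_mult_right c has_integral_abs_cos)
  have "(U - V) * 0 - (U + V) * 4 \<le> 2 * pi * r * Re (deriv g 0)"
  proof (rule has_integral_le[OF B A])
    fix t
    have n: "norm (p t) = r" and re: "Re (p t) = r * cos t"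
      using r by (simp_all add: p_def norm_mult)
    show "(U - V) * cos t - (U + V) * \<bar>cos t\<bar> \<le> 2 * (Re (g (p t)) * cos t)"
    proof (cases "cos t \<ge> 0")
      case True
      have "- V \<le> Re (g (p t))" using n re True r by (intro V) auto
      from mult_right_mono[OF this True] True show ?thesis by (simp add: algebra_simps)
    next
      case False
      then have "Re (g (p t)) \<le> U" using n re r by (intro U) (auto simp: mult_le_0_iff)
      from mult_right_mono_neg[OF this, of "cos t"] False show ?thesis by (simp add: algebra_simps)
    qed
  qed
  then show ?thesis using r by (simp add: field_simps)
qed

section \<open>From an upper bound on the real part to bounds on the function\<close>

text \<open>After subtracting g 0 and rescaling, h / (2 A - h) sends the half-plane Re h < A into
  the unit disc, and the Schwarz lemma applies.\<close>

lemma Borel_Caratheodory: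
  assumes g: "g holomorphic_on ball 0 r" and r: "r > 0"
    and A: "\<And>z. z \<in> ball 0 r \<Longrightarrow> Re (g z) \<le> Re (g 0) + A" and A0: "A > 0"
    and z: "norm z < r"
  shows "norm (g z - g 0) \<le> 2 * A * norm z / (r - norm z)"
proof -
  define B where "B = 2 * A"
  define h where "h w = g (of_real r * w) - g 0" for w
  define \<phi> where "\<phi> w = h w / (B - h w)" for w
  have Reh: "Re (h w) \<le> A" if "norm w < 1" for w
    using A[of "of_real r * w"] that r by (simp add: h_def norm_mult)
  have hol_h: "h holomorphic_on ball 0 1"
  proof -
    have "g \<circ> (\<lambda>w. of_real r * w) holomorphic_on ball 0 1"
      by (rule holomorphic_on_compose_gen[OF _ g]) (use r in \<open>auto intro!: holomorphic_intros simp: norm_mult\<close>)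
    then show ?thesis unfolding h_def o_def by (intro holomorphic_intros)
  qed
  have nz: "of_real B - h w \<noteq> 0" if "norm w < 1" for w
  proof
    assume "of_real B - h w = 0"
    then have "Re (h w) = B" by (metis Re_complex_of_real eq_iff_diff_eq_0)
    then show False using Reh[OF that] A0 by (simp add: B_def)
  qed
  have n1: "norm (h w) < norm (of_real B - h w)" if "norm w < 1" for w
  proof (cases "Re (h w) < A")
    case True
    have "(norm (of_real B - h w))\<^sup>2 - (norm (h w))\<^sup>2 = 4 * A * (A - Re (h w))"
      unfolding cmod_power2 by (simp add: B_def power2_eq_square algebra_simps)
    also have "\<dots> > 0" using True A0 by simp
    finally have "(norm (h w))\<^sup>2 < (norm (of_real B - h w))\<^sup>2" by simp
    then show ?thesis by (rule power2_less_imp_less) simp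
  next
    case False
    then have eq: "Re (h w) = A" using Reh[OF that] by simp
    \<comment> \<open>The hypothesis gives only Re h <= A, while the Schwarz lemma needs strictness.
      Equality at a point would make |exp h| maximal there, so exp h would be constant, against Re
      (h 0) = 0 < A.\<close>
    have "(exp \<circ> h) constant_on ball 0 1"
    proof (rule maximum_modulus_principle[where U = "ball 0 1" and \<xi> = w])
      show "exp \<circ> h holomorphic_on ball 0 1"
        by (intro holomorphic_on_compose hol_h holomorphic_on_exp)
      show "norm ((exp \<circ> h) v) \<le> norm ((exp \<circ> h) w)" if "v \<in> ball 0 1" for v
        using Reh[of v] that eq by simp
    qed (use that in auto)
    then have "exp (h w) = exp (h 0)" using that unfolding constant_on_def by force
    then have "Re (h w) = Re (h 0)" by (metis norm_exp_eq_Re exp_inj_iff)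
    then show ?thesis using eq A0 by (simp add: h_def)
  qed
  have "norm (\<phi> w) \<le> norm w" if "norm w < 1" for w
  proof (rule Schwarz_Lemma(1))
    show "\<phi> holomorphic_on ball 0 1"
      unfolding \<phi>_def by (intro holomorphic_intros hol_h) (use nz in auto)
    show "\<phi> 0 = 0" by (simp add: \<phi>_def h_def)
    show "norm (\<phi> z) < 1" if "norm z < 1" for z
      using n1[OF that] nz[OF that] by (simp add: \<phi>_def norm_divide divide_less_eq)
  qed (use that in auto)
  define w where "w = z / of_real r"
  have w: "norm w < 1" "norm w = norm z / r" using z r by (auto simp: w_def norm_divide)
  have hz: "h w = g z - g 0" using r by (simp add: h_def w_def)
  have "norm (h w) \<le> norm w * norm (of_real B - h w)"
    using \<open>norm w < 1 \<Longrightarrow> norm (\<phi> w) \<le> norm w\<close> w(1) nz[OF w(1)]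
    by (simp add: \<phi>_def norm_divide divide_le_eq)
  also have "\<dots> \<le> norm w * (B + norm (h w))"
    using A0 norm_triangle_ineq4[of "of_real B" "h w"] by (intro mult_left_mono) (auto simp: B_def)
  finally have "norm (h w) * (1 - norm w) \<le> norm w * B" by (simp add: algebra_simps)
  then have "norm (h w) \<le> norm w * B / (1 - norm w)" using w(1) by (simp only: pos_le_divide_eq diff_gt_0_iff_gt)
  also have "\<dots> = 2 * A * norm z / (r - norm z)"
    using r z by (simp add: w(2) B_def field_simps)
  finally show ?thesis by (simp add: hz)
qed

text \<open>The second derivative is bounded by Cauchy's estimate on discs of radius r / 2 about the
  points of the disc of radius r / 4. These discs stay within 3 r / 4, where |g - g 0| <= 6 A by the
  previous lemma; 7 A makes this strict, and 56 = 2! * 7 / (1/2)^2.\<close>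

lemma Borel_Caratheodory_deriv:
  assumes g: "g holomorphic_on ball 0 r" and r: "r > 0"
    and A: "\<And>z. z \<in> ball 0 r \<Longrightarrow> Re (g z) \<le> Re (g 0) + A" and A0: "A > 0"
    and z: "norm z \<le> r / 4"
  shows "norm (deriv g z - deriv g 0) \<le> 56 * A / r\<^sup>2 * norm z"
proof -
  have "norm (deriv g z - deriv g 0) \<le> 56 * A / r\<^sup>2 * norm (z - 0)"
  proof (rule field_differentiable_bound[where S = "cball 0 (r / 4)"])
    fix w :: complex assume w: "w \<in> cball 0 (r / 4)"
    have "w \<in> ball 0 r" using w r by auto
    then show "(deriv g has_field_derivative (deriv ^^ 2) g w) (at w within cball 0 (r / 4))"
      using holomorphic_derivI[OF holomorphic_deriv[OF g open_ball] open_ball, of w]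
      by (simp add: numeral_2_eq_2)
    have sub: "v \<in> ball 0 r \<and> norm v < 3 * r / 4" if "v \<in> ball w (r / 2)" for v
      using that w r norm_triangle_ineq2[of v w] by (auto simp: dist_norm norm_minus_commute)
    have csub: "cball w (r / 2) \<subseteq> ball 0 r"
    proof
      fix v assume "v \<in> cball w (r / 2)"
      then show "v \<in> ball 0 r"
        using w r norm_triangle_ineq2[of v w] by (auto simp: dist_norm norm_minus_commute)
    qed
    have "norm ((deriv ^^ 2) g w) \<le> fact 2 * (7 * A) / (r / 2) ^ 2"
    proof (rule Cauchy_higher_deriv_bound[where y = "g 0"])
      show "g holomorphic_on ball w (r / 2)"
        by (rule holomorphic_on_subset[OF g]) (use sub in blast)
      show "continuous_on (cball w (r / 2)) g"
        by (rule continuous_on_subset[OF holomorphic_on_imp_continuous_on[OF g] csub])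
      fix v assume v: "v \<in> ball w (r / 2)"
      have "norm (g v - g 0) \<le> 2 * A * norm v / (r - norm v)"
        by (rule Borel_Caratheodory[OF g r A A0]) (use sub[OF v] in auto)
      also have "\<dots> \<le> 2 * A * (3 * r / 4) / (r - 3 * r / 4)"
        using sub[OF v] r A0 by (intro frac_le mult_left_mono mult_nonneg_nonneg) auto
      also have "\<dots> = 6 * A" using r by (simp add: field_simps)
      finally show "g v \<in> ball (g 0) (7 * A)"
        using A0 by (simp add: dist_norm norm_minus_commute)
    qed (use r in auto)
    then show "norm ((deriv ^^ 2) g w) \<le> 56 * A / r\<^sup>2" by (simp add: power_divide field_simps)
  qed (use z r in auto)
  then show ?thesis by simp
qed

section \<open>Dividing out zeros\<close>

text \<open>The local factor at the zero extends to the whole domain, since away from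
  \<open>\<rho>\<close> it is f divided by a power of z - \<open>\<rho>\<close>.\<close>

lemma holomorphic_factor_zero_global:
  assumes f: "f holomorphic_on S" and S: "open S" "connected S" and \<rho>: "\<rho> \<in> S" "f \<rho> = 0"
    and nc: "\<not> f constant_on S"
  obtains n h where "n > 0" "h holomorphic_on S" "h \<rho> \<noteq> 0" "\<And>z. z \<in> S \<Longrightarrow> f z = (z - \<rho>) ^ n * h z"
proof -
  obtain g e n where n: "0 < n" and e: "0 < e" "ball \<rho> e \<subseteq> S" and g: "g holomorphic_on ball \<rho> e"
    "\<And>w. w \<in> ball \<rho> e \<Longrightarrow> f w = (w - \<rho>) ^ n * g w" "\<And>w. w \<in> ball \<rho> e \<Longrightarrow> g w \<noteq> 0"
    using holomorphic_factor_zero_nonconstant[OF f S \<rho> nc] by metis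
  define h where "h z = (if z = \<rho> then g \<rho> else f z / (z - \<rho>) ^ n)" for z
  have "h holomorphic_on ball \<rho> e \<union> (S - {\<rho>})"
  proof (rule holomorphic_on_Un)
    show "h holomorphic_on ball \<rho> e"
      by (rule holomorphic_transform[OF g(1)]) (auto simp: h_def g(2))
    have "(\<lambda>z. f z / (z - \<rho>) ^ n) holomorphic_on S - {\<rho>}"
      by (intro holomorphic_intros holomorphic_on_subset[OF f]) auto
    then show "h holomorphic_on S - {\<rho>}"
      by (rule holomorphic_transform) (auto simp: h_def)
  qed (use S in auto)
  moreover have "ball \<rho> e \<union> (S - {\<rho>}) = S" using e \<rho> by auto
  ultimately have "h holomorphic_on S" by simp
  moreover have "h \<rho> \<noteq> 0" using g(3)[of \<rho>] e by (simp add: h_def)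
  moreover have "f z = (z - \<rho>) ^ n * h z" if "z \<in> S" for z
    using \<rho> n by (auto simp: h_def)
  ultimately show ?thesis using that n by blast
qed

text \<open>Induction on the number of distinct zeros in the closed disc, one of which is divided
  out at each step with a power large enough to remove it. Zeros between r and R stay in
  \<open>G\<close>.\<close>

lemma holomorphic_factor_zeros:
  assumes f: "f holomorphic_on ball 0 R" and r: "0 < r" "r < R" and f0: "f 0 \<noteq> 0"
  shows "\<exists>M G. G holomorphic_on ball 0 R \<and> (\<forall>z\<in>cball 0 r. G z \<noteq> 0) \<and>
     (\<forall>z\<in>ball 0 R. f z = (\<Prod>\<rho>\<in>#M. z - \<rho>) * G z) \<and> (\<forall>\<rho>\<in>#M. \<rho> \<in> cball 0 r \<and> f \<rho> = 0)"
  using f f0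
proof (induction "card {z\<in>cball 0 r. f z = 0}" arbitrary: f rule: less_induct)
  case (less f)
  show ?case
  proof (cases "\<exists>\<rho>\<in>cball 0 r. f \<rho> = 0")
    case False
    then show ?thesis using less.prems by (intro exI[of _ "{#}"] exI[of _ f]) auto
  next
    case True
    then obtain \<rho> where \<rho>: "\<rho> \<in> cball 0 r" "f \<rho> = 0" by blast
    have \<rho>R: "\<rho> \<in> ball 0 R" using \<rho> r by auto
    have nc: "\<not> f constant_on ball 0 R"
      using \<rho>R \<rho>(2) less.prems(2) r unfolding constant_on_def by force
    obtain n h where nh: "n > 0" "h holomorphic_on ball 0 R" "h \<rho> \<noteq> 0"
        "\<And>z. z \<in> ball 0 R \<Longrightarrow> f z = (z - \<rho>) ^ n * h z"
      using holomorphic_factor_zero_global[OF less.prems(1) open_ball connected_ball \<rho>R \<rho>(2) nc] by blast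
    have fin: "finite {z\<in>cball 0 r. f z = 0}"
      by (rule holomorphic_compact_finite_zeros[OF less.prems(1) open_ball connected_ball compact_cball _ nc])
         (use r in auto)
    have h0: "h z = 0 \<Longrightarrow> f z = 0" if "z \<in> cball 0 r" for z
      using nh(4)[of z] that r by auto
    have sub: "{z\<in>cball 0 r. h z = 0} \<subset> {z\<in>cball 0 r. f z = 0}"
      using h0 \<rho> nh(3) by blast
    have "h 0 \<noteq> 0" using nh(4)[of 0] less.prems(2) r by auto
    from less.hyps[OF psubset_card_mono[OF fin sub] nh(2) this]
    obtain M G where MG: "G holomorphic_on ball 0 R" "\<forall>z\<in>cball 0 r. G z \<noteq> 0"
      "\<forall>z\<in>ball 0 R. h z = (\<Prod>\<rho>\<in>#M. z - \<rho>) * G z" "\<forall>\<rho>\<in>#M. \<rho> \<in> cball 0 r \<and> h \<rho> = 0" by blast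
    show ?thesis
    proof (intro exI[of _ "M + replicate_mset n \<rho>"] exI[of _ G] conjI ballI)
      fix z :: complex assume "z \<in> ball 0 R"
      then show "f z = (\<Prod>\<rho>\<in>#M + replicate_mset n \<rho>. z - \<rho>) * G z"
        using nh(4) MG(3) by (simp add: mult_ac)
    qed (use MG \<rho> h0 in \<open>auto simp: in_replicate_mset split: if_splits\<close>)
  qed
qed

lemma norm_prod_mset: "norm (\<Prod>x\<in>#M. F x :: complex) = (\<Prod>x\<in>#M. norm (F x))"
  by (induction M) (simp_all add: norm_mult)

lemma prod_mset_pos:
  "(\<And>x. x \<in># M \<Longrightarrow> F x > 0) \<Longrightarrow> (\<Prod>x\<in>#M. F x :: real) > 0"
  by (induction M) auto

lemma ln_prod_mset:
  "(\<And>x. x \<in># M \<Longrightarrow> F x > 0) \<Longrightarrow> ln (\<Prod>x\<in>#M. F x :: real) = (\<Sum>x\<in>#M. ln (F x))"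
proof (induction M)
  case (add y M)
  have "(\<Prod>x\<in>#M. F x) > 0" using add.prems by (intro prod_mset_pos) auto
  moreover have "F y > 0" using add.prems by auto
  ultimately show ?case using add by (simp add: ln_mult_pos)
qed auto

lemma has_field_derivative_prod_mset:
  fixes F :: "'b \<Rightarrow> complex \<Rightarrow> complex"
  assumes "\<And>\<rho>. \<rho> \<in># M \<Longrightarrow> (F \<rho> has_field_derivative F' \<rho>) (at x)" "\<And>\<rho>. \<rho> \<in># M \<Longrightarrow> F \<rho> x \<noteq> 0"
  shows "((\<lambda>z. \<Prod>\<rho>\<in>#M. F \<rho> z) has_field_derivative (\<Prod>\<rho>\<in>#M. F \<rho> x) * (\<Sum>\<rho>\<in>#M. F' \<rho> / F \<rho> x)) (at x)"
  using assms
proof (induction M)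
  case (add y M)
  have "((\<lambda>z. F y z * (\<Prod>\<rho>\<in>#M. F \<rho> z)) has_field_derivative
      F' y * (\<Prod>\<rho>\<in>#M. F \<rho> x) + (\<Prod>\<rho>\<in>#M. F \<rho> x) * (\<Sum>\<rho>\<in>#M. F' \<rho> / F \<rho> x) * F y x) (at x)"
    by (rule DERIV_mult) (use add in auto)
  moreover have "F y x \<noteq> 0" using add.prems(2) by simp
  ultimately show ?case by (simp add: algebra_simps)
qed auto

text \<open>
  The zeros are divided out by Blaschke factors; \<open>h\<close> is the derivative of the logarithm of the
  remaining zero-free quotient, which has the same modulus as \<open>f\<close> on the circle.
\<close>

lemma log_deriv_disc:
  fixes f f1 :: "complex \<Rightarrow> complex"
  assumes r: "0 < r" "r < R"
    and f: "f holomorphic_on ball 0 R" "f 0 \<noteq> 0" "\<And>z. norm z = r \<Longrightarrow> f z \<noteq> 0"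
    and f1: "f1 holomorphic_on ball 0 R" "\<And>z. z \<in> ball 0 R \<Longrightarrow> f z = (z - \<rho>0) ^ m * f1 z" "norm \<rho>0 < r"
    and U: "\<And>z. norm z = r \<Longrightarrow> Re z \<le> 0 \<Longrightarrow> ln (norm (f z)) \<le> U"
    and V: "\<And>z. norm z = r \<Longrightarrow> Re z \<ge> 0 \<Longrightarrow> ln (norm (f z)) \<ge> - V"
    and U': "\<And>z. norm z = r \<Longrightarrow> ln (norm (f z)) \<le> U'"
  shows "\<exists>M h. replicate_mset m \<rho>0 \<subseteq># M \<and> (\<forall>\<rho>\<in>#M. norm \<rho> < r \<and> f \<rho> = 0) \<and>
     (\<Sum>\<rho>\<in>#M. r\<^sup>2 - (norm \<rho>)\<^sup>2) \<le> 2 * r\<^sup>2 * (U' - ln (norm (f 0))) \<and>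
     (\<forall>x\<in>ball 0 r. f x \<noteq> 0 \<longrightarrow>
        deriv f x / f x = (\<Sum>\<rho>\<in>#M. 1 / (x - \<rho>) + cnj \<rho> / (of_real (r\<^sup>2) - cnj \<rho> * x)) + h x) \<and>
     Re (h 0) \<ge> - (2 / (pi * r)) * (U + V) \<and>
     (\<forall>x. norm x \<le> r / 4 \<longrightarrow> norm (h x - h 0) \<le> 56 * (U' - ln (norm (f 0)) + 1) / r\<^sup>2 * norm x)"
proof -
  have f10: "f1 0 \<noteq> 0" using f1(2)[of 0] f(2) r by auto
  obtain M1 G where G: "G holomorphic_on ball 0 R" "\<And>z. z \<in> cball 0 r \<Longrightarrow> G z \<noteq> 0"
     "\<And>z. z \<in> ball 0 R \<Longrightarrow> f1 z = (\<Prod>\<rho>\<in>#M1. z - \<rho>) * G z"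
     "\<And>\<rho>. \<rho> \<in># M1 \<Longrightarrow> \<rho> \<in> cball 0 r \<and> f1 \<rho> = 0"
    using holomorphic_factor_zeros[OF f1(1) r f10] by blast
  \<comment> \<open>Only \<open>f1\<close> was factored, so \<open>M\<close> is sure to contain
    \<open>m\<close> copies of \<open>\<rho>0\<close>, even if \<open>f1\<close> vanishes there
    again.\<close>
  define M where "M = M1 + replicate_mset m \<rho>0"
  have fG: "f z = (\<Prod>\<rho>\<in>#M. z - \<rho>) * G z" if "z \<in> ball 0 R" for z
    using f1(2)[OF that] G(3)[OF that] by (simp add: M_def mult_ac)
  have M: "norm \<rho> < r \<and> f \<rho> = 0" if "\<rho> \<in># M" for \<rho>
  proof (cases "\<rho> \<in># M1")
    case True
    then have "norm \<rho> \<le> r" "f \<rho> = 0" using G(4)[OF True] f1(2)[of \<rho>] r by auto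
    then show ?thesis using f(3)[of \<rho>] by force
  next
    case False
    then have "\<rho> = \<rho>0" "m > 0" using that by (auto simp: M_def split: if_splits)
    then show ?thesis using f1(2)[of \<rho>0] f1(3) r by auto
  qed
  \<comment> \<open>Replacing z - \<open>\<rho>\<close> by this factor keeps the modulus on the
    circle and moves the zero outside, to r^2 / cnj \<open>\<rho>\<close>.\<close>
  define F where "F \<rho> z = (of_real (r\<^sup>2) - cnj \<rho> * z) / of_real r" for \<rho> z
  have F_nz: "F \<rho> z \<noteq> 0" if "\<rho> \<in># M" "norm z \<le> r" for \<rho> z
  proof
    assume "F \<rho> z = 0"
    then have "cnj \<rho> * z = of_real (r\<^sup>2)" using r by (simp add: F_def)
    then have "norm \<rho> * norm z = r\<^sup>2" by (metis complex_mod_cnj norm_mult norm_of_real abs_power2)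
    moreover have "norm \<rho> * norm z \<le> norm \<rho> * r" using that by (intro mult_left_mono) auto
    moreover have "norm \<rho> * r < r * r" using M[OF that(1)] r by simp
    ultimately show False by (simp add: power2_eq_square)
  qed
  define H where "H z = G z * (\<Prod>\<rho>\<in>#M. F \<rho> z)" for z
  have hol_prod: "(\<lambda>z. \<Prod>\<rho>\<in>#N. F \<rho> z) holomorphic_on S" for N S
  proof (induction N)
    case (add x N)
    then show ?case by (auto intro!: holomorphic_intros simp: F_def)
  qed auto
  have holH: "H holomorphic_on ball 0 R"
    unfolding H_def by (intro holomorphic_intros G(1) hol_prod)
  have H_nz: "H z \<noteq> 0" if "norm z \<le> r" for z
    using G(2)[of z] F_nz[OF _ that] that by (auto simp: H_def)
  \<comment> \<open>The logarithm of \<open>H\<close> is needed on a neighbourhood of the closed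
    disc; by compactness the absence of zeros extends to a slightly larger disc.\<close>
  obtain r' where r': "r < r'" "r' \<le> R" "\<And>z. z \<in> ball 0 r' \<Longrightarrow> H z \<noteq> 0"
  proof -
    have "open (ball 0 R \<inter> H -` (- {0}))"
      using holomorphic_on_imp_continuous_on[OF holH] by (intro continuous_open_preimage) auto
    moreover have "cball 0 r \<subseteq> ball 0 R \<inter> H -` (- {0})" using r H_nz by auto
    ultimately obtain e where e: "e > 0" "(\<Union>x\<in>cball 0 r. ball x e) \<subseteq> ball 0 R \<inter> H -` (- {0})"
      using compact_subset_open_imp_ball_epsilon_subset[OF compact_cball] by metis
    show ?thesis
    proof (rule that[of "min R (r + e)"])
      fix z :: complex assume z: "z \<in> ball 0 (min R (r + e))"
      show "H z \<noteq> 0"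
      proof (cases "norm z \<le> r")
        case False
        \<comment> \<open>Radial projection to the circle, which moves a point of norm below r + e
          by less than e.\<close>
        define x where "x = of_real (r / norm z) * z"
        have "norm z \<noteq> 0" using r False by linarith
        have nx: "norm x = r" using r \<open>norm z \<noteq> 0\<close>
          by (simp add: x_def norm_mult norm_divide)
        have "x - z = of_real (r / norm z - 1) * z" by (simp add: x_def algebra_simps)
        then have "norm (x - z) = \<bar>r / norm z - 1\<bar> * norm z" by (simp only: norm_mult norm_of_real)
        also have "\<dots> = norm z - r" using r False \<open>norm z \<noteq> 0\<close> by (simp add: abs_if field_simps)
        also have "\<dots> < e" using z by simp
        finally have "z \<in> (\<Union>x\<in>cball 0 r. ball x e)" using nx by (auto simp: dist_norm intro!: bexI[of _ x])
        then show ?thesis using e(2) by blast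
      qed (use H_nz in auto)
    qed (use r e in auto)
  qed
  have holH': "H holomorphic_on ball 0 r'" by (rule holomorphic_on_subset[OF holH]) (use r' in auto)
  obtain g where g: "g holomorphic_on ball 0 r'" "\<And>z. z \<in> ball 0 r' \<Longrightarrow> exp (g z) = H z"
    using holomorphic_logarithm_exists[OF convex_ball open_ball holH' r'(3), of 0] r r' by auto
  have Reg: "Re (g z) = ln (norm (H z))" if "z \<in> ball 0 r'" for z
    using g(2)[OF that] by (metis ln_exp norm_exp_eq_Re)
  have normF: "norm (F \<rho> z) = norm (z - \<rho>)" if "norm z = r" for \<rho> z
  proof -
    have "of_real (r\<^sup>2) - cnj \<rho> * z = z * cnj (z - \<rho>)"
      using that complex_norm_square[of z] by (simp add: algebra_simps)
    then have "norm (of_real (r\<^sup>2) - cnj \<rho> * z) = r * norm (z - \<rho>)"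
      by (simp only: norm_mult complex_mod_cnj that)
    then show ?thesis using r by (simp add: F_def norm_divide)
  qed
  have normH: "norm (H z) = norm (f z)" if "norm z = r" for z
  proof -
    have "z \<in> ball 0 R" using that r by simp
    then show ?thesis
      by (simp add: H_def fG norm_mult norm_prod_mset normF[OF that])
  qed
  \<comment> \<open>Jensen's formula: the excess at the centre counts each zero with weight ln (r /
    |\<rho>|).\<close>
  have Re0: "Re (g 0) - ln (norm (f 0)) = (\<Sum>\<rho>\<in>#M. ln r - ln (norm \<rho>))"
  proof -
    have M0: "\<rho> \<noteq> 0" if "\<rho> \<in># M" for \<rho> using M[OF that] f(2) by auto
    have G0: "norm (G 0) > 0" using G(2)[of 0] r by simp
    have pr: "(\<Prod>\<rho>\<in>#M. norm \<rho>) > 0" using M0 by (intro prod_mset_pos) auto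
    have pr': "(\<Prod>\<rho>\<in>#M. r) > 0" using r by (intro prod_mset_pos) auto
    have "Re (g 0) = ln (norm (G 0) * (\<Prod>\<rho>\<in>#M. r))"
      using Reg[of 0] r r' by (simp add: H_def norm_mult norm_prod_mset F_def power2_eq_square norm_power)
    also have "\<dots> = ln (norm (G 0)) + (\<Sum>\<rho>\<in>#M. ln r)"
      by (subst ln_mult_pos[OF G0 pr'], subst ln_prod_mset) (use r in auto)
    finally have 1: "Re (g 0) = ln (norm (G 0)) + (\<Sum>\<rho>\<in>#M. ln r)" .
    have "ln (norm (f 0)) = ln ((\<Prod>\<rho>\<in>#M. norm \<rho>) * norm (G 0))"
      using fG[of 0] r by (simp add: norm_mult norm_prod_mset)
    also have "\<dots> = (\<Sum>\<rho>\<in>#M. ln (norm \<rho>)) + ln (norm (G 0))"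
      by (subst ln_mult_pos[OF pr G0], subst ln_prod_mset) (use M0 in auto)
    finally have "Re (g 0) - ln (norm (f 0)) = (\<Sum>\<rho>\<in>#M. ln r) - (\<Sum>\<rho>\<in>#M. ln (norm \<rho>))" using 1 by simp
    also have "\<dots> = (\<Sum>\<rho>\<in>#M. ln r - ln (norm \<rho>))" by (induction M) auto
    finally show ?thesis .
  qed
  \<comment> \<open>The error made at a zero will carry the weight r^2 - |\<rho>|^2, so this is
    compared with the Jensen weight. With p = |\<rho>| / r it amounts to ln p <= p - 1 and 1 + p <=
    2.\<close>
  have each: "(r\<^sup>2 - (norm \<rho>)\<^sup>2) \<le> 2 * r\<^sup>2 * (ln r - ln (norm \<rho>))" "0 \<le> ln r - ln (norm \<rho>)"
    if "\<rho> \<in># M" for \<rho>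
  proof -
    have n: "0 < norm \<rho>" "norm \<rho> < r" using M[OF that] f(2) by auto
    define p where "p = norm \<rho> / r"
    have p: "0 < p" "p \<le> 1" using n r by (auto simp: p_def)
    have "ln p \<le> p - 1" using p by (intro ln_le_minus_one) auto
    then have lp: "1 - p \<le> ln r - ln (norm \<rho>)" using n r by (simp add: p_def ln_div)
    have "r\<^sup>2 - (norm \<rho>)\<^sup>2 = r\<^sup>2 * ((1 - p) * (1 + p))"
      using r by (simp add: p_def power2_eq_square field_simps)
    also have "\<dots> \<le> r\<^sup>2 * ((1 - p) * 2)"
      using p by (intro mult_left_mono) auto
    also have "\<dots> \<le> r\<^sup>2 * ((ln r - ln (norm \<rho>)) * 2)"
      using lp by (intro mult_left_mono mult_right_mono) auto
    finally show "(r\<^sup>2 - (norm \<rho>)\<^sup>2) \<le> 2 * r\<^sup>2 * (ln r - ln (norm \<rho>))" by (simp add: algebra_simps)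
    show "0 \<le> ln r - ln (norm \<rho>)" using lp p by simp
  qed
  have Re0_ge: "Re (g 0) \<ge> ln (norm (f 0))"
    using sum_mset_mono[of M "\<lambda>_. 0" "\<lambda>\<rho>. ln r - ln (norm \<rho>)"] each(2) Re0 by auto
  have Rele: "Re (g z) \<le> U'" if "norm z \<le> r" for z
  proof (rule maximum_real_frontier[where S = "cball 0 r" and f = g and \<xi> = z])
    show "g holomorphic_on interior (cball 0 r)"
      by (rule holomorphic_on_subset[OF g(1)]) (use r' in auto)
    show "continuous_on (closure (cball 0 r)) g"
      by (rule continuous_on_subset[OF holomorphic_on_imp_continuous_on[OF g(1)]]) (use r' in auto)
    show "Re (g w) \<le> U'" if "w \<in> frontier (cball 0 r)" for w
      using that r r' U'[of w] Reg[of w] normH[of w] by (simp add: frontier_cball)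
  qed (use that in auto)
  have zsum: "(\<Sum>\<rho>\<in>#M. r\<^sup>2 - (norm \<rho>)\<^sup>2) \<le> 2 * r\<^sup>2 * (U' - ln (norm (f 0)))"
  proof -
    have "(\<Sum>\<rho>\<in>#M. r\<^sup>2 - (norm \<rho>)\<^sup>2) \<le> (\<Sum>\<rho>\<in>#M. 2 * r\<^sup>2 * (ln r - ln (norm \<rho>)))"
      by (rule sum_mset_mono) (use each(1) in auto)
    also have "\<dots> = 2 * r\<^sup>2 * (Re (g 0) - ln (norm (f 0)))"
      by (simp add: Re0 sum_mset_distrib_left)
    also have "\<dots> \<le> 2 * r\<^sup>2 * (U' - ln (norm (f 0)))"
      using Rele[of 0] r by (intro mult_left_mono) auto
    finally show ?thesis .
  qed
  have half: "Re (deriv g 0) \<ge> - (2 / (pi * r)) * (U + V)"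
  proof (rule Re_deriv_ge_of_half_circles[OF g(1) r(1) r'(1)])
    fix z :: complex assume z: "norm z = r"
    then have "Re (g z) = ln (norm (f z))" using Reg[of z] normH[of z] r' by simp
    then show "Re z \<le> 0 \<Longrightarrow> Re (g z) \<le> U" "Re z \<ge> 0 \<Longrightarrow> Re (g z) \<ge> - V" using U V z by auto
  qed
  have reg: "norm (deriv g x - deriv g 0) \<le> 56 * (U' - ln (norm (f 0)) + 1) / r\<^sup>2 * norm x"
    if x: "norm x \<le> r / 4" for x
  proof -
    have "norm (deriv g x - deriv g 0) \<le> 56 * (U' - Re (g 0) + 1) / r\<^sup>2 * norm x"
    proof (rule Borel_Caratheodory_deriv[OF _ r(1)])
      show "g holomorphic_on ball 0 r" by (rule holomorphic_on_subset[OF g(1)]) (use r' in auto)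
      show "Re (g w) \<le> Re (g 0) + (U' - Re (g 0) + 1)" if "w \<in> ball 0 r" for w
        using Rele[of w] that by simp
      show "0 < U' - Re (g 0) + 1" using Rele[of 0] r by simp
    qed (rule x)
    also have "\<dots> \<le> 56 * (U' - ln (norm (f 0)) + 1) / r\<^sup>2 * norm x"
      using Re0_ge r by (intro mult_right_mono divide_right_mono) auto
    finally show ?thesis .
  qed
  have ld: "deriv f x / f x = (\<Sum>\<rho>\<in>#M. 1 / (x - \<rho>) + cnj \<rho> / (of_real (r\<^sup>2) - cnj \<rho> * x)) + deriv g x"
    if x: "x \<in> ball 0 r" "f x \<noteq> 0" for x
  proof -
    have xR: "x \<in> ball 0 R" "x \<in> ball 0 r'" "norm x \<le> r" using x r r' by auto
    have M0: "x - \<rho> \<noteq> 0" if "\<rho> \<in># M" for \<rho> using M[OF that] x by auto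
    define P where "P = (\<Prod>\<rho>\<in>#M. x - \<rho>)"
    define Q where "Q = (\<Prod>\<rho>\<in>#M. F \<rho> x)"
    define G' where "G' = deriv G x"
    have dG: "(G has_field_derivative G') (at x)"
      unfolding G'_def by (rule holomorphic_derivI[OF G(1) open_ball xR(1)])
    have "x \<notin># M" using M[of x] x(2) by blast
    then have "P \<noteq> 0" unfolding P_def prod_mset_zero_iff by auto
    moreover have "Q \<noteq> 0" unfolding Q_def prod_mset_zero_iff using F_nz[OF _ xR(3)] by fastforce
    moreover have "G x \<noteq> 0" using G(2)[of x] xR(3) by simp
    ultimately have nz: "P \<noteq> 0" "Q \<noteq> 0" "G x \<noteq> 0" by blast+
    have dP: "((\<lambda>z. \<Prod>\<rho>\<in>#M. z - \<rho>) has_field_derivative P * (\<Sum>\<rho>\<in>#M. 1 / (x - \<rho>))) (at x)"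
      unfolding P_def
    proof (rule has_field_derivative_prod_mset)
      show "((\<lambda>z. z - \<rho>) has_field_derivative 1) (at x)" for \<rho>
        by (auto intro!: derivative_eq_intros)
    qed (rule M0)
    have dQ: "((\<lambda>z. \<Prod>\<rho>\<in>#M. F \<rho> z) has_field_derivative Q * (\<Sum>\<rho>\<in>#M. (- cnj \<rho> / r) / F \<rho> x)) (at x)"
      unfolding Q_def by (rule has_field_derivative_prod_mset)
         (use F_nz xR(3) r in \<open>auto simp: F_def[abs_def] intro!: derivative_eq_intros\<close>)
    have "((\<lambda>z. (\<Prod>\<rho>\<in>#M. z - \<rho>) * G z) has_field_derivative
             P * (\<Sum>\<rho>\<in>#M. 1 / (x - \<rho>)) * G x + G' * P) (at x)"
      using DERIV_mult[OF dP dG] by (simp add: P_def)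
    then have "(f has_field_derivative P * (\<Sum>\<rho>\<in>#M. 1 / (x - \<rho>)) * G x + G' * P) (at x)"
      by (rule has_field_derivative_transform_within_open[OF _ open_ball xR(1)]) (use fG in auto)
    then have 1: "deriv f x / f x = (\<Sum>\<rho>\<in>#M. 1 / (x - \<rho>)) + G' / G x"
      using nz fG[OF xR(1)] by (simp add: DERIV_imp_deriv P_def[symmetric] field_simps)
    have dg: "(g has_field_derivative deriv g x) (at x)"
      by (rule holomorphic_derivI[OF g(1) open_ball xR(2)])
    have "((\<lambda>z. exp (g z)) has_field_derivative exp (g x) * deriv g x) (at x)"
      by (rule DERIV_fun_exp[OF dg])
    then have "(H has_field_derivative exp (g x) * deriv g x) (at x)"
      by (rule has_field_derivative_transform_within_open[OF _ open_ball xR(2)]) (rule g(2))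
    moreover have "(H has_field_derivative G x * (Q * (\<Sum>\<rho>\<in>#M. (- cnj \<rho> / r) / F \<rho> x)) + G' * Q) (at x)"
      unfolding H_def[abs_def] Q_def using DERIV_mult[OF dG dQ] by (simp add: Q_def algebra_simps)
    ultimately have "exp (g x) * deriv g x = G x * (Q * (\<Sum>\<rho>\<in>#M. (- cnj \<rho> / r) / F \<rho> x)) + G' * Q"
      by (rule DERIV_unique)
    moreover have "exp (g x) = G x * Q" unfolding g(2)[OF xR(2)] by (simp add: H_def Q_def)
    ultimately have "(G x * Q) * deriv g x = (G x * Q) * ((\<Sum>\<rho>\<in>#M. (- cnj \<rho> / r) / F \<rho> x) + G' / G x)"
      using nz(3) by (simp add: distrib_left)
    then have 2: "deriv g x = (\<Sum>\<rho>\<in>#M. (- cnj \<rho> / r) / F \<rho> x) + G' / G x"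
      using nz by (simp only: mult_cancel_left mult_eq_0_iff) blast
    have "(- cnj \<rho> / r) / F \<rho> x = - (cnj \<rho> / (of_real (r\<^sup>2) - cnj \<rho> * x))" for \<rho>
      using r by (simp add: F_def)
    then have 3: "(\<Sum>\<rho>\<in>#M. (- cnj \<rho> / r) / F \<rho> x) = - (\<Sum>\<rho>\<in>#M. cnj \<rho> / (of_real (r\<^sup>2) - cnj \<rho> * x))"
      by (induction M) auto
    show ?thesis using 1 2 3 by (simp add: sum_mset.distrib)
  qed
  show ?thesis
    by (intro exI[of _ M] exI[of _ "deriv g"] conjI ballI allI impI)
       (use M zsum half reg ld in \<open>auto simp: M_def\<close>)
qed

section \<open>The zeta function near the line of absolute convergence\<close>

lemma summable_ln_powr:
  assumes "\<sigma> > 1"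
  shows "summable (\<lambda>n. ln (real n) * real n powr (- \<sigma>))"
proof (rule summable_comparison_test)
  define d where "d = (\<sigma> - 1) / 2"
  have d: "d > 0" using assms by (simp add: d_def)
  show "summable (\<lambda>n. 1 / d * real n powr (- \<sigma> + d))"
    by (intro summable_mult, subst summable_real_powr_iff) (use assms in \<open>auto simp: d_def field_simps\<close>)
  show "\<exists>N. \<forall>n\<ge>N. norm (ln (real n) * real n powr (- \<sigma>)) \<le> 1 / d * real n powr (- \<sigma> + d)"
  proof (intro exI allI impI)
    fix n :: nat assume n: "n \<ge> 1"
    have "ln (real n) * real n powr (- \<sigma>) \<le> real n powr d / d * real n powr (- \<sigma>)"
      using n d by (intro mult_right_mono ln_powr_bound) auto
    also have "\<dots> = 1 / d * (real n powr (- \<sigma>) * real n powr d)" by simp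
    also have "\<dots> = 1 / d * real n powr (- \<sigma> + d)" by (simp only: powr_add)
    finally show "norm (ln (real n) * real n powr (- \<sigma>)) \<le> 1 / d * real n powr (- \<sigma> + d)"
      using n by simp
  qed
qed

lemma norm_exp_mult_ln: "n > 0 \<Longrightarrow> norm (exp (- s * complex_of_real (ln (real n)))) = real n powr (- Re s)"
  by (simp add: powr_def)

text \<open>As \<open>ln 0 = 0\<close>, the exponential at n = 0 is 1 whereas the bound there is 0;
  the condition \<open>b 0 = 0\<close> removes this term.\<close>

lemma dirichlet_series_bound:
  fixes b :: "nat \<Rightarrow> real" and s :: complex
  assumes b: "\<And>n. \<bar>b n\<bar> \<le> 1" "b 0 = 0"
  shows "norm (complex_of_real (b n) * exp (- s * complex_of_real (ln (real n)))) \<le> real n powr (- Re s)"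
proof (cases "n = 0")
  case False
  then have "norm (complex_of_real (b n) * exp (- s * complex_of_real (ln (real n)))) = \<bar>b n\<bar> * real n powr (- Re s)"
    using norm_exp_mult_ln[of n s] by (simp add: norm_mult)
  also have "\<dots> \<le> 1 * real n powr (- Re s)" by (intro mult_right_mono b) auto
  finally show ?thesis by simp
qed (use b in auto)

lemma dirichlet_series_deriv:
  fixes b :: "nat \<Rightarrow> real"
  assumes b: "\<And>n. \<bar>b n\<bar> \<le> 1" "b 0 = 0"
  shows "\<exists>g g' :: complex \<Rightarrow> complex. \<forall>s::complex. Re s > 1 \<longrightarrow> (\<lambda>n. complex_of_real (b n) * exp (- s * complex_of_real (ln (real n)))) sums g s \<and>
       (\<lambda>n. - (b n * ln (real n)) * exp (- s * complex_of_real (ln (real n)))) sums g' s \<and>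
       (g has_field_derivative g' s) (at s)"
proof -
  have "\<exists>g g' :: complex \<Rightarrow> complex. \<forall>s\<in>{s::complex. Re s > 1}. (\<lambda>n. complex_of_real (b n) * exp (- s * complex_of_real (ln (real n)))) sums g s \<and>
       (\<lambda>n. - (b n * ln (real n)) * exp (- s * complex_of_real (ln (real n)))) sums g' s \<and>
       (g has_field_derivative g' s) (at s)"
  proof (rule series_and_derivative_comparison_local)
    show "open {s. Re s > 1}" by (rule open_Re_gt)
    fix s assume s: "s \<in> {s. Re s > 1}"
    show "((\<lambda>s. complex_of_real (b n) * exp (- s * complex_of_real (ln (real n)))) has_field_derivative
         - (b n * ln (real n)) * exp (- s * complex_of_real (ln (real n)))) (at s)" for n
      by (auto intro!: derivative_eq_intros)
    define d where "d = (Re s - 1) / 2"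
    have d: "d > 0" using s by (simp add: d_def)
    have "summable (\<lambda>n. real n powr (- (Re s - d)))"
      by (subst summable_real_powr_iff) (use s in \<open>auto simp: d_def field_simps\<close>)
    moreover have "norm (complex_of_real (b n) * exp (- y * complex_of_real (ln (real n)))) \<le> real n powr (- (Re s - d))"
      if "y \<in> ball s d" for n y
    proof (cases "n = 0")
      case False
      have "\<bar>Re (s - y)\<bar> < d" using that abs_Re_le_cmod[of "s - y"] by (simp add: dist_norm)
      then have "real n powr (- Re y) \<le> real n powr (- (Re s - d))"
        using False by (intro powr_mono) auto
      then show ?thesis using dirichlet_series_bound[of b, OF b, of n y] by linarith
    qed (use b in auto)
    ultimately show "\<exists>d h. 0 < d \<and> summable h \<and>
       (\<forall>\<^sub>F n in sequentially. \<forall>y\<in>ball s d \<inter> {s. Re s > 1}. norm (complex_of_real (b n) * exp (- y * complex_of_real (ln (real n)))) \<le> h n)"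
      using d by (intro exI[of _ d] exI[of _ "\<lambda>n. real n powr (- (Re s - d))"]) auto
  qed
  then show ?thesis by simp
qed

text \<open>At s = k the terms with n >= 2 are at most n^(-2) 2^(2 - k), so only n = 1 survives. The
  limit fixes the constant of integration when zeta is compared with an exponential.\<close>

lemma dirichlet_series_at_infinity:
  fixes b :: "nat \<Rightarrow> real" and g :: "complex \<Rightarrow> complex"
  assumes b: "\<And>n. \<bar>b n\<bar> \<le> 1" "b 0 = 0"
    and g: "\<And>s. Re s > 1 \<Longrightarrow> (\<lambda>n. complex_of_real (b n) * exp (- s * complex_of_real (ln (real n)))) sums g s"
  shows "(\<lambda>k. g (of_nat k)) \<longlonglongrightarrow> b 1"
proof (rule Lim_null_comparison[THEN LIM_zero_cancel])
  define Z where "Z = (\<Sum>n. real (n + 2) powr (- 2))"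
  have sZ: "summable (\<lambda>n. real (n + 2) powr (- 2))"
    by (rule summable_ignore_initial_segment, subst summable_real_powr_iff) auto
  show "\<forall>\<^sub>F k in sequentially. norm (g (of_nat k) - b 1) \<le> Z * 4 * (1 / 2) ^ k"
    using eventually_ge_at_top[of 2]
  proof eventually_elim
    case (elim k)
    define a where "a n = b n * exp (- of_nat k * complex_of_real (ln (real n)))" for n
    have "a sums g (of_nat k)" unfolding a_def by (rule g) (use elim in simp)
    from sums_split_initial_segment[OF this, of 2]
    have s: "(\<lambda>n. a (n + 2)) sums (g (of_nat k) - b 1)"
      using b by (simp add: a_def numeral_2_eq_2)
    have "norm (a (n + 2)) \<le> real (n + 2) powr (- 2) * (4 * (1 / 2) ^ k)" for n
    proof -
      have "norm (a (n + 2)) \<le> real (n + 2) powr (- real k)"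
        unfolding a_def using dirichlet_series_bound[of b, OF b, of "n + 2" "of_nat k"] by simp
      also have "\<dots> = real (n + 2) powr (- 2) * real (n + 2) powr (- (real k - 2))"
        by (simp add: powr_add[symmetric])
      also have "real (n + 2) powr (- (real k - 2)) \<le> 2 powr (- (real k - 2))"
        using elim by (intro powr_mono2') auto
      also have "2 powr (- (real k - 2)) = 4 * (1 / 2 :: real) ^ k"
        by (simp add: powr_minus powr_diff powr_realpow power_divide field_simps)
      finally show ?thesis by (simp add: mult_left_mono)
    qed
    then have "norm (\<Sum>n. a (n + 2)) \<le> (\<Sum>n. real (n + 2) powr (- 2) * (4 * (1 / 2) ^ k))"
      by (rule norm_suminf_le) (rule summable_mult2[OF sZ])
    also have "\<dots> = Z * 4 * (1 / 2) ^ k"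
      unfolding Z_def by (subst suminf_mult2[OF sZ, symmetric]) simp
    finally show ?case using s by (simp add: sums_iff)
  qed
  have "(\<lambda>k. Z * 4 * (1 / 2) ^ k) \<longlonglongrightarrow> Z * 4 * 0"
    by (intro tendsto_intros LIMSEQ_realpow_zero) auto
  then show "(\<lambda>k. Z * 4 * (1 / 2) ^ k) \<longlonglongrightarrow> 0" by simp
qed

lemma mangoldt_le_ln: "(mangoldt n :: real) \<le> ln (real n)"
proof (cases "n = 0")
  case False
  have "(mangoldt n :: real) \<le> (\<Sum>d | d dvd n. mangoldt d)"
    using False by (intro member_le_sum) (auto intro: mangoldt_nonneg)
  then show ?thesis using mangoldt_sum[of n, where 'a = real] False by simp
qed auto

text \<open>
  Euler products are avoided: with \<open>\<kappa> = mangoldt / ln\<close> the Dirichlet series \<open>H\<close> of \<open>\<kappa>\<close> satisfies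
  \<open>zeta' = H' zeta\<close> because the convolution of \<open>mangoldt\<close> with 1 is \<open>ln\<close>, and \<open>exp H\<close> and \<open>zeta\<close>
  both tend to 1 at infinity.
\<close>

lemma mangoldt_dirichlet_product:
  assumes s: "Re s > 1"
    and L: "(\<lambda>n. complex_of_real (mangoldt n) * exp (- s * complex_of_real (ln (real n)))) sums L"
    and Z: "(\<lambda>n. complex_of_real (if n = 0 then 0 else 1) * exp (- s * complex_of_real (ln (real n)))) sums Z"
    and D: "(\<lambda>n. complex_of_real (ln (real n)) * exp (- s * complex_of_real (ln (real n)))) sums D"
  shows "L * Z = D"
proof -
  define e where "e n = exp (- s * complex_of_real (ln (real n)))" for n :: nat
  have norm_e: "norm (e n) = real n powr (- Re s)" if "n > 0" for n
    unfolding e_def using norm_exp_mult_ln[OF that] .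
  have e_mult: "e (m * n) = e m * e n" if "m > 0" "n > 0" for m n
    using that by (simp add: e_def ln_mult exp_add[symmetric] algebra_simps)
  let ?A = "{1..} :: nat set"
  have to_A: "(f has_sum S) ?A"
    if "f sums S" "f 0 = 0" "summable (\<lambda>n. norm (f n))" for f :: "nat \<Rightarrow> complex" and S
  proof -
    have "(f has_sum S) UNIV" by (rule norm_summable_imp_has_sum[OF that(3,1)])
    then show ?thesis
      by (rule has_sum_cong_neutral[THEN iffD1, rotated -1]) (use that(2) in \<open>auto simp: not_le\<close>)
  qed
  have sn: "summable (\<lambda>n. norm (of_real (f n) * e n))" if "\<And>n. n > 0 \<Longrightarrow> \<bar>f n\<bar> \<le> ln (real n)" "f 0 = 0" for f
  proof (rule summable_comparison_test[OF _ summable_ln_powr[OF s]], intro exI allI impI)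
    fix n :: nat assume n: "n \<ge> 1"
    have "norm (norm (of_real (f n) * e n)) = \<bar>f n\<bar> * real n powr (- Re s)"
      using n by (simp add: norm_mult norm_e)
    also have "\<dots> \<le> ln (real n) * real n powr (- Re s)"
      using n that(1)[of n] by (intro mult_right_mono) auto
    finally show "norm (norm (of_real (f n) * e n)) \<le> ln (real n) * real n powr (- Re s)" .
  qed
  have hL: "((\<lambda>n. of_real (mangoldt n) * e n) has_sum L) ?A"
    using L mangoldt_le_ln mangoldt_nonneg by (intro to_A sn) (auto simp: e_def)
  have hD: "((\<lambda>n. complex_of_real (ln (real n)) * e n) has_sum D) ?A"
    using D by (intro to_A sn) (auto simp: e_def)
  have sZ: "summable (\<lambda>n. norm (complex_of_real (if n = 0 then 0 else 1) * e n))"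
  proof (rule summable_comparison_test, intro exI allI impI)
    show "summable (\<lambda>n. real n powr (- Re s))" by (subst summable_real_powr_iff) (use s in auto)
    fix n :: nat assume n: "n \<ge> 1"
    then show "norm (norm (complex_of_real (if n = 0 then 0 else 1) * e n)) \<le> real n powr (- Re s)"
      by (simp add: norm_e)
  qed
  have hZ': "((\<lambda>n. complex_of_real (if n = 0 then 0 else 1) * e n) has_sum Z) ?A"
    using Z by (intro to_A sZ) (auto simp: e_def)
  have hZ: "(e has_sum Z) ?A"
    by (rule has_sum_cong[THEN iffD1, OF _ hZ']) auto
  have aL: "(\<lambda>n. norm (of_real (mangoldt n) * e n)) summable_on ?A"
    using sn[of mangoldt] mangoldt_le_ln mangoldt_nonneg
    by (intro summable_on_subset[OF iffD2[OF summable_on_UNIV_nonneg_real_iff]]) auto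
  have aZ: "(\<lambda>n. norm (e n)) summable_on ?A"
  proof -
    have "(\<lambda>n. norm (complex_of_real (if n = 0 then 0 else 1) * e n)) summable_on ?A"
      using sZ by (intro summable_on_subset[OF iffD2[OF summable_on_UNIV_nonneg_real_iff]]) auto
    then show ?thesis by (rule summable_on_cong[THEN iffD1, rotated]) auto
  qed
  define f where "f = (\<lambda>(d, m). of_real (mangoldt d) * e d * e m)"
  have "(\<lambda>x. norm (f x)) summable_on ?A \<times> ?A"
  proof (subst Infinite_Sum.abs_summable_on_Sigma_iff, intro conjI ballI)
    fix d show "(\<lambda>y. norm (f (d, y))) summable_on ?A"
      unfolding f_def using summable_on_cmult_right[OF aZ, of "norm (of_real (mangoldt d) * e d)"]
      by (simp add: norm_mult mult_ac)
  next
    have "infsum (\<lambda>y. norm (f (d, y))) ?A = norm (of_real (mangoldt d) * e d) * infsum (\<lambda>y. norm (e y)) ?A" for d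
      unfolding f_def by (simp add: norm_mult infsum_cmult_right')
    then show "(\<lambda>d. norm (infsum (\<lambda>y. norm (f (d, y))) ?A)) summable_on ?A"
      using summable_on_cmult_left[OF aL, of "\<bar>infsum (\<lambda>y. norm (e y)) ?A\<bar>"]
      by (simp add: abs_mult norm_mult mult_ac)
  qed
  then have sf: "f summable_on ?A \<times> ?A" by (rule abs_summable_summable)
  have 1: "(f has_sum (L * Z)) (?A \<times> ?A)"
  proof (rule has_sum_SigmaI[OF _ _ sf])
    fix d show "((\<lambda>y. f (d, y)) has_sum of_real (mangoldt d) * e d * Z) ?A"
      unfolding f_def using has_sum_cmult_right[OF hZ] by simp
  next
    show "((\<lambda>d. of_real (mangoldt d) * e d * Z) has_sum L * Z) ?A"
      by (rule has_sum_cmult_left[OF hL])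
  qed
  \<comment> \<open>Regrouping by the product n = d m: the pair (d, m) becomes (n, d) with d
    dividing n.\<close>
  have 2: "((\<lambda>(n, d). of_real (mangoldt d) * e n) has_sum (L * Z)) (SIGMA n:?A. {d. d dvd n})"
    using 1
  proof (rule has_sum_reindex_bij_witness[where i = "\<lambda>(d, m). (d * m, d)" and j = "\<lambda>(n, d). (d, n div d)", THEN iffD2, rotated -1])
    fix x assume "x \<in> (SIGMA n:?A. {d. d dvd n})"
    then obtain n d where x: "x = (n, d)" "n \<ge> 1" "d dvd n" by auto
    then obtain m where m: "n = d * m" by auto
    have pos: "d > 0" "m > 0" using x m by (cases d; cases m; simp)+
    show "(case case x of (n, d) \<Rightarrow> (d, n div d) of (d, m) \<Rightarrow> (d * m, d)) = x" using x m pos by simp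
    show "(case x of (n, d) \<Rightarrow> (d, n div d)) \<in> ?A \<times> ?A" using x m pos by simp
    show "f (case x of (n, d) \<Rightarrow> (d, n div d)) = (case x of (n, d) \<Rightarrow> of_real (mangoldt d) * e n)"
      using x m pos e_mult[of d m] by (simp add: f_def mult_ac)
  qed auto
  have "((\<lambda>n. \<Sum>d | d dvd n. of_real (mangoldt d) * e n) has_sum (L * Z)) ?A"
  proof (rule has_sum_SigmaD[OF 2])
    fix n :: nat assume "n \<in> ?A"
    then have "finite {d. d dvd n}" by auto
    then show "((\<lambda>d. case (n, d) of (n, d) \<Rightarrow> of_real (mangoldt d) * e n) has_sum (\<Sum>d | d dvd n. of_real (mangoldt d) * e n)) {d. d dvd n}"
      by (simp add: has_sum_finite)
  qed
  moreover have "(\<Sum>d | d dvd n. of_real (mangoldt d) * e n) = complex_of_real (ln (real n)) * e n" if "n \<in> ?A" for n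
    using mangoldt_sum[of n, where 'a = complex] that by (simp add: sum_distrib_right[symmetric])
  ultimately have "((\<lambda>n. complex_of_real (ln (real n)) * e n) has_sum (L * Z)) ?A"
    by (subst (asm) has_sum_cong) auto
  then show ?thesis using hD has_sum_unique by blast
qed

text \<open>One sequence of nonnegative coefficients serves both log |zeta| and the logarithmic
  derivative, the two series differing by the factor ln n. The termwise comparison in
  \<open>log_zeta_combination_ge\<close> rests on this.\<close>

lemma zeta_log_series:
  "\<exists>\<kappa>. (\<forall>n. \<kappa> n \<ge> (0::real)) \<and> (\<forall>n\<le>1. \<kappa> n = 0) \<and>
    (\<forall>s. Re s > 1 \<longrightarrow> zeta s \<noteq> 0 \<and>
      (\<lambda>n. \<kappa> n * Re (exp (- s * complex_of_real (ln (real n))))) sums ln (norm (zeta s)) \<and>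
      (\<lambda>n. \<kappa> n * ln (real n) * exp (- s * complex_of_real (ln (real n)))) sums (- deriv zeta s / zeta s))"
proof -
  define \<kappa> where "\<kappa> n = (if n \<le> 1 then 0 else mangoldt n / ln (real n) :: real)" for n :: nat
  have \<kappa>0: "\<kappa> n \<ge> 0" for n by (auto simp: \<kappa>_def mangoldt_nonneg)
  have \<kappa>1: "\<bar>\<kappa> n\<bar> \<le> 1" for n
    using \<kappa>0[of n] mangoldt_le_ln[of n] by (auto simp: \<kappa>_def divide_le_eq_1)
  have \<kappa>ln: "\<kappa> n * ln (real n) = mangoldt n" for n
  proof -
    have "n = 0 \<or> n = 1 \<or> n > 1" by linarith
    then show ?thesis by (auto simp: \<kappa>_def)
  qed
  obtain H H' where H: "\<And>s. Re s > 1 \<Longrightarrow> (\<lambda>n. \<kappa> n * exp (- s * complex_of_real (ln (real n)))) sums H s"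
      "\<And>s. Re s > 1 \<Longrightarrow> (\<lambda>n. - (\<kappa> n * ln (real n)) * exp (- s * complex_of_real (ln (real n)))) sums H' s"
      "\<And>s. Re s > 1 \<Longrightarrow> (H has_field_derivative H' s) (at s)"
    using dirichlet_series_deriv[of \<kappa>] \<kappa>1 by (force simp: \<kappa>_def)
  define b where "b n = (if n = 0 then 0 else 1 :: real)" for n :: nat
  obtain g g' where g: "\<And>s. Re s > 1 \<Longrightarrow> (\<lambda>n. complex_of_real (b n) * exp (- s * complex_of_real (ln (real n)))) sums g s"
      "\<And>s. Re s > 1 \<Longrightarrow> (\<lambda>n. - (b n * ln (real n)) * exp (- s * complex_of_real (ln (real n)))) sums g' s"
      "\<And>s. Re s > 1 \<Longrightarrow> (g has_field_derivative g' s) (at s)"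
    using dirichlet_series_deriv[of b] by (force simp: b_def)
  have gz: "g s = zeta s" if s: "Re s > 1" for s
  proof -
    have "(\<lambda>n. b (Suc n) * exp (- s * complex_of_real (ln (real (Suc n))))) sums (g s - b 0 * exp (- s * complex_of_real (ln (real 0))))"
      using sums_Suc_iff[of "\<lambda>n. b n * exp (- s * complex_of_real (ln (real n)))"] g(1)[OF s] by (simp add: b_def)
    moreover have "b (Suc n) * exp (- s * complex_of_real (ln (real (Suc n)))) = 1 / of_nat (Suc n) powr s" for n
    proof -
      have "Ln (of_nat (Suc n)) = complex_of_real (ln (real (Suc n)))"
        by (metis Ln_of_nat of_nat_0_less_iff zero_less_Suc)
      then show ?thesis by (simp add: b_def powr_def exp_minus divide_inverse del: of_nat_Suc)
    qed
    ultimately have "(\<lambda>n. 1 / of_nat (Suc n) powr s) sums g s" by (simp add: b_def)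
    then show ?thesis using zeta_sums[OF s] sums_unique2 by blast
  qed
  have prod: "g' s = H' s * zeta s" if s: "Re s > 1" for s
  proof -
    have "- H' s * g s = - g' s"
    proof (rule mangoldt_dirichlet_product[OF s])
      show "(\<lambda>n. complex_of_real (mangoldt n) * exp (- s * complex_of_real (ln (real n)))) sums (- H' s)"
        using sums_minus[OF H(2)[OF s]] \<kappa>ln by simp
      show "(\<lambda>n. complex_of_real (if n = 0 then 0 else 1) * exp (- s * complex_of_real (ln (real n)))) sums g s"
        using g(1)[OF s] by (simp add: b_def)
      have "- (- (b n * ln (real n)) * exp (- s * complex_of_real (ln (real n)))) =
              complex_of_real (ln (real n)) * exp (- s * complex_of_real (ln (real n)))" for n
        by (simp add: b_def)
      then show "(\<lambda>n. complex_of_real (ln (real n)) * exp (- s * complex_of_real (ln (real n)))) sums (- g' s)"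
        using sums_minus[OF g(2)[OF s]] by (simp only:)
    qed
    then show ?thesis using gz[OF s] by simp
  qed
  define S where "S = {s :: complex. Re s > 1}"
  have S: "connected S" "open S"
    unfolding S_def by (auto intro!: convex_connected convex_halfspace_Re_gt open_Re_gt)
  have D: "((\<lambda>s. g s * exp (- H s)) has_field_derivative 0) (at s)" if "s \<in> S" for s
  proof -
    have s: "Re s > 1" using that by (simp add: S_def)
    have "((\<lambda>s. g s * exp (- H s)) has_field_derivative
        g' s * exp (- H s) + exp (- H s) * (- H' s) * g s) (at s)"
      by (intro DERIV_mult g(3)[OF s] DERIV_fun_exp DERIV_minus H(3)[OF s])
    then show ?thesis using prod[OF s] gz[OF s] by (simp add: mult_ac)
  qed
  obtain c where cS: "\<And>s. s \<in> S \<Longrightarrow> g s * exp (- H s) = c"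
  proof (rule DERIV_zero_connected_constant[OF S finite.emptyI])
    show "continuous_on S (\<lambda>s. g s * exp (- H s))"
      by (intro continuous_at_imp_continuous_on ballI DERIV_isCont[OF D])
    show "\<forall>x\<in>S - {}. ((\<lambda>s. g s * exp (- H s)) has_field_derivative 0) (at x)"
      using D by blast
  qed auto
  have c: "g s * exp (- H s) = c" if "Re s > 1" for s using cS[of s] that by (simp add: S_def)
  \<comment> \<open>The constant value of zeta times exp (- H) is its limit along the integers,
    which is \<open>b 1\<close> times exp (- \<open>\<kappa> 1\<close>), that is 1.\<close>
  have "(\<lambda>k. g (of_nat k)) \<longlonglongrightarrow> b 1"
    by (rule dirichlet_series_at_infinity[OF _ _ g(1)]) (auto simp: b_def)
  moreover have "(\<lambda>k. H (of_nat k)) \<longlonglongrightarrow> \<kappa> 1"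
    by (rule dirichlet_series_at_infinity[OF \<kappa>1 _ H(1)]) (auto simp: \<kappa>_def)
  ultimately have "(\<lambda>k. g (of_nat k) * exp (- H (of_nat k))) \<longlonglongrightarrow> of_real (b 1) * exp (- of_real (\<kappa> 1))"
    by (intro tendsto_intros)
  then have "(\<lambda>k. g (of_nat k) * exp (- H (of_nat k))) \<longlonglongrightarrow> 1" by (simp add: b_def \<kappa>_def)
  moreover have "(\<lambda>k. g (of_nat k) * exp (- H (of_nat k))) \<longlonglongrightarrow> c"
  proof (rule tendsto_eventually)
    show "\<forall>\<^sub>F k in sequentially. g (of_nat k) * exp (- H (of_nat k)) = c"
      using eventually_ge_at_top[of 2] by eventually_elim (rule c, simp)
  qed
  ultimately have c1: "c = 1" using LIMSEQ_unique by blast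
  have zH: "zeta s = exp (H s)" if "Re s > 1" for s
    using c[OF that] gz[OF that] c1 by (simp add: exp_minus field_simps)
  have dz: "deriv zeta s = g' s" if s: "Re s > 1" for s
  proof (rule DERIV_imp_deriv)
    show "(zeta has_field_derivative g' s) (at s)"
      by (rule has_field_derivative_transform_within_open[OF g(3)[OF s] open_Re_gt[of 1]]) (use s gz in auto)
  qed
  show ?thesis
  proof (intro exI[of _ \<kappa>] conjI allI impI)
    fix s :: complex assume s: "Re s > 1"
    show "zeta s \<noteq> 0" using zH[OF s] by simp
    have "ln (norm (zeta s)) = Re (H s)" using zH[OF s] by simp
    then show "(\<lambda>n. \<kappa> n * Re (exp (- s * complex_of_real (ln (real n))))) sums ln (norm (zeta s))"
      using sums_Re[OF H(1)[OF s]] by simp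
    have "- deriv zeta s / zeta s = - H' s" using dz[OF s] prod[OF s] zH[OF s] by simp
    then show "(\<lambda>n. \<kappa> n * ln (real n) * exp (- s * complex_of_real (ln (real n)))) sums (- deriv zeta s / zeta s)"
      using sums_minus[OF H(2)[OF s]] by simp
  qed (use \<kappa>0 in \<open>auto simp: \<kappa>_def\<close>)
qed

lemma zeta_nonzero: "Re s > 1 \<Longrightarrow> zeta s \<noteq> 0"
  using zeta_log_series by blast

text \<open>The coefficients of log |zeta| are nonnegative, so taking absolute values and moving to
  the smaller abscissa increases every term; this settles both signs.\<close>

lemma abs_ln_zeta_le:
  assumes "Re s > 1" "1 < \<sigma>" "\<sigma> \<le> Re s"
  shows "\<bar>ln (norm (zeta s))\<bar> \<le> ln (norm (zeta (of_real \<sigma>)))"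
proof -
  obtain \<kappa> where k: "\<And>n. \<kappa> n \<ge> (0::real)" "\<And>n. n \<le> 1 \<Longrightarrow> \<kappa> n = 0"
     "\<And>s. Re s > 1 \<Longrightarrow> (\<lambda>n. \<kappa> n * Re (exp (- s * of_real (ln (real n))))) sums ln (norm (zeta s))"
    using zeta_log_series by blast
  let ?f = "\<lambda>s n. \<kappa> n * Re (exp (- s * of_real (ln (real n))))"
  have le: "\<bar>?f s n\<bar> \<le> ?f (of_real \<sigma>) n" for n
  proof (cases "n \<le> 1")
    case False
    have "\<bar>Re (exp (- s * of_real (ln (real n))))\<bar> \<le> norm (exp (- s * of_real (ln (real n))))"
      by (rule abs_Re_le_cmod)
    also have "\<dots> = exp (- (Re s * ln (real n)))" by simp
    also have "\<dots> \<le> exp (- (\<sigma> * ln (real n)))" using False assms by (simp add: mult_right_mono)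
    also have "\<dots> = Re (exp (- of_real \<sigma> * of_real (ln (real n))))"
      by (metis Re_complex_of_real exp_of_real mult_minus_left of_real_minus of_real_mult)
    finally show ?thesis using k(1)[of n] by (simp add: abs_mult mult_left_mono)
  qed (use k in auto)
  have s1: "?f s sums ln (norm (zeta s))" by (rule k(3)) fact
  have s2: "?f (of_real \<sigma>) sums ln (norm (zeta (of_real \<sigma>)))" by (rule k(3)) (use assms in simp)
  have "ln (norm (zeta s)) \<le> ln (norm (zeta (of_real \<sigma>)))"
    by (rule sums_le[OF _ s1 s2]) (use le abs_le_D1 in blast)
  moreover have "- ln (norm (zeta s)) \<le> ln (norm (zeta (of_real \<sigma>)))"
    by (rule sums_le[OF _ sums_minus[OF s1] s2]) (use le abs_le_D2 in blast)
  ultimately show ?thesis by simp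
qed

section \<open>Reflection, the pole at 1, and growth to the right of the line Re s = 1\<close>

text \<open>Uniqueness of the continuation: conjugating argument and value gives a function
  holomorphic off 1 with the same Dirichlet series.\<close>

lemma zeta_cnj:
  assumes "s \<noteq> 1"
  shows "zeta (cnj s) = cnj (zeta s)"
proof -
  have "(cnj \<circ> zeta \<circ> cnj) holomorphic_on - {1}"
    by (rule holomorphic_on_compose_cnj_cnj)
       (auto intro!: holomorphic_on_subset[OF zeta_holomorphic] simp: complex_eq_iff)
  then have h: "(\<lambda>s. cnj (zeta (cnj s))) holomorphic_on - {1}" by (simp add: o_def)
  have "(\<lambda>n. 1 / of_nat (Suc n) powr s) sums cnj (zeta (cnj s))" if "Re s > 1" for s
  proof -
    have "(\<lambda>n. 1 / of_nat (Suc n) powr cnj s) sums zeta (cnj s)" using that by (intro zeta_sums) simp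
    then have "(\<lambda>n. cnj (1 / of_nat (Suc n) powr cnj s)) sums cnj (zeta (cnj s))" by (simp only: sums_cnj)
    moreover have "cnj (1 / of_nat (Suc n) powr cnj s) = 1 / of_nat (Suc n) powr s" for n
    proof -
      have "Ln (of_nat (Suc n)) = complex_of_real (ln (real (Suc n)))"
        by (metis Ln_of_nat of_nat_0_less_iff zero_less_Suc)
      then show ?thesis by (simp add: powr_def exp_cnj del: of_nat_Suc)
    qed
    ultimately show ?thesis by simp
  qed
  from zeta_unique[OF h this, of s] assms have "cnj (zeta (cnj s)) = zeta s" by simp
  then show ?thesis by (metis complex_cnj_cnj)
qed

lemma dirichlet_zeta_eq_zeta:
  assumes "Re s > 1"
  shows "dirichlet_zeta s = zeta s"
proof -
  have "(\<lambda>n. 1 / of_nat (Suc n) powr s) sums dirichlet_zeta s"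
    using dirichlet_zeta_sums[OF assms] by (simp add: powr_minus divide_inverse)
  then show ?thesis using zeta_sums[OF assms] sums_unique2 by blast
qed

text \<open>(s - 1) zeta s extends to \<open>F\<close>, holomorphic near 1 with value 1 there. The
  two bounds are the local boundedness of the logarithmic derivative of \<open>F\<close> and of
  \<open>F\<close> itself.\<close>

lemma zeta_near_1:
  "\<exists>C>0. \<exists>d>0. \<forall>\<sigma>. 1 < \<sigma> \<and> \<sigma> < 1 + d \<longrightarrow>
     norm (deriv zeta (of_real \<sigma>) / zeta (of_real \<sigma>) + 1 / of_real (\<sigma> - 1)) \<le> C \<and>
     norm (zeta (of_real \<sigma>)) \<le> C / (\<sigma> - 1)"
proof -
  define F where "F s = 1 + (\<Sum>n. zeta_diff 2 n s)" for s
  have holF: "F holomorphic_on {s. Re s > 0}"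
    unfolding F_def using zeta_diff_sum_holomorphic[of 2] by (intro holomorphic_intros) simp
  have F1: "F 1 = 1"
  proof -
    \<comment> \<open>At s = 1 this is 1 - (1 + 0), because 0 gchoose 1 vanishes.\<close>
    have "zeta_diff 2 n 1 = 0" for n
      by (simp add: zeta_diff_def numeral_2_eq_2 lessThan_Suc of_nat_eq_0_iff del: of_nat_Suc)
    then show ?thesis by (simp add: F_def)
  qed
  have Fz: "F s = (s - 1) * zeta s" if "Re s > 1" for s
    using zeta_diff_sum_eq[OF that, of 2] dirichlet_zeta_eq_zeta[OF that] by (simp add: F_def)
  have o: "open {s. Re s > 0}" by (rule open_Re_gt)
  have holD: "deriv F holomorphic_on {s. Re s > 0}" by (rule holomorphic_deriv[OF holF o])
  have "continuous (at 1) F" "continuous (at 1) (deriv F)"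
    using holF holD o by (auto simp: holomorphic_on_imp_continuous_on continuous_on_eq_continuous_at
        dest!: holomorphic_on_imp_continuous_on)
  then have lim: "(F \<longlongrightarrow> F 1) (at 1)" "(deriv F \<longlongrightarrow> deriv F 1) (at 1)"
    by (simp_all add: continuous_within)
  have "((\<lambda>s. deriv F s / F s) \<longlongrightarrow> deriv F 1 / F 1) (at 1)"
    by (rule tendsto_divide[OF lim(2,1)]) (simp add: F1)
  then have "((\<lambda>s. norm (deriv F s / F s)) \<longlongrightarrow> norm (deriv F 1 / F 1)) (at 1)" "((\<lambda>s. norm (F s)) \<longlongrightarrow> norm (F 1)) (at 1)"
    using lim(1) by (auto intro: tendsto_norm)
  then have "\<forall>\<^sub>F s in at 1. norm (deriv F s / F s) < norm (deriv F 1 / F 1) + 1"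
     "\<forall>\<^sub>F s in at 1. norm (F s) < norm (F 1) + 1"
    by (auto intro: order_tendstoD)
  then have "\<forall>\<^sub>F s in at 1. norm (deriv F s / F s) < norm (deriv F 1 / F 1) + 1 \<and> norm (F s) < norm (F 1) + 1"
    by eventually_elim simp
  then obtain d where d: "d > 0" "\<And>s. s \<noteq> 1 \<Longrightarrow> dist s 1 < d \<Longrightarrow>
       norm (deriv F s / F s) < norm (deriv F 1 / F 1) + 1 \<and> norm (F s) < norm (F 1) + 1"
    unfolding eventually_at by auto
  define C where "C = norm (deriv F 1 / F 1) + 2"
  have "C > 0" unfolding C_def by (intro add_nonneg_pos) simp_all
  moreover have "\<forall>\<sigma>. 1 < \<sigma> \<and> \<sigma> < 1 + d \<longrightarrow>
     norm (deriv zeta (of_real \<sigma>) / zeta (of_real \<sigma>) + 1 / of_real (\<sigma> - 1)) \<le> C \<and>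
     norm (zeta (of_real \<sigma>)) \<le> C / (\<sigma> - 1)"
  proof (intro conjI allI impI)
    fix \<sigma> :: real assume \<sigma>: "1 < \<sigma> \<and> \<sigma> < 1 + d"
    define s where "s = complex_of_real \<sigma>"
    have "s - 1 = of_real (\<sigma> - 1)" by (simp add: s_def)
    then have ns: "norm (s - 1) = \<sigma> - 1" using \<sigma> by (simp only: norm_of_real) simp
    have s: "Re s > 1" "dist s 1 < d" using \<sigma> ns by (simp_all add: s_def dist_norm)
    have s1: "s \<noteq> 1" using s(1) by auto
    have nz: "zeta s \<noteq> 0" "s - 1 \<noteq> 0" using zeta_nonzero[OF s(1)] s1 by auto
    have dz: "(zeta has_field_derivative deriv zeta s) (at s)"
      by (rule holomorphic_derivI[OF zeta_holomorphic]) (use s1 in \<open>auto simp: open_delete\<close>)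
    have "((\<lambda>s. (s - 1) * zeta s) has_field_derivative (1 - 0) * zeta s + deriv zeta s * (s - 1)) (at s)"
      by (intro DERIV_mult DERIV_diff DERIV_ident DERIV_const dz)
    then have "(F has_field_derivative (1 - 0) * zeta s + deriv zeta s * (s - 1)) (at s)"
      by (rule has_field_derivative_transform_within_open[OF _ open_Re_gt[of 1]]) (use s Fz in auto)
    then have "deriv F s / F s = (zeta s + deriv zeta s * (s - 1)) / ((s - 1) * zeta s)"
      using Fz[OF s(1)] by (simp add: DERIV_imp_deriv)
    also have "\<dots> = deriv zeta s / zeta s + 1 / (s - 1)"
      using nz by (simp add: add_divide_distrib)
    finally have "deriv F s / F s = deriv zeta s / zeta s + 1 / (s - 1)" .
    then have "norm (deriv zeta s / zeta s + 1 / (s - 1)) \<le> C" using d(2)[OF s1 s(2)] by (simp add: C_def)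
    then show "norm (deriv zeta (of_real \<sigma>) / zeta (of_real \<sigma>) + 1 / of_real (\<sigma> - 1)) \<le> C"
      by (simp add: s_def)
    have "norm (F s) \<le> C" using d(2)[OF s1 s(2)] F1 norm_ge_zero[of "deriv F 1 / F 1"]
      unfolding C_def F1 norm_one by linarith
    moreover have "norm (F s) = (\<sigma> - 1) * norm (zeta s)"
      using Fz[OF s(1)] ns by (simp add: norm_mult)
    ultimately show "norm (zeta (of_real \<sigma>)) \<le> C / (\<sigma> - 1)"
      using \<sigma> by (simp add: s_def pos_le_divide_eq mult.commute)
  qed
  ultimately show ?thesis using d(1) by blast
qed

text \<open>The mean value inequality used twice, for z^(- s) and then for z^(1 - s) minus a linear
  function. It compares one term n^(- s) with one step of a telescoping sum.\<close>

lemma powr_taylor_bound: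
  fixes s :: complex and x :: real
  assumes x: "x \<ge> 1" and s: "Re s \<ge> 0"
  shows "norm (of_real (x + 1) powr (1 - s) - of_real x powr (1 - s) - (1 - s) * of_real x powr (- s))
     \<le> norm (1 - s) * norm s * x powr (- Re s - 1)"
proof -
  define S where "S = closed_segment (complex_of_real x) (of_real (x + 1))"
  have S: "\<exists>v\<in>{x..x + 1}. z = of_real v" if "z \<in> S" for z
    using that by (auto simp: S_def closed_segment_of_real closed_segment_eq_real_ivl simp del: of_real_add)
  have xS: "complex_of_real x \<in> S" "complex_of_real (x + 1) \<in> S" by (simp_all add: S_def del: of_real_add)
  have cS: "convex S" by (simp add: S_def)
  have pw: "((\<lambda>z. z powr a) has_field_derivative a * z powr (a - 1)) (at z within S)" if "z \<in> S" for z a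
    by (rule has_field_derivative_at_within, rule has_field_derivative_powr)
       (use S[OF that] x in \<open>auto simp: complex_nonpos_Reals_iff\<close>)
  have dist1: "norm (z - of_real x) \<le> 1" if "z \<in> S" for z
    using S[OF that] by (auto simp: norm_of_real simp flip: of_real_diff)
  have bound1: "norm (z powr (- s) - of_real x powr (- s)) \<le> norm s * x powr (- Re s - 1)"
    if z: "z \<in> S" for z
  proof -
    have "norm (z powr (- s) - of_real x powr (- s)) \<le> norm s * x powr (- Re s - 1) * norm (z - of_real x)"
    proof (rule field_differentiable_bound[OF cS pw _ z xS(1)])
      fix z assume "z \<in> S"
      then obtain v where v: "z = of_real v" "v \<in> {x..x + 1}" using S by blast
      have "norm (- s * z powr (- s - 1)) = norm s * v powr (- Re s - 1)"
        using v x by (simp add: norm_mult norm_powr_real_powr)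
      also have "\<dots> \<le> norm s * x powr (- Re s - 1)"
        using v x s by (intro mult_left_mono powr_mono2') auto
      finally show "norm (- s * z powr (- s - 1)) \<le> norm s * x powr (- Re s - 1)" .
    qed
    also have "\<dots> \<le> norm s * x powr (- Re s - 1) * 1"
      by (intro mult_left_mono dist1 z) auto
    finally show ?thesis by simp
  qed
  define f where "f z = z powr (1 - s) - (1 - s) * z * of_real x powr (- s)" for z :: complex
  have "norm (f (of_real (x + 1)) - f (of_real x)) \<le> norm (1 - s) * (norm s * x powr (- Re s - 1)) * norm (complex_of_real (x + 1) - of_real x)"
  proof (rule field_differentiable_bound[OF cS _ _ xS(2,1)])
    fix z assume z: "z \<in> S"
    show "(f has_field_derivative ((1 - s) * z powr ((1 - s) - 1) - (1 - s) * 1 * of_real x powr (- s))) (at z within S)"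
      unfolding f_def by (intro DERIV_diff pw[OF z] DERIV_cmult_right DERIV_cmult DERIV_ident)
    have "(1 - s) * z powr ((1 - s) - 1) - (1 - s) * 1 * of_real x powr (- s) = (1 - s) * (z powr (- s) - of_real x powr (- s))"
      by (simp add: algebra_simps)
    then show "norm ((1 - s) * z powr ((1 - s) - 1) - (1 - s) * 1 * of_real x powr (- s)) \<le> norm (1 - s) * (norm s * x powr (- Re s - 1))"
      by (simp only: norm_mult) (intro mult_left_mono bound1 z norm_ge_zero)
  qed
  moreover have "f (of_real (x + 1)) - f (of_real x) = of_real (x + 1) powr (1 - s) - of_real x powr (1 - s) - (1 - s) * of_real x powr (- s)"
    by (simp add: f_def algebra_simps)
  ultimately show ?thesis by simp
qed

lemma suminf_inverse_square_le:
  assumes "N \<ge> 1"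
  shows "summable (\<lambda>n. 1 / (real (n + N + 1))\<^sup>2)" "(\<Sum>n. 1 / (real (n + N + 1))\<^sup>2) \<le> 1 / real N"
proof -
  have "(\<lambda>n. 1 / real (n + N)) \<longlonglongrightarrow> 0"
    by (rule LIMSEQ_ignore_initial_segment[OF lim_1_over_n])
  from telescope_sums'[OF this] have t: "(\<lambda>n. 1 / real (n + N) - 1 / real (n + N + 1)) sums (1 / real N)"
    by simp
  have le: "1 / (real (n + N + 1))\<^sup>2 \<le> 1 / real (n + N) - 1 / real (n + N + 1)" for n
  proof -
    have "1 / real (n + N) - 1 / real (n + N + 1) = 1 / (real (n + N) * real (n + N + 1))"
      using assms by (simp add: field_simps)
    moreover have "real (n + N) * real (n + N + 1) \<le> (real (n + N + 1))\<^sup>2"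
      by (simp add: power2_eq_square mult_right_mono)
    ultimately show ?thesis using assms by (simp add: frac_le)
  qed
  show s: "summable (\<lambda>n. 1 / (real (n + N + 1))\<^sup>2)"
    by (rule summable_comparison_test[OF _ sums_summable[OF t]]) (use le in auto)
  show "(\<Sum>n. 1 / (real (n + N + 1))\<^sup>2) \<le> 1 / real N"
    using suminf_le[OF le s sums_summable[OF t]] t by (simp add: sums_iff)
qed

text \<open>The left half circles reach up to Re s = 1 + \<lambda>, beyond the range of the growth
  hypothesis, and this bound covers the gap. The first N = floor |t| terms give 1 + ln N; in the
  tail (1 - s) n^(- s) is compared with a telescoping difference, and the error |s| / N stays
  bounded because N is about |t|.\<close>

lemma zeta_log_bound:
  "\<exists>C>0. \<forall>s. 1 < Re s \<and> Re s \<le> 2 \<and> \<bar>Im s\<bar> \<ge> 3 \<longrightarrow> norm (zeta s) \<le> C * ln \<bar>Im s\<bar>"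
proof (intro exI[of _ "6::real"] conjI allI impI)
  fix s :: complex assume s: "1 < Re s \<and> Re s \<le> 2 \<and> \<bar>Im s\<bar> \<ge> 3"
  define t where "t = \<bar>Im s\<bar>"
  define N where "N = nat \<lfloor>t\<rfloor>"
  have N: "real N \<le> t" "t < real N + 1" "N \<ge> 3" using s unfolding N_def t_def by linarith+
  have ns: "norm s \<le> 2 + t" "norm (1 - s) \<ge> t"
    using cmod_le[of s] abs_Im_le_cmod[of "1 - s"] s by (auto simp: t_def)
  define p where "p n = complex_of_real (real n) powr (- s)" for n
  have Z: "(\<lambda>n. p (Suc n)) sums zeta s"
    using dirichlet_zeta_sums[of s] dirichlet_zeta_eq_zeta[of s] s by (simp add: p_def)
  have tail: "(\<lambda>n. p (n + N + 1)) sums (zeta s - (\<Sum>n<N. p (Suc n)))"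
    using sums_split_initial_segment[OF Z, of N] by simp
  define E where "E n = complex_of_real (real (n + N + 1) + 1) powr (1 - s) - of_real (real (n + N + 1)) powr (1 - s)
      - (1 - s) * of_real (real (n + N + 1)) powr (- s)" for n
  have normE: "norm (E n) \<le> norm (1 - s) * norm s * (1 / (real (n + N + 1))\<^sup>2)" for n
  proof -
    have "norm (E n) \<le> norm (1 - s) * norm s * (real (n + N + 1)) powr (- Re s - 1)"
      unfolding E_def by (rule powr_taylor_bound) (use s in auto)
    also have "\<dots> \<le> norm (1 - s) * norm s * (real (n + N + 1)) powr (- 2)"
      using s by (intro mult_left_mono powr_mono) auto
    also have "(real (n + N + 1)) powr (- 2) = 1 / (real (n + N + 1))\<^sup>2"
      by (simp add: powr_minus_divide powr_realpow')
    finally show ?thesis .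
  qed
  have N1: "N \<ge> 1" using N by simp
  have sumE: "norm (\<Sum>n. E n) \<le> norm (1 - s) * norm s / real N"
  proof -
    have "norm (\<Sum>n. E n) \<le> (\<Sum>n. norm (1 - s) * norm s * (1 / (real (n + N + 1))\<^sup>2))"
      by (rule norm_suminf_le[OF normE]) (intro summable_mult suminf_inverse_square_le N1)
    also have "\<dots> = norm (1 - s) * norm s * (\<Sum>n. 1 / (real (n + N + 1))\<^sup>2)"
      by (rule suminf_mult[OF suminf_inverse_square_le(1)[OF N1]])
    also have "\<dots> \<le> norm (1 - s) * norm s * (1 / real N)"
      by (intro mult_left_mono suminf_inverse_square_le N1) auto
    finally show ?thesis by simp
  qed
  have summE: "summable E"
    by (rule summable_comparison_test[OF _ summable_mult[OF suminf_inverse_square_le(1)[OF N1]]]) (use normE in blast)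
  have "(\<lambda>n. complex_of_real (real (n + N + 1)) powr (1 - s)) \<longlonglongrightarrow> 0"
  proof (rule tendsto_norm_zero_cancel)
    have "(\<lambda>n. real n powr (1 - Re s)) \<longlonglongrightarrow> 0"
      by (rule tendsto_neg_powr) (use s in \<open>auto simp: filterlim_real_sequentially\<close>)
    from LIMSEQ_ignore_initial_segment[OF this, of "N + 1"]
    show "(\<lambda>n. norm (complex_of_real (real (n + N + 1)) powr (1 - s))) \<longlonglongrightarrow> 0"
      by (simp add: norm_powr_real_powr add.assoc)
  qed
  from telescope_sums[OF this]
  have tele: "(\<lambda>n. complex_of_real (real (n + N + 1) + 1) powr (1 - s) - of_real (real (n + N + 1)) powr (1 - s)) sums
      (0 - complex_of_real (real (N + 1)) powr (1 - s))"
    by (simp add: add_ac)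
  \<comment> \<open>The telescoping part collapses to its first term, of norm at most 1 since Re s >
    1, and the tail of the series can be solved for.\<close>
  have "E sums ((0 - complex_of_real (real (N + 1)) powr (1 - s)) - (1 - s) * (zeta s - (\<Sum>n<N. p (Suc n))))"
    unfolding E_def using sums_diff[OF tele sums_mult[OF tail, of "1 - s"]] by (simp add: p_def)
  then have eq: "(1 - s) * (zeta s - (\<Sum>n<N. p (Suc n))) = - (complex_of_real (real (N + 1)) powr (1 - s)) - (\<Sum>n. E n)"
    by (simp add: sums_iff algebra_simps)
  have "norm (complex_of_real (real (N + 1)) powr (1 - s)) = real (N + 1) powr (1 - Re s)"
    by (subst norm_powr_real_powr) auto
  also have "\<dots> \<le> real (N + 1) powr 0" using s by (intro powr_mono) auto
  finally have n1: "norm (complex_of_real (real (N + 1)) powr (1 - s)) \<le> 1" by simp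
  have "norm ((1 - s) * (zeta s - (\<Sum>n<N. p (Suc n)))) \<le> 1 + norm (1 - s) * norm s / real N"
    unfolding eq
    using norm_triangle_ineq4[of "- (complex_of_real (real (N + 1)) powr (1 - s))" "\<Sum>n. E n"] n1 sumE
    unfolding norm_minus_cancel by linarith
  then have "norm (1 - s) * norm (zeta s - (\<Sum>n<N. p (Suc n))) \<le> 1 + norm (1 - s) * norm s / real N"
    by (simp only: norm_mult)
  moreover have pos: "norm (1 - s) > 0" "norm (1 - s) \<ge> 3" using ns s t_def by linarith+
  ultimately have "norm (zeta s - (\<Sum>n<N. p (Suc n))) \<le> 1 / norm (1 - s) + norm s / real N"
    by (simp add: field_simps)
  also have "\<dots> \<le> 1 / 3 + 2"
  proof (intro add_mono)
    show "1 / norm (1 - s) \<le> 1 / 3" using pos by (intro divide_left_mono) auto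
    have "norm s \<le> 2 * real N" using ns N by linarith
    then show "norm s / real N \<le> 2" using N by (simp add: divide_le_eq)
  qed
  finally have 1: "norm (zeta s - (\<Sum>n<N. p (Suc n))) \<le> 3" by simp
  have "norm (\<Sum>n<N. p (Suc n)) \<le> (\<Sum>n<N. 1 / real (Suc n))"
  proof (rule sum_norm_le)
    fix n
    have "norm (p (Suc n)) = real (Suc n) powr (- Re s)"
      unfolding p_def by (subst norm_powr_real_powr) auto
    also have "\<dots> \<le> real (Suc n) powr (- 1)" using s by (intro powr_mono) auto
    finally show "norm (p (Suc n)) \<le> 1 / real (Suc n)" by (simp add: powr_minus_divide)
  qed
  also have "\<dots> \<le> 1 + ln (real N)"
  proof -
    have "(\<Sum>n<N. 1 / real (Suc n)) \<le> 1 + ln (real N)" if "N \<ge> 1" for N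
      using that
    proof (induction N rule: dec_induct)
      case (step n)
      have "ln (real n / real (Suc n)) \<le> real n / real (Suc n) - 1"
        using step by (intro ln_le_minus_one) auto
      then have "1 / real (Suc n) \<le> ln (real (Suc n)) - ln (real n)"
        using step by (simp add: ln_div field_simps)
      then show ?case using step by simp
    qed auto
    then show ?thesis using N1 by simp
  qed
  also have "\<dots> \<le> 1 + ln t" using N by simp
  finally have 2: "norm (\<Sum>n<N. p (Suc n)) \<le> 1 + ln t" .
  have "norm (zeta s) \<le> norm (zeta s - (\<Sum>n<N. p (Suc n))) + norm (\<Sum>n<N. p (Suc n))"
    using norm_triangle_ineq[of "zeta s - (\<Sum>n<N. p (Suc n))" "\<Sum>n<N. p (Suc n)"] by simp
  then have "norm (zeta s) \<le> 4 + ln t" using 1 2 by linarith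
  moreover have "ln t \<ge> 1"
  proof -
    have "exp 1 \<le> t" using exp_le s by (simp add: t_def)
    then show ?thesis by (metis exp_gt_zero ln_exp ln_mono order_less_le_trans)
  qed
  ultimately show "norm (zeta s) \<le> 6 * ln \<bar>Im s\<bar>" unfolding t_def[symmetric] by linarith
qed simp

section \<open>The conformal map of the strip\<close>

text \<open>Arctan z is i/2 times the logarithm of the Moebius image u of z, and u stays in the
  right half-plane. The argument of u, less than pi / 2 in modulus, gives the real part, and ln |u|
  the imaginary part.\<close>

lemma Arctan_bounds:
  assumes z: "norm z < 1"
  shows "\<bar>Re (Arctan z)\<bar> < pi / 4" "\<bar>Im (Arctan z)\<bar> \<le> ln ((1 + norm z) / (1 - norm z)) / 2"
    "Re z \<ge> 0 \<Longrightarrow> Re (Arctan z) \<ge> 0"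
proof -
  define u where "u = (1 - \<i> * z) / (1 + \<i> * z)"
  have n1: "1 - norm z \<le> norm (1 + \<i> * z)" "norm (1 + \<i> * z) \<le> 1 + norm z"
    "1 - norm z \<le> norm (1 - \<i> * z)" "norm (1 - \<i> * z) \<le> 1 + norm z"
    using norm_triangle_ineq[of 1 "\<i> * z"] norm_triangle_ineq4[of 1 "\<i> * z"]
      norm_triangle_ineq2[of 1 "\<i> * z"] norm_triangle_ineq2[of 1 "- (\<i> * z)"]
    by (simp_all add: norm_mult)
  have nz: "1 + \<i> * z \<noteq> 0" "1 - \<i> * z \<noteq> 0" using n1 z by auto
  have u0: "u \<noteq> 0" using nz by (simp add: u_def)
  have ReA: "Re (Arctan z) = - Im (Ln u) / 2" and ImA: "Im (Arctan z) = Re (Ln u) / 2"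
    by (simp_all add: Arctan_def u_def)
  have "Re u > 0" using z by (simp add: u_def Re_complex_div_lemma)
  then have "\<bar>Im (Ln u)\<bar> < pi / 2" using Re_Ln_pos_lt[OF u0] by simp
  then show "\<bar>Re (Arctan z)\<bar> < pi / 4" using ReA by (simp add: abs_if split: if_splits)
  have nu: "norm u = norm (1 - \<i> * z) / norm (1 + \<i> * z)" by (simp add: u_def norm_divide)
  have up: "norm u \<le> (1 + norm z) / (1 - norm z)"
    unfolding nu using n1 z by (intro frac_le) auto
  have "(1 - norm z) / (1 + norm z) \<le> norm u"
    unfolding nu using n1 z nz by (intro frac_le) auto
  moreover have "0 < (1 - norm z) / (1 + norm z)" using z by (intro divide_pos_pos) (auto intro: add_pos_nonneg)
  ultimately have "ln ((1 - norm z) / (1 + norm z)) \<le> ln (norm u)" by (intro ln_mono)  auto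
  moreover have "ln ((1 - norm z) / (1 + norm z)) = - ln ((1 + norm z) / (1 - norm z))"
  proof -
    have "1 + norm z > 0" "1 - norm z > 0" using z by (auto intro: add_pos_nonneg)
    then show ?thesis by (simp add: ln_div)
  qed
  moreover have "ln (norm u) \<le> ln ((1 + norm z) / (1 - norm z))"
    by (rule ln_mono) (use up u0 in auto)
  moreover have "Re (Ln u) = ln (norm u)" using u0 by simp
  ultimately show "\<bar>Im (Arctan z)\<bar> \<le> ln ((1 + norm z) / (1 - norm z)) / 2"
    using ImA by (simp add: abs_if)
  assume "Re z \<ge> 0"
  have "Im u \<le> 0"
  proof -
    have "Im u = (Im (1 - \<i> * z) * Re (1 + \<i> * z) - Re (1 - \<i> * z) * Im (1 + \<i> * z)) / (norm (1 + \<i> * z))\<^sup>2"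
      unfolding u_def Im_divide cmod_power2 by simp
    also have "\<dots> = - (2 * Re z) / (norm (1 + \<i> * z))\<^sup>2" by (simp add: algebra_simps)
    also have "\<dots> \<le> 0" using \<open>Re z \<ge> 0\<close> by (simp add: divide_nonpos_nonneg)
    finally show ?thesis .
  qed
  have "Im (Ln u) \<le> 0"
  proof (rule ccontr)
    assume "\<not> Im (Ln u) \<le> 0"
    then have "0 < Im (Ln u) \<and> Im (Ln u) < pi" using \<open>\<bar>Im (Ln u)\<bar> < pi / 2\<close> pi_gt_zero by linarith
    then have "0 < Im u" using Im_Ln_pos_lt[OF u0] by simp
    then show False using \<open>Im u \<le> 0\<close> by simp
  qed
  then show "Re (Arctan z) \<ge> 0" using ReA by simp
qed

lemma Arctan_minus': "norm z < 1 \<Longrightarrow> Arctan (- z) = - Arctan z"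
proof -
  assume z: "norm z < 1"
  have "- z = tan (- Arctan z)"
  proof -
    have "z\<^sup>2 \<noteq> - 1"
    proof
      assume "z\<^sup>2 = - 1"
      then have "norm z ^ 2 = 1" by (metis norm_minus_cancel norm_one norm_power)
      then have "norm z = 1 \<or> norm z = - 1" by (simp only: power2_eq_1_iff)
      then show False using z norm_ge_zero[of z] by linarith
    qed
    then show ?thesis by (simp add: tan_minus)
  qed
  then have "Arctan (- z) = Arctan (tan (- Arctan z))" by simp
  also have "\<dots> = - Arctan z"
    by (rule Arctan_tan) (use Arctan_bounds(1)[OF z] pi_gt_zero in simp)
  finally show ?thesis .
qed

text \<open>Arctan is purely imaginary at i Im z, and moving from there to z costs |Re z| times the
  bound 1 / (1 - |z|^2) for the derivative. Near 0 this is asymptotically exact, as is needed for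
  zeros close to the centre.\<close>

lemma abs_Re_Arctan_le:
  assumes z: "norm z < 1"
  shows "\<bar>Re (Arctan z)\<bar> \<le> \<bar>Re z\<bar> / (1 - (norm z)\<^sup>2)"
proof -
  define y where "y = \<i> * of_real (Im z)"
  have ny: "norm y \<le> norm z" by (simp add: y_def norm_mult abs_Im_le_cmod)
  have "Re (Arctan y) = 0"
  proof -
    have "\<bar>Im z\<bar> < 1" using z abs_Im_le_cmod[of z] by linarith
    then have "(1 - \<i> * y) / (1 + \<i> * y) = of_real ((1 + Im z) / (1 - Im z))"
      "(1 + Im z) / (1 - Im z) > 0"
      by (simp_all add: y_def mult.assoc[symmetric])
    then have "Im (Ln ((1 - \<i> * y) / (1 + \<i> * y))) = 0"
      by (metis Im_complex_of_real Ln_of_real)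
    then show ?thesis by (simp add: Arctan_def)
  qed
  moreover have "norm (Arctan z - Arctan y) \<le> 1 / (1 - (norm z)\<^sup>2) * norm (z - y)"
  proof (rule field_differentiable_bound[where S = "cball 0 (norm z)"])
    fix w :: complex assume w: "w \<in> cball 0 (norm z)"
    then have w1: "norm w < 1" using z by simp
    show "(Arctan has_field_derivative inverse (1 + w\<^sup>2)) (at w within cball 0 (norm z))"
      by (rule has_field_derivative_at_within, rule has_field_derivative_Arctan)
         (use w1 abs_Im_le_cmod[of w] in linarith)
    have "1 - (norm z)\<^sup>2 \<le> 1 - (norm w)\<^sup>2" using w by (simp add: power_mono)
    also have "\<dots> \<le> norm (1 + w\<^sup>2)"
      using norm_triangle_ineq2[of 1 "- (w\<^sup>2)"] by (simp add: norm_power)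
    finally have "1 - (norm z)\<^sup>2 \<le> norm (1 + w\<^sup>2)" .
    moreover have "1 - (norm z)\<^sup>2 > 0" using z by (simp add: power_less_one_iff)
    ultimately show "norm (inverse (1 + w\<^sup>2)) \<le> 1 / (1 - (norm z)\<^sup>2)"
      by (simp add: norm_inverse inverse_eq_divide frac_le norm_divide)
  qed (use ny in auto)
  moreover have "norm (z - y) = \<bar>Re z\<bar>"
  proof -
    have "z - y = of_real (Re z)" by (simp add: y_def complex_eq_iff)
    then show ?thesis by (simp only: norm_of_real)
  qed
  ultimately show ?thesis using abs_Re_le_cmod[of "Arctan z - Arctan y"] by simp
qed

text \<open>The radius is a compromise: the final constant improves as r tends to 1, but for
  \<open>prime_weight_nonneg\<close> the bound 3.1 must stay below pi r, twice the weight pi r / 2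
  of the logarithmic derivatives.\<close>

lemma cmod_Arctan_le:
  assumes "norm z \<le> 0.993"
  shows "norm (Arctan z) \<le> 3.1"
proof -
  have z: "norm z < 1" using assms by simp
  have "(1 + norm z) / (1 - norm z) \<le> (1 + 0.993) / (1 - 0.993)"
    using assms by (intro frac_le) auto
  also have "\<dots> \<le> (285::real)" by simp
  finally have "ln ((1 + norm z) / (1 - norm z)) \<le> ln 285"
    using z by (intro ln_mono divide_pos_pos) (auto intro: add_pos_nonneg)
  \<comment> \<open>387 is below 2.7^6, hence ln 387 <= 6, and the quotient 285 / 387 gains at least
    1 - 285/387 > 0.26.\<close>
  also have "ln (285::real) \<le> 5.9"
  proof -
    have "exp (1::real) \<ge> 5837465777 / 2147483648 - inverse (2 ^ 32)"
      using e_approx_32 by linarith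
    then have e: "exp (1::real) \<ge> 2.7" by simp
    have "(387::real) \<le> 2.7 ^ 6" by (simp add: eval_nat_numeral)
    also have "\<dots> \<le> exp 1 ^ 6" by (rule power_mono[OF e]) simp
    also have "\<dots> = exp 6" by (simp flip: exp_of_nat_mult)
    finally have "ln 387 \<le> (6::real)" by (metis exp_gt_zero ln_exp ln_mono zero_less_numeral)
    moreover have "ln (285 / 387 :: real) \<le> 285 / 387 - 1" by (rule ln_le_minus_one) simp
    moreover have "ln (285 / 387 :: real) = ln 285 - ln 387" by (subst ln_div) simp_all
    ultimately show ?thesis by linarith
  qed
  finally have im: "\<bar>Im (Arctan z)\<bar> \<le> 2.95" using Arctan_bounds(2)[OF z] by simp
  have re: "\<bar>Re (Arctan z)\<bar> \<le> 0.8" using Arctan_bounds(1)[OF z] pi_approx(2) by simp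
  have "(Re (Arctan z))\<^sup>2 \<le> 0.8\<^sup>2" "(Im (Arctan z))\<^sup>2 \<le> 2.95\<^sup>2"
    using power_mono[OF re abs_ge_zero, of 2] power_mono[OF im abs_ge_zero, of 2] unfolding power2_abs .
  then have "(norm (Arctan z))\<^sup>2 \<le> 3.1\<^sup>2" unfolding cmod_power2 by (simp add: power2_eq_square)
  then show ?thesis by (rule power2_le_imp_le) simp
qed

section \<open>Elementary inequalities for arctan and the exponential\<close>

lemma arctan_bounds_nonneg:
  fixes x :: real
  assumes "x \<ge> 0"
  shows "x / (1 + x\<^sup>2) \<le> arctan x" "arctan x \<le> x" "0 \<le> x - arctan x" "x - arctan x \<le> x ^ 3"
proof -
  have 1: "x / (1 + x\<^sup>2) \<le> arctan x \<and> arctan x \<le> x"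
  proof (cases "x = 0")
    case False
    then have "x > 0" using assms by simp
    have "\<exists>z. 0 < z \<and> z < x \<and> arctan x - arctan 0 = (x - 0) * inverse (1 + z\<^sup>2)"
      using \<open>x > 0\<close> by (intro MVT2) (auto intro!: derivative_eq_intros)
    then obtain z where z: "0 < z" "z < x" "arctan x = x * inverse (1 + z\<^sup>2)" by auto
    have "inverse (1 + x\<^sup>2) \<le> inverse (1 + z\<^sup>2)"
      using z by (intro le_imp_inverse_le) (auto intro: power_mono add_pos_nonneg)
    moreover have "inverse (1 + z\<^sup>2) \<le> 1" by (simp add: inverse_le_1_iff)
    ultimately have "x * inverse (1 + x\<^sup>2) \<le> arctan x" "arctan x \<le> x * 1"
      unfolding z(3) using assms by (intro mult_left_mono; simp)+
    then show ?thesis by (simp add: divide_inverse)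
  qed simp
  show "x / (1 + x\<^sup>2) \<le> arctan x" "arctan x \<le> x" "0 \<le> x - arctan x" using 1 by auto
  have "x - x / (1 + x\<^sup>2) = x ^ 3 / (1 + x\<^sup>2)"
    by (simp add: field_simps power2_eq_square power3_eq_cube add_nonneg_eq_0_iff)
  also have "\<dots> \<le> x ^ 3" using assms by (simp add: divide_le_eq mult_le_cancel_left1 add_pos_nonneg)
  finally show "x - arctan x \<le> x ^ 3" using 1 by linarith
qed

text \<open>The bound is uniform in l although l multiplies the change of exponent: with a = arctan
  x this change is at most l a x^2, and l a exp (- l a) <= 1. It allows the weights at arctan (i
  \<epsilon>) to be replaced by powers y^i.\<close>

lemma exp_arctan_diff:
  fixes x l :: real
  assumes x: "0 \<le> x" and l: "l \<ge> 0"
  shows "\<bar>exp (- l * arctan x) / (1 + x\<^sup>2) - exp (- l * x)\<bar> \<le> 2 * x\<^sup>2"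
proof -
  define a where "a = arctan x"
  have a: "x / (1 + x\<^sup>2) \<le> a" "0 \<le> a" "a \<le> x"
    using arctan_bounds_nonneg[OF x] x by (auto simp: a_def)
  have e1: "exp (- l * a) \<le> 1" using l a by simp
  have p: "0 < 1 + x\<^sup>2" by (simp add: add_pos_nonneg)
  have "exp (- l * a) - exp (- l * a) / (1 + x\<^sup>2) = exp (- l * a) * (x\<^sup>2 / (1 + x\<^sup>2))"
    using p by (simp add: field_simps)
  moreover have "exp (- l * a) * (x\<^sup>2 / (1 + x\<^sup>2)) \<le> 1 * x\<^sup>2"
    using e1 by (intro mult_mono) (auto simp: divide_le_eq mult_le_cancel_left1 p)
  moreover have "0 \<le> exp (- l * a) * (x\<^sup>2 / (1 + x\<^sup>2))" by simp
  ultimately have 1: "\<bar>exp (- l * a) - exp (- l * a) / (1 + x\<^sup>2)\<bar> \<le> x\<^sup>2" by simp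
  have "exp (- l * x) \<le> exp (- l * a)" using l a by (simp add: mult_left_mono)
  moreover have "exp (- l * a) - exp (- l * x) \<le> x\<^sup>2"
  proof -
    have "exp (- l * a) - exp (- l * x) = exp (- l * a) * (1 - exp (- (l * (x - a))))"
      by (simp add: algebra_simps flip: exp_add)
    also have "\<dots> \<le> exp (- l * a) * (l * (x - a))"
      using exp_ge_add_one_self[of "- (l * (x - a))"] by (intro mult_left_mono) auto
    also have "x - a \<le> a * x\<^sup>2"
    proof -
      have "x \<le> a * (1 + x\<^sup>2)" using a(1) p by (simp add: divide_le_eq)
      then show ?thesis by (simp add: algebra_simps)
    qed
    then have "exp (- l * a) * (l * (x - a)) \<le> exp (- l * a) * (l * (a * x\<^sup>2))"
      using l by (intro mult_left_mono) auto
    also have "\<dots> = (exp (- (l * a)) * (l * a)) * x\<^sup>2" by simp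
    also have "\<dots> \<le> 1 * x\<^sup>2"
    proof (rule mult_right_mono)
      have "l * a \<le> exp (l * a)" using exp_ge_add_one_self[of "l * a"] by linarith
      then show "exp (- (l * a)) * (l * a) \<le> 1" by (simp add: exp_minus field_simps)
    qed simp
    finally show ?thesis by simp
  qed
  ultimately have 2: "\<bar>exp (- l * a) - exp (- l * x)\<bar> \<le> x\<^sup>2" by simp
  show ?thesis unfolding a_def[symmetric] using 1 2 by linarith
qed

text \<open>exp is bounded by 1 and 1-Lipschitz on the half-plane Re z <= 0; each fact gives one
  entry of the maximum.\<close>

lemma Re_exp_minus_ge:
  assumes "Re w \<ge> 0" "norm w \<le> B" "l \<ge> 0"
  shows "Re (exp (- of_real l * w)) \<ge> max (- 1) (1 - B * l)"
proof -
  have n: "norm (exp (- of_real l * w)) \<le> 1" using assms by simp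
  have "norm (exp (- of_real l * w) - exp 0) \<le> 1 * norm (- of_real l * w - 0)"
  proof (rule field_differentiable_bound[where S = "{z. Re z \<le> 0}" and f' = exp])
    show "convex {z. Re z \<le> 0}" by (rule convex_halfspace_Re_le)
    show "(exp has_field_derivative exp z) (at z within {z. Re z \<le> 0})" for z :: complex
      by (rule has_field_derivative_at_within[OF DERIV_exp])
  qed (use assms in auto)
  also have "\<dots> = l * norm w" using assms by (simp add: norm_mult)
  also have "\<dots> \<le> B * l" using mult_left_mono[OF assms(2,3)] by (simp add: mult.commute)
  finally have "norm (exp (- of_real l * w) - 1) \<le> B * l" by simp
  then have "\<bar>Re (exp (- of_real l * w) - 1)\<bar> \<le> B * l" using abs_Re_le_cmod order_trans by blast
  moreover have "\<bar>Re (exp (- of_real l * w))\<bar> \<le> 1" using n abs_Re_le_cmod order_trans by blast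
  ultimately show ?thesis by (simp only: max.bounded_iff minus_complex.sel one_complex.sel) linarith
qed

text \<open>
  The weight of a prime power \<open>n\<close> in the right half circle estimate, with \<open>l = q ln n\<close>.  Since \<open>3.1\<close> is less
  than twice \<open>1.558 < 0.992 pi / 2\<close>, the logarithmic derivative outweighs the oscillating term.
\<close>

lemma prime_weight_nonneg:
  fixes c :: "nat \<Rightarrow> real"
  assumes c1: "(\<Sum>i\<le>N. c i) = 1" and \<mu>: "\<mu> > 0"
    and c: "\<forall>y\<in>{0..1}. (\<Sum>i\<le>N. c i * y ^ i) \<ge> \<mu>"
  shows "\<exists>\<epsilon>0>0. \<forall>\<epsilon> r l w. 0 < \<epsilon> \<longrightarrow> \<epsilon> \<le> \<epsilon>0 \<longrightarrow> 0.992 \<le> r \<longrightarrow> l \<ge> 0 \<longrightarrow> Re w \<ge> 0 \<longrightarrow> norm w \<le> 3.1 \<longrightarrow>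
     0 \<le> pi * r / 2 * l * (\<Sum>i\<le>N. c i * (exp (- l * arctan (real i * \<epsilon>)) / (1 + (real i * \<epsilon>)\<^sup>2)))
         + Re (exp (- of_real l * w))"
proof -
  define A where "A = (\<Sum>i\<le>N. \<bar>c i\<bar>)"
  have A: "A \<ge> 0" by (simp add: A_def sum_nonneg)
  define \<delta> where "\<delta> = min (\<mu> / 2) (1 / 2000)"
  have \<delta>: "\<delta> > 0" "\<delta> \<le> \<mu> / 2" "\<delta> \<le> 1 / 2000" using \<mu> by (auto simp: \<delta>_def)
  \<comment> \<open>Two regimes. For l >= l1 the lower bound \<mu> / 2 of the weight outweighs the
    value - 1 of the oscillating term. For l < l1 the product l \<epsilon> is small, so the weight
    is close to sum c_i = 1.\<close>
  define l1 where "l1 = 2 / \<mu>"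
  have l1: "l1 > 0" using \<mu> by (simp add: l1_def)
  define K where "K = 2 * real N ^ 2 * (A + 1) + real N * (A + 1) * l1 + 1"
  have K: "K \<ge> 1" using A l1 by (auto simp: K_def intro!: add_nonneg_nonneg mult_nonneg_nonneg)
  define \<epsilon>0 where "\<epsilon>0 = \<delta> / K"
  have \<epsilon>0: "\<epsilon>0 > 0" using \<delta> K by (simp add: \<epsilon>0_def)
  have main: "0 \<le> pi * r / 2 * l * (\<Sum>i\<le>N. c i * (exp (- l * arctan (real i * \<epsilon>)) / (1 + (real i * \<epsilon>)\<^sup>2)))
         + Re (exp (- of_real l * w))"
    if \<epsilon>: "0 < \<epsilon>" "\<epsilon> \<le> \<epsilon>0" and r: "0.992 \<le> r" and l: "l \<ge> 0" and w: "Re w \<ge> 0" "norm w \<le> 3.1" for \<epsilon> r l w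
  proof -
    have e1: "\<epsilon> \<le> 1"
    proof -
      have "\<delta> / K \<le> \<delta> / 1" using K \<delta> by (intro divide_left_mono) auto
      then show ?thesis using \<epsilon> \<delta> by (simp add: \<epsilon>0_def)
    qed
    have eK: "\<epsilon> * K \<le> \<delta>" using \<epsilon> K by (simp add: \<epsilon>0_def le_divide_eq)
    define W where "W = (\<Sum>i\<le>N. c i * (exp (- l * arctan (real i * \<epsilon>)) / (1 + (real i * \<epsilon>)\<^sup>2)))"
    define W0 where "W0 = (\<Sum>i\<le>N. c i * exp (- (l * \<epsilon>)) ^ i)"
    have d1: "\<bar>W - W0\<bar> \<le> A * (2 * (real N * \<epsilon>)\<^sup>2)"
    proof -
      have "W - W0 = (\<Sum>i\<le>N. c i * (exp (- l * arctan (real i * \<epsilon>)) / (1 + (real i * \<epsilon>)\<^sup>2) - exp (- l * (real i * \<epsilon>))))"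
        unfolding W_def W0_def sum_subtractf[symmetric] right_diff_distrib
        by (intro sum.cong refl) (simp add: exp_of_nat_mult[symmetric] mult_ac)
      also have "\<bar>\<dots>\<bar> \<le> (\<Sum>i\<le>N. \<bar>c i\<bar> * (2 * (real N * \<epsilon>)\<^sup>2))"
      proof (rule order.trans[OF sum_abs], rule sum_mono)
        fix i assume i: "i \<in> {..N}"
        have "\<bar>exp (- l * arctan (real i * \<epsilon>)) / (1 + (real i * \<epsilon>)\<^sup>2) - exp (- l * (real i * \<epsilon>))\<bar> \<le> 2 * (real i * \<epsilon>)\<^sup>2"
          by (rule exp_arctan_diff) (use \<epsilon> l in auto)
        also have "\<dots> \<le> 2 * (real N * \<epsilon>)\<^sup>2"
          using i \<epsilon> by (intro mult_left_mono power_mono mult_right_mono) auto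
        finally show "\<bar>c i * (exp (- l * arctan (real i * \<epsilon>)) / (1 + (real i * \<epsilon>)\<^sup>2) - exp (- l * (real i * \<epsilon>)))\<bar> \<le> \<bar>c i\<bar> * (2 * (real N * \<epsilon>)\<^sup>2)"
          by (simp only: abs_mult) (rule mult_left_mono, auto)
      qed
      finally show ?thesis by (simp add: A_def sum_distrib_right)
    qed
    have d1': "A * (2 * (real N * \<epsilon>)\<^sup>2) \<le> \<epsilon> * (2 * real N ^ 2 * (A + 1))"
    proof -
      have "A * (2 * (real N * \<epsilon>)\<^sup>2) = (2 * real N ^ 2 * A) * (\<epsilon> * \<epsilon>)" by (simp add: power2_eq_square)
      also have "\<dots> \<le> (2 * real N ^ 2 * (A + 1)) * (\<epsilon> * 1)"
        using A e1 \<epsilon> by (intro mult_mono) auto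
      finally show ?thesis by (simp add: mult_ac)
    qed
    have K1: "\<epsilon> * (2 * real N ^ 2 * (A + 1)) \<le> \<epsilon> * K"
      using \<epsilon> A l1 by (intro mult_left_mono) (auto simp: K_def intro!: mult_nonneg_nonneg)
    have W\<mu>: "W \<ge> \<mu> / 2"
    proof -
      have "W0 \<ge> \<mu>" unfolding W0_def by (rule bspec[OF c]) (use l \<epsilon> in auto)
      then show ?thesis using d1 d1' K1 eK \<delta> by linarith
    qed
    have pr: "pi * r / 2 \<ge> 1.558"
    proof -
      have "3.1415 * 0.992 / 2 \<le> pi * r / 2"
        using pi_approx(1) r by (intro divide_right_mono mult_mono) auto
      then show ?thesis by simp
    qed
    have R: "Re (exp (- of_real l * w)) \<ge> max (- 1) (1 - 3.1 * l)"
      by (rule Re_exp_minus_ge[OF w l])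
    show ?thesis
    proof (cases "l \<ge> l1")
      case True
      have "1 \<le> 1.558 * l * (\<mu> / 2)"
        using True \<mu> by (simp add: l1_def field_simps)
      also have "\<dots> \<le> pi * r / 2 * l * W"
        using pr l W\<mu> \<mu> by (intro mult_mono mult_nonneg_nonneg) auto
      finally show ?thesis using R by (simp add: W_def)
    next
      case False
      have d2: "\<bar>W0 - 1\<bar> \<le> A * (real N * (l1 * \<epsilon>))"
      proof -
        have "W0 - 1 = (\<Sum>i\<le>N. c i * (exp (- (l * \<epsilon>)) ^ i - 1))"
          using c1 by (simp add: W0_def right_diff_distrib sum_subtractf)
        also have "\<bar>\<dots>\<bar> \<le> (\<Sum>i\<le>N. \<bar>c i\<bar> * (real N * (l1 * \<epsilon>)))"
        proof (rule order.trans[OF sum_abs], rule sum_mono)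
          fix i assume i: "i \<in> {..N}"
          have "exp (- (l * \<epsilon>)) ^ i = exp (- (real i * (l * \<epsilon>)))" by (simp flip: exp_of_nat_mult)
          moreover have "exp (- (real i * (l * \<epsilon>))) \<ge> 1 - real i * (l * \<epsilon>)"
            using exp_ge_add_one_self[of "- (real i * (l * \<epsilon>))"] by simp
          moreover have "exp (- (real i * (l * \<epsilon>))) \<le> 1" using l \<epsilon> by simp
          moreover have "real i * (l * \<epsilon>) \<le> real N * (l1 * \<epsilon>)"
            using i False l \<epsilon> by (intro mult_mono mult_nonneg_nonneg) auto
          ultimately have "\<bar>exp (- (l * \<epsilon>)) ^ i - 1\<bar> \<le> real N * (l1 * \<epsilon>)" by linarith
          then show "\<bar>c i * (exp (- (l * \<epsilon>)) ^ i - 1)\<bar> \<le> \<bar>c i\<bar> * (real N * (l1 * \<epsilon>))"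
            by (simp only: abs_mult) (rule mult_left_mono, auto)
        qed
        finally show ?thesis by (simp add: A_def sum_distrib_right)
      qed
      have d2': "A * (real N * (l1 * \<epsilon>)) \<le> \<epsilon> * (real N * (A + 1) * l1)"
        using \<epsilon> l1 by (simp add: algebra_simps)
      have "\<epsilon> * (2 * real N ^ 2 * (A + 1)) + \<epsilon> * (real N * (A + 1) * l1) \<le> \<epsilon> * K"
        using \<epsilon> by (simp add: K_def algebra_simps)
      then have "\<bar>W - 1\<bar> \<le> \<delta>" using d1 d1' d2 d2' eK by linarith
      then have W1: "W \<ge> 1 - 1 / 2000" using \<delta> by linarith
      have "1.558 * l * (1 - 1 / 2000) \<le> pi * r / 2 * l * W"
        using pr l W1 by (intro mult_mono mult_nonneg_nonneg) auto
      \<comment> \<open>The line of slope 1.558 (1 - 1/2000) reaches 1 at about l = 0.642, just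
        before l = 2 / 3.1, where 1 - 3.1 l falls to - 1.\<close>
      moreover have "0 \<le> 1.558 * l * (1 - 1 / 2000) + max (- 1) (1 - 3.1 * l)"
        using l by (auto simp: max_def)
      ultimately show ?thesis using R by (simp add: W_def)
    qed
  qed
  show ?thesis using main \<epsilon>0 by (intro exI[of _ \<epsilon>0]) auto
qed

section \<open>The contribution of a single zero\<close>

text \<open>The two fractions combine to (r^2 - |\<rho>|^2) / ((x - \<rho>) (r^2 - cnj \<rho> x)).
  Its numerator is the weight whose sum over the zeros is bounded in \<open>log_deriv_disc\<close>,
  so errors proportional to it can be added up. For \<rho> near 0 only the second fraction is nearly
  constant in x.\<close>

lemma Blaschke_log_deriv_bounds:
  fixes \<rho> :: complex and r x :: real
  assumes r: "1 / 2 \<le> r" "r \<le> 1" and \<rho>: "norm \<rho> < r" and x: "0 \<le> x" "x \<le> 1 / 8"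
  shows "norm (cnj \<rho> / (of_real (r\<^sup>2) - cnj \<rho> * of_real x) - cnj \<rho> / of_real (r\<^sup>2)) \<le> 32 * x * norm \<rho>"
    "0 < \<kappa> \<Longrightarrow> \<kappa> \<le> norm \<rho> \<Longrightarrow> x \<le> \<kappa> / 2 \<Longrightarrow>
     norm ((1 / (of_real x - \<rho>) + cnj \<rho> / (of_real (r\<^sup>2) - cnj \<rho> * of_real x)) - (- 1 / \<rho> + cnj \<rho> / of_real (r\<^sup>2)))
       \<le> 192 / \<kappa>\<^sup>2 * x * (r\<^sup>2 - (norm \<rho>)\<^sup>2)"
proof -
  have r2: "1 / 4 \<le> r\<^sup>2" "r\<^sup>2 \<le> 1"
    using power_mono[of "1/2" r 2] power_mono[of r 1 2] r by (simp_all add: power2_eq_square)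
  define D where "D = of_real (r\<^sup>2) - cnj \<rho> * of_real x"
  have n1: "norm (cnj \<rho> * of_real x) \<le> x"
    using \<rho> r x by (simp add: norm_mult mult_left_le_one_le)
  have "r\<^sup>2 - x \<le> norm D"
    unfolding D_def using norm_triangle_ineq2[of "of_real (r\<^sup>2)" "cnj \<rho> * of_real x"] n1 by (simp add: norm_power)
  then have D: "1 / 8 \<le> norm D" using r2 x by linarith
  then have D0: "D \<noteq> 0" by auto
  have R0: "complex_of_real (r\<^sup>2) \<noteq> 0" using r by simp
  have "cnj \<rho> / D - cnj \<rho> / of_real (r\<^sup>2) = cnj \<rho> * (of_real (r\<^sup>2) - D) / (D * of_real (r\<^sup>2))"
    using D0 R0 by (simp add: diff_frac_eq right_diff_distrib)
  also have "of_real (r\<^sup>2) - D = cnj \<rho> * of_real x" by (simp add: D_def)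
  finally have "norm (cnj \<rho> / D - cnj \<rho> / of_real (r\<^sup>2)) = norm \<rho> * norm (cnj \<rho> * of_real x) / (norm D * r\<^sup>2)"
    by (simp add: norm_mult norm_divide norm_power)
  also have "\<dots> \<le> norm \<rho> * x / (1 / 8 * (1 / 4))"
    using D r2 n1 x by (intro frac_le mult_mono) auto
  finally show "norm (cnj \<rho> / (of_real (r\<^sup>2) - cnj \<rho> * of_real x) - cnj \<rho> / of_real (r\<^sup>2)) \<le> 32 * x * norm \<rho>"
    by (simp add: D_def mult_ac)
  assume k: "0 < \<kappa>" "\<kappa> \<le> norm \<rho>" "x \<le> \<kappa> / 2"
  define E where "E = of_real x - \<rho>"
  have "norm \<rho> - x \<le> norm E"
    unfolding E_def using norm_triangle_ineq2[of \<rho> "of_real x"] x by (simp add: norm_minus_commute)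
  then have E: "\<kappa> / 2 \<le> norm E" using k by linarith
  then have E0: "E \<noteq> 0" using k by auto
  have \<rho>0: "\<rho> \<noteq> 0" using k by auto
  have n2: "complex_of_real ((norm \<rho>)\<^sup>2) = \<rho> * cnj \<rho>" by (rule complex_norm_square)
  define P where "P = complex_of_real (r\<^sup>2 - (norm \<rho>)\<^sup>2)"
  have P: "P = of_real (r\<^sup>2) - \<rho> * cnj \<rho>" by (simp only: P_def of_real_diff n2)
  have a: "1 / E + cnj \<rho> / D = P / (E * D)"
    using E0 D0 unfolding P by (simp add: add_frac_eq) (simp add: E_def D_def algebra_simps)
  have b: "- 1 / \<rho> + cnj \<rho> / of_real (r\<^sup>2) = P / (- \<rho> * of_real (r\<^sup>2))"
    using \<rho>0 R0 unfolding P by (simp add: add_frac_eq) (simp add: field_simps)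
  have frac: "P / a - P / b = P * (b - a) / (a * b)" if "a \<noteq> 0" "b \<noteq> 0" for a b
    using that by (simp add: field_simps)
  have "P / (E * D) - P / (- \<rho> * of_real (r\<^sup>2)) = P * (- \<rho> * of_real (r\<^sup>2) - E * D) / ((E * D) * (- \<rho> * of_real (r\<^sup>2)))"
    by (rule frac) (use E0 D0 \<rho>0 R0 in auto)
  moreover have "norm (- \<rho> * of_real (r\<^sup>2) - E * D) \<le> 3 * x"
  proof -
    have "- \<rho> * of_real (r\<^sup>2) - E * D = of_real x * (- of_real (r\<^sup>2) + cnj \<rho> * of_real x - \<rho> * cnj \<rho>)"
      by (simp add: E_def D_def algebra_simps)
    also have "norm \<dots> \<le> x * (norm (- complex_of_real (r\<^sup>2)) + norm (cnj \<rho> * of_real x) + norm (\<rho> * cnj \<rho>))"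
    proof -
      have tri: "norm (a + b - d) \<le> norm a + norm b + norm d" for a b d :: complex
        using norm_triangle_ineq4[of "a + b" d] norm_triangle_ineq[of a b] by linarith
      have "norm (complex_of_real x * (- of_real (r\<^sup>2) + cnj \<rho> * of_real x - \<rho> * cnj \<rho>)) =
          x * norm (- complex_of_real (r\<^sup>2) + cnj \<rho> * of_real x - \<rho> * cnj \<rho>)"
        using x by (simp only: norm_mult[of "complex_of_real x"] norm_of_real abs_of_nonneg)
      then show ?thesis using mult_left_mono[OF tri x(1)] by (simp only:)
    qed
    also have "\<dots> \<le> x * (1 + 1 + 1)"
    proof (intro mult_left_mono add_mono)
      show "norm (- complex_of_real (r\<^sup>2)) \<le> 1" using r2 by (simp add: norm_power)
      show "norm (cnj \<rho> * of_real x) \<le> 1" using n1 x by linarith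
      show "norm (\<rho> * cnj \<rho>) \<le> 1" using \<rho> r by (simp add: norm_mult mult_le_one)
    qed (use x in auto)
    finally show ?thesis by simp
  qed
  moreover have "norm P = r\<^sup>2 - (norm \<rho>)\<^sup>2" "0 \<le> r\<^sup>2 - (norm \<rho>)\<^sup>2"
  proof -
    show "0 \<le> r\<^sup>2 - (norm \<rho>)\<^sup>2" using \<rho> by (simp add: power_mono)
    then show "norm P = r\<^sup>2 - (norm \<rho>)\<^sup>2" unfolding P_def norm_of_real by simp
  qed
  moreover have "\<kappa> / 2 * (1 / 8) * (\<kappa> * (1 / 4)) \<le> norm ((E * D) * (- \<rho> * of_real (r\<^sup>2)))"
    unfolding norm_mult norm_minus_cancel norm_of_real using E D k r2
    by (intro mult_mono mult_nonneg_nonneg) auto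
  ultimately have "norm (P / (E * D) - P / (- \<rho> * of_real (r\<^sup>2))) \<le> (r\<^sup>2 - (norm \<rho>)\<^sup>2) * (3 * x) / (\<kappa> / 2 * (1 / 8) * (\<kappa> * (1 / 4)))"
    using k x by (simp only: norm_divide norm_mult[of P]) (intro frac_le mult_mono mult_nonneg_nonneg, auto)
  also have "\<dots> = 192 / \<kappa>\<^sup>2 * x * (r\<^sup>2 - (norm \<rho>)\<^sup>2)" using k by (simp add: power2_eq_square field_simps)
  finally show "norm ((1 / (of_real x - \<rho>) + cnj \<rho> / (of_real (r\<^sup>2) - cnj \<rho> * of_real x)) - (- 1 / \<rho> + cnj \<rho> / of_real (r\<^sup>2)))
       \<le> 192 / \<kappa>\<^sup>2 * x * (r\<^sup>2 - (norm \<rho>)\<^sup>2)"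
    unfolding E_def[symmetric] D_def[symmetric] a b .
qed

lemma Re_weighted_sum_diff:
  fixes c :: "nat \<Rightarrow> real" and F :: "nat \<Rightarrow> complex"
  assumes "(\<Sum>i\<le>N. c i) = 1" "\<And>i. i \<le> N \<Longrightarrow> norm (F i - z) \<le> B"
  shows "\<bar>Re (\<Sum>i\<le>N. c i * F i) - Re z\<bar> \<le> (\<Sum>i\<le>N. \<bar>c i\<bar>) * B"
proof -
  have "(\<Sum>i\<le>N. c i * F i) - z = (\<Sum>i\<le>N. c i * (F i - z))"
    using assms(1) by (simp add: right_diff_distrib sum_subtractf sum_distrib_right[symmetric] flip: of_real_sum)
  also have "norm \<dots> \<le> (\<Sum>i\<le>N. \<bar>c i\<bar> * B)"
    by (intro sum_norm_le) (simp add: norm_mult mult_left_mono assms(2))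
  finally have "norm ((\<Sum>i\<le>N. c i * F i) - z) \<le> (\<Sum>i\<le>N. \<bar>c i\<bar>) * B" by (simp add: sum_distrib_right)
  then show ?thesis using abs_Re_le_cmod[of "(\<Sum>i\<le>N. c i * F i) - z"] by simp
qed

text \<open>
  Near the centre the positivity of the kernel beats the boundary term \<open>cnj \<rho> / r\<^sup>2\<close>; far away the sum is
  close to its value at coinciding points, whose real part has the right sign.
\<close>

lemma zero_contribution_ge:
  fixes c :: "nat \<Rightarrow> real"
  assumes c1: "(\<Sum>i\<le>N. c i) = 1" and \<mu>: "\<mu> > 0" and \<nu>: "1 + \<nu> > 0"
    and F: "\<forall>w::complex. Re w \<ge> 1 + \<nu> \<longrightarrow> \<mu> * Re (1 / w) \<le> Re (\<Sum>i\<le>N. c i / (w + of_nat i))"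
    and \<kappa>: "0 < \<kappa>" "\<kappa> \<le> 1 / 4" "4 * \<kappa>\<^sup>2 \<le> \<mu>"
  shows "\<exists>C>0. \<exists>\<epsilon>0>0. \<forall>\<epsilon> r \<rho>. 0 < \<epsilon> \<longrightarrow> \<epsilon> \<le> \<epsilon>0 \<longrightarrow> 1 / 2 \<le> r \<longrightarrow> r \<le> 1 \<longrightarrow> norm \<rho> < r \<longrightarrow> Re \<rho> \<le> 0 \<longrightarrow>
     (norm \<rho> < \<kappa> \<longrightarrow> Re \<rho> \<le> - (1 + \<nu>) * \<epsilon>) \<longrightarrow>
     Re (\<Sum>i\<le>N. c i * (1 / (of_real (real i * \<epsilon>) - \<rho>) + cnj \<rho> / (of_real (r\<^sup>2) - cnj \<rho> * of_real (real i * \<epsilon>))))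
       \<ge> - C * \<epsilon> * (r\<^sup>2 - (norm \<rho>)\<^sup>2)"
proof -
  define A where "A = (\<Sum>i\<le>N. \<bar>c i\<bar>)"
  have A: "A \<ge> 0" by (simp add: A_def sum_nonneg)
  define C where "C = 192 / \<kappa>\<^sup>2 * real N * A + 256 * real N * A + 1"
  have C: "C > 0" unfolding C_def using A by (intro add_nonneg_pos add_nonneg_nonneg mult_nonneg_nonneg) auto
  define \<epsilon>0 where "\<epsilon>0 = \<kappa> / (8 * (real N + 1))"
  have \<epsilon>0: "\<epsilon>0 > 0" using \<kappa> by (simp add: \<epsilon>0_def)
  have main: "Re (\<Sum>i\<le>N. c i * (1 / (of_real (real i * \<epsilon>) - \<rho>) + cnj \<rho> / (of_real (r\<^sup>2) - cnj \<rho> * of_real (real i * \<epsilon>))))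
       \<ge> - C * \<epsilon> * (r\<^sup>2 - (norm \<rho>)\<^sup>2)"
    if \<epsilon>: "0 < \<epsilon>" "\<epsilon> \<le> \<epsilon>0" and r: "1 / 2 \<le> r" "r \<le> 1" and \<rho>: "norm \<rho> < r" "Re \<rho> \<le> 0"
      and near: "norm \<rho> < \<kappa> \<Longrightarrow> Re \<rho> \<le> - (1 + \<nu>) * \<epsilon>" for \<epsilon> r \<rho>
  proof -
    have xi: "0 \<le> real i * \<epsilon>" "real i * \<epsilon> \<le> real N * \<epsilon>" "real i * \<epsilon> \<le> \<kappa> / 2" "real i * \<epsilon> \<le> 1 / 8" if "i \<le> N" for i
    proof -
      show "0 \<le> real i * \<epsilon>" using \<epsilon> by simp
      show 1: "real i * \<epsilon> \<le> real N * \<epsilon>" using that \<epsilon> by (intro mult_right_mono) auto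
      have "real N * \<epsilon> \<le> real N * \<epsilon>0" using \<epsilon> by (intro mult_left_mono) auto
      also have "\<dots> = \<kappa> / 8 * (real N / (real N + 1))" by (simp add: \<epsilon>0_def)
      also have "\<dots> \<le> \<kappa> / 8 * 1" using \<kappa> by (intro mult_left_mono) auto
      finally show "real i * \<epsilon> \<le> \<kappa> / 2" "real i * \<epsilon> \<le> 1 / 8" using 1 \<kappa> by linarith+
    qed
    have pos: "0 \<le> r\<^sup>2 - (norm \<rho>)\<^sup>2" using \<rho> by (simp add: power_mono)
    show ?thesis
    proof (cases "norm \<rho> < \<kappa>")
      case False
      have \<rho>0: "norm \<rho> > 0" using False \<kappa> by linarith
      have "\<bar>Re (\<Sum>i\<le>N. c i * (1 / (of_real (real i * \<epsilon>) - \<rho>) + cnj \<rho> / (of_real (r\<^sup>2) - cnj \<rho> * of_real (real i * \<epsilon>))))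
         - Re (- 1 / \<rho> + cnj \<rho> / of_real (r\<^sup>2))\<bar> \<le> A * (192 / \<kappa>\<^sup>2 * (real N * \<epsilon>) * (r\<^sup>2 - (norm \<rho>)\<^sup>2))"
        unfolding A_def
      proof (rule Re_weighted_sum_diff[OF c1])
        fix i assume i: "i \<le> N"
        have "norm ((1 / (of_real (real i * \<epsilon>) - \<rho>) + cnj \<rho> / (of_real (r\<^sup>2) - cnj \<rho> * of_real (real i * \<epsilon>))) - (- 1 / \<rho> + cnj \<rho> / of_real (r\<^sup>2)))
           \<le> 192 / \<kappa>\<^sup>2 * (real i * \<epsilon>) * (r\<^sup>2 - (norm \<rho>)\<^sup>2)"
          by (rule Blaschke_log_deriv_bounds(2)) (use r \<rho> xi[OF i] False \<kappa> in auto)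
        also have "\<dots> \<le> 192 / \<kappa>\<^sup>2 * (real N * \<epsilon>) * (r\<^sup>2 - (norm \<rho>)\<^sup>2)"
          using i \<epsilon> pos by (intro mult_right_mono mult_left_mono) auto
        finally show "norm ((1 / (of_real (real i * \<epsilon>) - \<rho>) + cnj \<rho> / (of_real (r\<^sup>2) - cnj \<rho> * of_real (real i * \<epsilon>))) - (- 1 / \<rho> + cnj \<rho> / of_real (r\<^sup>2)))
           \<le> 192 / \<kappa>\<^sup>2 * (real N * \<epsilon>) * (r\<^sup>2 - (norm \<rho>)\<^sup>2)" .
      qed
      moreover have "Re (- 1 / \<rho> + cnj \<rho> / of_real (r\<^sup>2)) \<ge> 0"
      proof -
        have "Re (- 1 / \<rho> + cnj \<rho> / of_real (r\<^sup>2)) = (- Re \<rho>) * (1 / (norm \<rho>)\<^sup>2 - 1 / r\<^sup>2)"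
          using \<rho>0 by (simp only: plus_complex.sel Re_divide_of_real complex_cnj) (simp add: Re_divide cmod_power2 algebra_simps)
        also have "\<dots> \<ge> 0"
          using \<rho> \<rho>0 r by (intro mult_nonneg_nonneg) (auto intro!: divide_left_mono power_mono simp: zero_less_mult_iff)
        finally show ?thesis .
      qed
      ultimately have "Re (\<Sum>i\<le>N. c i * (1 / (of_real (real i * \<epsilon>) - \<rho>) + cnj \<rho> / (of_real (r\<^sup>2) - cnj \<rho> * of_real (real i * \<epsilon>))))
         \<ge> - (192 / \<kappa>\<^sup>2 * real N * A * (\<epsilon> * (r\<^sup>2 - (norm \<rho>)\<^sup>2)))" by (simp add: mult_ac)
      moreover have "192 / \<kappa>\<^sup>2 * real N * A * (\<epsilon> * (r\<^sup>2 - (norm \<rho>)\<^sup>2)) \<le> C * (\<epsilon> * (r\<^sup>2 - (norm \<rho>)\<^sup>2))"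
        using A pos \<epsilon> unfolding C_def by (intro mult_right_mono mult_nonneg_nonneg) auto
      ultimately show ?thesis by (simp add: mult_ac)
    next
      case True
      \<comment> \<open>Measuring from the centre in units of \<epsilon> turns the evaluation points
        into 0, ..., N and the sum of the 1 / (i \<epsilon> - \<rho>) into the kernel at w, divided
        by \<epsilon>.\<close>
      define w where "w = - \<rho> / of_real \<epsilon>"
      have Rew: "Re w \<ge> 1 + \<nu>"
      proof -
        have "(1 + \<nu>) * \<epsilon> \<le> - Re \<rho>" using near[OF True] by (simp add: algebra_simps)
        then have "1 + \<nu> \<le> - Re \<rho> / \<epsilon>" using \<epsilon> by (simp only: pos_le_divide_eq)
        then show ?thesis by (simp add: w_def)
      qed
      have Re\<rho>: "Re \<rho> < 0"
      proof -
        have "(1 + \<nu>) * \<epsilon> > 0" using \<nu> \<epsilon> by simp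
        then show ?thesis using near[OF True] by (simp add: algebra_simps)
      qed
      then have \<rho>0: "norm \<rho> > 0" by auto
      have r2: "1 / 4 \<le> r\<^sup>2" using power_mono[of "1/2" r 2] r by (simp add: power2_eq_square)
      have "(\<Sum>i\<le>N. c i * (1 / (of_real (real i * \<epsilon>) - \<rho>))) = (\<Sum>i\<le>N. c i / (w + of_nat i)) / of_real \<epsilon>"
        unfolding sum_divide_distrib
      proof (intro sum.cong refl)
        fix i
        have "of_real \<epsilon> * (w + of_nat i) = of_real (real i * \<epsilon>) - \<rho>" using \<epsilon> by (simp add: w_def algebra_simps)
        then show "c i * (1 / (of_real (real i * \<epsilon>) - \<rho>)) = c i / (w + of_nat i) / of_real \<epsilon>"
          by (simp only: divide_inverse inverse_mult_distrib flip: \<open>of_real \<epsilon> * (w + of_nat i) = of_real (real i * \<epsilon>) - \<rho>\<close>) (simp add: mult_ac)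
      qed
      then have "Re (\<Sum>i\<le>N. c i * (1 / (of_real (real i * \<epsilon>) - \<rho>))) = Re (\<Sum>i\<le>N. c i / (w + of_nat i)) / \<epsilon>"
        by (simp only: Re_divide_of_real)
      also have "\<dots> \<ge> \<mu> * Re (1 / w) / \<epsilon>" using F[rule_format, OF Rew] \<epsilon> by (intro divide_right_mono) auto
      also have "\<mu> * Re (1 / w) / \<epsilon> = \<mu> * (- Re \<rho> / (norm \<rho>)\<^sup>2)"
      proof -
        have "1 / w = of_real \<epsilon> * (- 1 / \<rho>)" by (simp add: w_def)
        then have "Re (1 / w) = \<epsilon> * Re (- 1 / \<rho>)"
          by (simp only: times_complex.sel Re_complex_of_real Im_complex_of_real mult_zero_left diff_zero)
        also have "Re (- 1 / \<rho>) = - Re \<rho> / (norm \<rho>)\<^sup>2" by (simp add: Re_divide cmod_power2)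
        finally show ?thesis using \<epsilon> by simp
      qed
      finally have first: "Re (\<Sum>i\<le>N. c i * (1 / (of_real (real i * \<epsilon>) - \<rho>))) \<ge> \<mu> * (- Re \<rho> / (norm \<rho>)\<^sup>2)" .
      have "\<bar>Re (\<Sum>i\<le>N. c i * (cnj \<rho> / (of_real (r\<^sup>2) - cnj \<rho> * of_real (real i * \<epsilon>))))
         - Re (cnj \<rho> / of_real (r\<^sup>2))\<bar> \<le> A * (32 * (real N * \<epsilon>))"
        unfolding A_def
      proof (rule Re_weighted_sum_diff[OF c1])
        fix i assume i: "i \<le> N"
        have "norm (cnj \<rho> / (of_real (r\<^sup>2) - cnj \<rho> * of_real (real i * \<epsilon>)) - cnj \<rho> / of_real (r\<^sup>2)) \<le> 32 * (real i * \<epsilon>) * norm \<rho>"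
          by (rule Blaschke_log_deriv_bounds(1)) (use r \<rho> xi[OF i] in auto)
        also have "\<dots> \<le> 32 * (real N * \<epsilon>) * 1" using xi[OF i] i \<epsilon> \<rho> r by (intro mult_mono) auto
        finally show "norm (cnj \<rho> / (of_real (r\<^sup>2) - cnj \<rho> * of_real (real i * \<epsilon>)) - cnj \<rho> / of_real (r\<^sup>2)) \<le> 32 * (real N * \<epsilon>)" by simp
      qed
      moreover have "Re (cnj \<rho> / of_real (r\<^sup>2)) = Re \<rho> / r\<^sup>2" by (simp only: Re_divide_of_real complex_cnj) simp
      ultimately have second: "Re (\<Sum>i\<le>N. c i * (cnj \<rho> / (of_real (r\<^sup>2) - cnj \<rho> * of_real (real i * \<epsilon>)))) \<ge> Re \<rho> / r\<^sup>2 - A * (32 * (real N * \<epsilon>))"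
        by linarith
      \<comment> \<open>The size of \<open>\<kappa>\<close> is used here: the boundary term is at
        most 4 |Re \<rho>|, and 4 <= \<mu> / \<kappa>^2 <= \<mu> / |\<rho>|^2.\<close>
      have "- Re \<rho> / r\<^sup>2 \<le> \<mu> * (- Re \<rho> / (norm \<rho>)\<^sup>2)"
      proof -
        have "1 / r\<^sup>2 \<le> 4" using r2 r by (simp add: divide_le_eq)
        also have "4 \<le> \<mu> / \<kappa>\<^sup>2" using \<kappa> by (simp add: le_divide_eq)
        also have "\<mu> / \<kappa>\<^sup>2 \<le> \<mu> / (norm \<rho>)\<^sup>2" using True \<rho>0 \<mu> \<kappa>(1) by (intro divide_left_mono power_mono mult_pos_pos) auto
        finally have "(- Re \<rho>) * (1 / r\<^sup>2) \<le> (- Re \<rho>) * (\<mu> / (norm \<rho>)\<^sup>2)" using Re\<rho> by (intro mult_left_mono) auto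
        then show ?thesis by (simp add: mult_ac)
      qed
      moreover have "Re (\<Sum>i\<le>N. c i * (1 / (of_real (real i * \<epsilon>) - \<rho>) + cnj \<rho> / (of_real (r\<^sup>2) - cnj \<rho> * of_real (real i * \<epsilon>))))
         = Re (\<Sum>i\<le>N. c i * (1 / (of_real (real i * \<epsilon>) - \<rho>))) + Re (\<Sum>i\<le>N. c i * (cnj \<rho> / (of_real (r\<^sup>2) - cnj \<rho> * of_real (real i * \<epsilon>))))"
        unfolding plus_complex.sel(1)[symmetric] sum.distrib[symmetric] distrib_left[symmetric] ..
      ultimately have ge: "Re (\<Sum>i\<le>N. c i * (1 / (of_real (real i * \<epsilon>) - \<rho>) + cnj \<rho> / (of_real (r\<^sup>2) - cnj \<rho> * of_real (real i * \<epsilon>))))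
         \<ge> - (A * (32 * (real N * \<epsilon>)))" using first second by linarith
      \<comment> \<open>The remaining error is of order \<epsilon> without the weight r^2 -
        |\<rho>|^2. Near the centre the weight is at least 1/8, so it can be inserted; hence 256 = 8
        * 32 in \<open>C\<close>.\<close>
      have "1 / 8 \<le> r\<^sup>2 - (norm \<rho>)\<^sup>2"
      proof -
        have "(norm \<rho>)\<^sup>2 \<le> (1 / 4)\<^sup>2" using True \<kappa> by (intro power_mono) auto
        then show ?thesis using r2 by (simp add: power2_eq_square)
      qed
      then have "256 * real N * A * \<epsilon> * (1 / 8) \<le> C * \<epsilon> * (r\<^sup>2 - (norm \<rho>)\<^sup>2)"
        using A \<epsilon> \<kappa> unfolding C_def by (intro mult_mono mult_right_mono mult_nonneg_nonneg) auto
      then have "- C * \<epsilon> * (r\<^sup>2 - (norm \<rho>)\<^sup>2) \<le> - (A * (32 * (real N * \<epsilon>)))"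
        by (simp add: mult_ac)
      then show ?thesis using ge by (rule order.trans)
    qed
  qed
  show ?thesis
    by (rule exI[of _ C], rule conjI[OF C], rule exI[of _ \<epsilon>0], rule conjI[OF \<epsilon>0], intro allI impI, rule main) auto
qed

section \<open>Primes, the pole and the zeros\<close>

lemma has_field_derivative_prod_power:
  fixes F :: "'b \<Rightarrow> complex \<Rightarrow> complex"
  assumes "finite J" "\<And>j. j \<in> J \<Longrightarrow> (F j has_field_derivative F' j) (at x)" "\<And>j. j \<in> J \<Longrightarrow> F j x \<noteq> 0"
  shows "((\<lambda>z. \<Prod>j\<in>J. F j z ^ \<beta> j) has_field_derivative (\<Prod>j\<in>J. F j x ^ \<beta> j) * (\<Sum>j\<in>J. of_nat (\<beta> j) * (F' j / F j x))) (at x)"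
  using assms
proof (induction J rule: finite_induct)
  case (insert y J)
  define P where "P = (\<Prod>j\<in>J. F j x ^ \<beta> j)"
  define S where "S = (\<Sum>j\<in>J. of_nat (\<beta> j) * (F' j / F j x))"
  have nz: "F y x \<noteq> 0" using insert.prems by simp
  have "((\<lambda>z. F y z ^ \<beta> y) has_field_derivative of_nat (\<beta> y) * (F y x ^ (\<beta> y - Suc 0) * F' y)) (at x)"
    using DERIV_power[OF insert.prems(1)[of y], of "\<beta> y"] by (simp add: mult_ac)
  also have "of_nat (\<beta> y) * (F y x ^ (\<beta> y - Suc 0) * F' y) = F y x ^ \<beta> y * (of_nat (\<beta> y) * (F' y / F y x))"
    using nz by (cases "\<beta> y") auto
  finally have "((\<lambda>z. F y z ^ \<beta> y * (\<Prod>j\<in>J. F j z ^ \<beta> j)) has_field_derivative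
      F y x ^ \<beta> y * (of_nat (\<beta> y) * (F' y / F y x)) * P + P * S * F y x ^ \<beta> y) (at x)"
    unfolding P_def S_def by (rule DERIV_mult) (use insert in auto)
  moreover have "F y x ^ \<beta> y * (of_nat (\<beta> y) * (F' y / F y x)) * P + P * S * F y x ^ \<beta> y =
       (F y x ^ \<beta> y * P) * (of_nat (\<beta> y) * (F' y / F y x) + S)"
    by (simp only: distrib_left mult_ac)
  ultimately show ?case using insert.hyps by (simp add: P_def S_def)
qed auto

text \<open>q / (1 + x^2) is the derivative of q arctan at x = i \<epsilon>, and - zeta' / zeta at
  \<sigma> is 1 / (\<sigma> - 1) up to a bounded error. As \<sigma> - 1 = q (\<epsilon> + arctan x),
  the factor q drops out, and each term differs from 1 / (\<epsilon> (i + 1)) by a bounded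
  amount.\<close>

lemma pole_contribution:
  fixes c :: "nat \<Rightarrow> real"
  shows "\<exists>C>0. \<exists>\<epsilon>0>0. \<forall>q \<epsilon>. 0 < q \<longrightarrow> q \<le> 1 / 8 \<longrightarrow> 0 < \<epsilon> \<longrightarrow> \<epsilon> \<le> \<epsilon>0 \<longrightarrow>
     (\<Sum>i\<le>N. c i * (q / (1 + (real i * \<epsilon>)\<^sup>2)) *
        Re (- deriv zeta (of_real (1 + q * \<epsilon> + q * arctan (real i * \<epsilon>))) / zeta (of_real (1 + q * \<epsilon> + q * arctan (real i * \<epsilon>)))))
     \<le> (1 / \<epsilon>) * (\<Sum>i\<le>N. c i / real (i + 1)) + C"
proof -
  obtain C d where C: "C > 0" and d: "d > 0"
    and near0: "\<forall>\<sigma>. 1 < \<sigma> \<and> \<sigma> < 1 + d \<longrightarrow>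
     norm (deriv zeta (of_real \<sigma>) / zeta (of_real \<sigma>) + 1 / of_real (\<sigma> - 1)) \<le> C \<and>
     norm (zeta (of_real \<sigma>)) \<le> C / (\<sigma> - 1)"
    using zeta_near_1 by (elim exE conjE) (rule that)
  have near: "norm (deriv zeta (of_real \<sigma>) / zeta (of_real \<sigma>) + 1 / of_real (\<sigma> - 1)) \<le> C"
    if "1 < \<sigma>" "\<sigma> < 1 + d" for \<sigma> using near0 that by blast
  define A where "A = (\<Sum>i\<le>N. \<bar>c i\<bar>)"
  have A: "A \<ge> 0" by (simp add: A_def sum_nonneg)
  define K where "K = C + 3 * (real N + 1) ^ 3"
  have K: "K > 0" using C by (simp add: K_def add_pos_nonneg)
  define \<epsilon>0 where "\<epsilon>0 = min 1 (d / (real N + 1))"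
  have \<epsilon>0: "\<epsilon>0 > 0" using d by (simp add: \<epsilon>0_def)
  have main: "(\<Sum>i\<le>N. c i * (q / (1 + (real i * \<epsilon>)\<^sup>2)) *
        Re (- deriv zeta (of_real (1 + q * \<epsilon> + q * arctan (real i * \<epsilon>))) / zeta (of_real (1 + q * \<epsilon> + q * arctan (real i * \<epsilon>)))))
     \<le> (1 / \<epsilon>) * (\<Sum>i\<le>N. c i / real (i + 1)) + (A * K + 1)"
    if q: "0 < q" "q \<le> 1 / 8" and \<epsilon>: "0 < \<epsilon>" "\<epsilon> \<le> \<epsilon>0" for q \<epsilon>
  proof -
    define D where "D i = q / (1 + (real i * \<epsilon>)\<^sup>2) *
        Re (- deriv zeta (of_real (1 + q * \<epsilon> + q * arctan (real i * \<epsilon>))) / zeta (of_real (1 + q * \<epsilon> + q * arctan (real i * \<epsilon>))))" for i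
    have close: "\<bar>D i - 1 / (\<epsilon> * real (i + 1))\<bar> \<le> K" if i: "i \<le> N" for i
    proof -
      define x where "x = real i * \<epsilon>"
      define a where "a = arctan x"
      have x: "0 \<le> x" "x \<le> real N * \<epsilon>" using i \<epsilon> by (auto simp: x_def intro: mult_right_mono)
      have a: "0 \<le> a" "a \<le> x" "0 \<le> x - a" "x - a \<le> x ^ 3"
        using arctan_bounds_nonneg[OF x(1)] x by (auto simp: a_def)
      define \<sigma> where "\<sigma> = 1 + q * \<epsilon> + q * a"
      have \<sigma>1: "1 < \<sigma>" using q \<epsilon> a by (simp add: \<sigma>_def add_pos_nonneg)
      have \<sigma>d: "\<sigma> < 1 + d"
      proof -
        have "\<epsilon> + a \<le> (real N + 1) * \<epsilon>" using a x by (simp add: algebra_simps)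
        also have "\<dots> \<le> d" using \<epsilon> by (simp add: \<epsilon>0_def le_divide_eq mult.commute)
        finally have "q * (\<epsilon> + a) \<le> 1 / 8 * d" using q \<epsilon> a by (intro mult_mono) auto
        then show ?thesis using d by (simp add: \<sigma>_def algebra_simps)
      qed
      define Q where "Q = deriv zeta (of_real \<sigma>) / zeta (of_real \<sigma>)"
      have "norm (Q + 1 / of_real (\<sigma> - 1)) \<le> C" unfolding Q_def by (rule near[OF \<sigma>1 \<sigma>d])
      moreover have "1 / complex_of_real (\<sigma> - 1) = of_real (1 / (\<sigma> - 1))"
        by (simp only: of_real_divide of_real_1)
      ultimately have "\<bar>Re (Q + of_real (1 / (\<sigma> - 1)))\<bar> \<le> C"
        using abs_Re_le_cmod[of "Q + of_real (1 / (\<sigma> - 1))"] by (simp only:)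
      then have Re: "\<bar>Re (- Q) - 1 / (\<sigma> - 1)\<bar> \<le> C"
        unfolding plus_complex.sel uminus_complex.sel Re_complex_of_real by linarith
      define h where "h = q / (1 + x\<^sup>2)"
      have h: "0 \<le> h" "h \<le> 1"
      proof -
        show "0 \<le> h" using q by (simp add: h_def)
        have "h \<le> q / 1" unfolding h_def using q by (intro divide_left_mono) (auto simp: add_pos_nonneg)
        then show "h \<le> 1" using q by simp
      qed
      have "D i = h * Re (- Q)" by (simp add: D_def h_def x_def Q_def \<sigma>_def a_def)
      then have "D i - h * (1 / (\<sigma> - 1)) = h * (Re (- Q) - 1 / (\<sigma> - 1))" by (simp only: right_diff_distrib)
      then have 1: "\<bar>D i - h * (1 / (\<sigma> - 1))\<bar> \<le> 1 * C"
        using h Re C by (simp only: abs_mult) (intro mult_mono, auto)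
      have "h * (1 / (\<sigma> - 1)) = 1 / ((1 + x\<^sup>2) * (\<epsilon> + a))"
      proof -
        have "\<sigma> - 1 = q * (\<epsilon> + a)" by (simp add: \<sigma>_def algebra_simps)
        then show ?thesis using q by (simp add: h_def)
      qed
      moreover have "\<bar>1 / ((1 + x\<^sup>2) * (\<epsilon> + a)) - 1 / (\<epsilon> + x)\<bar> \<le> 3 * (real N + 1) ^ 3"
      proof -
        define D1 where "D1 = (1 + x\<^sup>2) * (\<epsilon> + a)"
        define D2 where "D2 = \<epsilon> + x"
        have "1 * \<epsilon> \<le> D1" unfolding D1_def using \<epsilon> a by (intro mult_mono) auto
        then have D: "\<epsilon> \<le> D1" "\<epsilon> \<le> D2" using x by (auto simp: D2_def)
        \<comment> \<open>The first order terms cancel. The difference has third order in \<epsilon>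
          and the product of the denominators second order, so the error is even
          O(\<epsilon>).\<close>
        have "D2 - D1 = (x - a) - x\<^sup>2 * \<epsilon> - x\<^sup>2 * a" by (simp add: D1_def D2_def algebra_simps)
        moreover have "0 \<le> x\<^sup>2 * \<epsilon>" "0 \<le> x\<^sup>2 * a" using \<epsilon> a by auto
        moreover have "x\<^sup>2 * a \<le> x ^ 3"
          using a mult_left_mono[of a x "x\<^sup>2"] by (simp add: power2_eq_square power3_eq_cube)
        ultimately have "\<bar>D2 - D1\<bar> \<le> 2 * x ^ 3 + x\<^sup>2 * \<epsilon>" using a by linarith
        also have "\<dots> \<le> 2 * ((real N + 1) * \<epsilon>) ^ 3 + ((real N + 1) * \<epsilon>)\<^sup>2 * ((real N + 1) * \<epsilon>)"
        proof -
          have "x \<le> (real N + 1) * \<epsilon>" "\<epsilon> \<le> (real N + 1) * \<epsilon>" using x \<epsilon> by (simp_all add: algebra_simps)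
          then show ?thesis using x \<epsilon> by (intro add_mono mult_left_mono mult_mono power_mono) auto
        qed
        also have "\<dots> = 3 * (real N + 1) ^ 3 * \<epsilon> ^ 3" by (simp add: power2_eq_square power3_eq_cube)
        finally have n: "\<bar>D2 - D1\<bar> \<le> 3 * (real N + 1) ^ 3 * \<epsilon> ^ 3" .
        have "1 / D1 - 1 / D2 = (D2 - D1) / (D1 * D2)" using D \<epsilon> by (simp add: field_simps)
        then have "\<bar>1 / D1 - 1 / D2\<bar> = \<bar>D2 - D1\<bar> / (D1 * D2)" using D \<epsilon> by (simp add: abs_divide)
        also have "\<dots> \<le> (3 * (real N + 1) ^ 3 * \<epsilon> ^ 3) / (\<epsilon> * \<epsilon>)"
          using n D \<epsilon> by (intro frac_le mult_mono) auto
        also have "\<dots> = 3 * (real N + 1) ^ 3 * \<epsilon>" using \<epsilon> by (simp add: power3_eq_cube)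
        also have "\<dots> \<le> 3 * (real N + 1) ^ 3 * 1" using \<epsilon> by (intro mult_left_mono) (auto simp: \<epsilon>0_def)
        finally show ?thesis by (simp add: D1_def D2_def)
      qed
      moreover have "\<epsilon> + x = \<epsilon> * real (i + 1)" by (simp add: x_def algebra_simps)
      ultimately show ?thesis using 1 unfolding K_def by simp
    qed
    have "(\<Sum>i\<le>N. c i * D i) - (1 / \<epsilon>) * (\<Sum>i\<le>N. c i / real (i + 1)) = (\<Sum>i\<le>N. c i * (D i - 1 / (\<epsilon> * real (i + 1))))"
      by (simp add: sum_distrib_left right_diff_distrib sum_subtractf)
    also have "\<dots> \<le> (\<Sum>i\<le>N. \<bar>c i\<bar> * K)"
    proof (rule sum_mono)
      fix i assume "i \<in> {..N}"
      have "c i * (D i - 1 / (\<epsilon> * real (i + 1))) \<le> \<bar>c i * (D i - 1 / (\<epsilon> * real (i + 1)))\<bar>" by (rule abs_ge_self)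
      also have "\<dots> \<le> \<bar>c i\<bar> * K" unfolding abs_mult using close \<open>i \<in> {..N}\<close> by (intro mult_left_mono) auto
      finally show "c i * (D i - 1 / (\<epsilon> * real (i + 1))) \<le> \<bar>c i\<bar> * K" .
    qed
    also have "\<dots> = A * K" by (simp add: A_def sum_distrib_right)
    finally show ?thesis by (simp add: D_def mult.assoc)
  qed
  have pos: "A * K + 1 > 0" using A K by (simp add: add_nonneg_pos)
  show ?thesis
    by (rule exI[of _ "A * K + 1"], rule conjI[OF pos], rule exI[of _ \<epsilon>0], rule conjI[OF \<epsilon>0],
        intro allI impI, rule main)
qed

lemma Re_of_real_mult: "Re (of_real x * w) = x * Re w"
  by simp

text \<open>The difference of the two sides is a series over n whose terms are a nonnegative
  coefficient, times the trigonometric sum at - t ln n, times the quantity of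
  \<open>prime_weight_nonneg\<close> with l = q ln n. A bound by logarithmic derivatives rather than
  by a number is what permits the cancellation in \<open>detector_inequality\<close>.\<close>

lemma log_zeta_combination_ge:
  fixes c :: "nat \<Rightarrow> real" and b :: "int \<Rightarrow> real"
  assumes c1: "(\<Sum>i\<le>N. c i) = 1" and \<mu>: "\<mu> > 0"
    and c: "\<forall>y\<in>{0..1}. (\<Sum>i\<le>N. c i * y ^ i) \<ge> \<mu>"
    and J: "finite J"
    and trig: "\<And>v. \<exists>p\<ge>0. (\<Sum>j\<in>J. of_real (b j) * cis (of_int j * v)) = complex_of_real p"
  shows "\<exists>\<epsilon>0>0. \<forall>q \<epsilon> r t a. 0 < q \<longrightarrow> 0 < \<epsilon> \<longrightarrow> \<epsilon> \<le> \<epsilon>0 \<longrightarrow> 0.992 \<le> r \<longrightarrow> Re a \<ge> 0 \<longrightarrow> norm a \<le> 3.1 \<longrightarrow>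
     (\<Sum>j\<in>J. b j * ln (norm (zeta (Complex (1 + q * \<epsilon>) (of_int j * t) + of_real q * a)))) \<ge>
     - (pi * r / 2) * (\<Sum>i\<le>N. c i * (q / (1 + (real i * \<epsilon>)\<^sup>2)) *
         (\<Sum>j\<in>J. b j * Re (- deriv zeta (Complex (1 + q * \<epsilon>) (of_int j * t) + of_real (q * arctan (real i * \<epsilon>))) /
                             zeta (Complex (1 + q * \<epsilon>) (of_int j * t) + of_real (q * arctan (real i * \<epsilon>))))))"
proof -
  obtain \<epsilon>0 where \<epsilon>0: "\<epsilon>0 > 0" and weight: "\<forall>\<epsilon> r l w. 0 < \<epsilon> \<longrightarrow> \<epsilon> \<le> \<epsilon>0 \<longrightarrow> 0.992 \<le> r \<longrightarrow> l \<ge> 0 \<longrightarrow> Re w \<ge> 0 \<longrightarrow> norm w \<le> 3.1 \<longrightarrow>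
     0 \<le> pi * r / 2 * l * (\<Sum>i\<le>N. c i * (exp (- l * arctan (real i * \<epsilon>)) / (1 + (real i * \<epsilon>)\<^sup>2)))
         + Re (exp (- of_real l * w))"
    using prime_weight_nonneg[OF c1 \<mu> c] by (elim exE conjE) (rule that)
  obtain k where k0: "\<forall>n. k n \<ge> (0::real)" and k1: "\<forall>n\<le>1. k n = 0"
    and ks: "\<forall>s :: complex. Re s > 1 \<longrightarrow> zeta s \<noteq> 0 \<and>
      (\<lambda>n. k n * Re (exp (- s * of_real (ln (real n))))) sums ln (norm (zeta s)) \<and>
      (\<lambda>n. of_real (k n * ln (real n)) * exp (- s * of_real (ln (real n)))) sums (- deriv zeta s / zeta s)"
    using zeta_log_series by (elim exE conjE) (rule that)
  have kln: "(\<lambda>n. k n * Re (exp (- s * of_real (ln (real n))))) sums ln (norm (zeta s))"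
    and kd: "(\<lambda>n. of_real (k n * ln (real n)) * exp (- s * of_real (ln (real n)))) sums (- deriv zeta s / zeta s)"
    if "Re s > 1" for s :: complex
    using ks[rule_format, OF that] by blast+
  have main: "(\<Sum>j\<in>J. b j * ln (norm (zeta (Complex (1 + q * \<epsilon>) (of_int j * t) + of_real q * a)))) \<ge>
     - (pi * r / 2) * (\<Sum>i\<le>N. c i * (q / (1 + (real i * \<epsilon>)\<^sup>2)) *
         (\<Sum>j\<in>J. b j * Re (- deriv zeta (Complex (1 + q * \<epsilon>) (of_int j * t) + of_real (q * arctan (real i * \<epsilon>))) /
                             zeta (Complex (1 + q * \<epsilon>) (of_int j * t) + of_real (q * arctan (real i * \<epsilon>))))))"
    if q: "0 < q" and \<epsilon>: "0 < \<epsilon>" "\<epsilon> \<le> \<epsilon>0" and r: "0.992 \<le> r" and a: "Re a \<ge> 0" "norm a \<le> 3.1" for q \<epsilon> r t a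
  proof -
    define L where "L n = ln (real n)" for n :: nat
    define E where "E n = exp (- (1 + q * \<epsilon>) * L n)" for n
    define P where "P n = Re (\<Sum>j\<in>J. of_real (b j) * cis (of_int j * (- t * L n)))" for n
    have P0: "(\<Sum>j\<in>J. of_real (b j) * cis (of_int j * (- t * L n))) = of_real (P n) \<and> P n \<ge> 0" for n
    proof -
      obtain p where p: "p \<ge> 0" and eq: "(\<Sum>j\<in>J. of_real (b j) * cis (of_int j * (- t * L n))) = complex_of_real p"
        using trig[of "- t * L n"] by (elim exE conjE) (rule that)
      show ?thesis unfolding P_def eq using p by simp
    qed
    have P: "(\<Sum>j\<in>J. of_real (b j) * cis (of_int j * (- t * L n))) = of_real (P n)" "P n \<ge> 0" for n
      using P0[of n] by auto
    \<comment> \<open>The dependence on j separates from that on z: as all strips are evaluated at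
      the same z, its exponential is a common factor and the sum over j acts on the phases
      alone.\<close>
    have expand: "(\<Sum>j\<in>J. b j * Re (exp (- (Complex (1 + q * \<epsilon>) (of_int j * t) + of_real q * z) * of_real (L n)))) =
        E n * P n * Re (exp (- of_real (q * L n) * z))" for z n
    proof -
      have "exp (- (Complex (1 + q * \<epsilon>) (of_int j * t) + of_real q * z) * of_real (L n)) =
          of_real (E n) * exp (- of_real (q * L n) * z) * cis (of_int j * (- t * L n))" for j
      proof -
        have "- (Complex (1 + q * \<epsilon>) (of_int j * t) + of_real q * z) * of_real (L n) =
          of_real (- (1 + q * \<epsilon>) * L n) + (- of_real (q * L n) * z) + \<i> * of_real (of_int j * (- t * L n))"
          by (simp add: complex_eq_iff algebra_simps)
        then show ?thesis unfolding E_def by (simp only: exp_add exp_of_real cis_conv_exp)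
      qed
      then have "(\<Sum>j\<in>J. b j * Re (exp (- (Complex (1 + q * \<epsilon>) (of_int j * t) + of_real q * z) * of_real (L n)))) =
         Re (\<Sum>j\<in>J. of_real (b j) * (of_real (E n) * exp (- of_real (q * L n) * z) * cis (of_int j * (- t * L n))))"
        by (simp only: Re_sum Re_of_real_mult)
      also have "(\<Sum>j\<in>J. of_real (b j) * (of_real (E n) * exp (- of_real (q * L n) * z) * cis (of_int j * (- t * L n)))) =
         of_real (E n) * exp (- of_real (q * L n) * z) * (\<Sum>j\<in>J. of_real (b j) * cis (of_int j * (- t * L n)))"
        unfolding sum_distrib_left by (intro sum.cong refl) (simp only: mult_ac)
      also have "\<dots> = of_real (E n * P n) * exp (- of_real (q * L n) * z)" unfolding P(1) by simp
      also have "Re \<dots> = E n * P n * Re (exp (- of_real (q * L n) * z))"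
        by (rule Re_of_real_mult)
      finally show ?thesis .
    qed
    have Re1: "Re (Complex (1 + q * \<epsilon>) y + of_real q * z) > 1" if "Re z \<ge> 0" for y z
      using q \<epsilon> that by (simp add: add_pos_nonneg)
    have s1: "(\<lambda>n. k n * (E n * P n * Re (exp (- of_real (q * L n) * a)))) sums
       (\<Sum>j\<in>J. b j * ln (norm (zeta (Complex (1 + q * \<epsilon>) (of_int j * t) + of_real q * a))))"
    proof -
      have "(\<lambda>n. \<Sum>j\<in>J. b j * (k n * Re (exp (- (Complex (1 + q * \<epsilon>) (of_int j * t) + of_real q * a) * of_real (L n))))) sums
       (\<Sum>j\<in>J. b j * ln (norm (zeta (Complex (1 + q * \<epsilon>) (of_int j * t) + of_real q * a))))"
        unfolding L_def by (intro sums_sum sums_mult kln Re1 a)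
      moreover have "(\<Sum>j\<in>J. b j * (k n * Re (exp (- (Complex (1 + q * \<epsilon>) (of_int j * t) + of_real q * a) * of_real (L n))))) =
         k n * (E n * P n * Re (exp (- of_real (q * L n) * a)))" for n
        unfolding expand[symmetric] sum_distrib_left by (intro sum.cong refl) (simp only: mult_ac)
      ultimately show ?thesis by (simp only:)
    qed
    have s2: "(\<lambda>n. k n * L n * (E n * P n * exp (- (q * L n) * arctan (real i * \<epsilon>)))) sums
       (\<Sum>j\<in>J. b j * Re (- deriv zeta (Complex (1 + q * \<epsilon>) (of_int j * t) + of_real (q * arctan (real i * \<epsilon>))) /
                             zeta (Complex (1 + q * \<epsilon>) (of_int j * t) + of_real (q * arctan (real i * \<epsilon>)))))" for i
    proof -
      define z where "z = complex_of_real (arctan (real i * \<epsilon>))"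
      have z0: "Re z \<ge> 0" using \<epsilon> by (simp add: z_def)
      have "(\<lambda>n. \<Sum>j\<in>J. b j * Re (of_real (k n * L n) * exp (- (Complex (1 + q * \<epsilon>) (of_int j * t) + of_real q * z) * of_real (L n)))) sums
       (\<Sum>j\<in>J. b j * Re (- deriv zeta (Complex (1 + q * \<epsilon>) (of_int j * t) + of_real q * z) / zeta (Complex (1 + q * \<epsilon>) (of_int j * t) + of_real q * z)))"
        unfolding L_def by (intro sums_sum sums_mult sums_Re kd Re1 z0)
      moreover have "(\<Sum>j\<in>J. b j * Re (of_real (k n * L n) * exp (- (Complex (1 + q * \<epsilon>) (of_int j * t) + of_real q * z) * of_real (L n)))) =
         k n * L n * (E n * P n * exp (- (q * L n) * arctan (real i * \<epsilon>)))" for n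
      proof -
        have "Re (of_real (k n * L n) * exp (- (Complex (1 + q * \<epsilon>) (of_int j * t) + of_real q * z) * of_real (L n))) =
            (k n * L n) * Re (exp (- (Complex (1 + q * \<epsilon>) (of_int j * t) + of_real q * z) * of_real (L n)))" for j
          by (rule Re_of_real_mult)
        moreover have "exp (- of_real (q * L n) * z) = of_real (exp (- (q * L n) * arctan (real i * \<epsilon>)))"
          unfolding z_def by (simp flip: exp_of_real)
        then have "Re (exp (- of_real (q * L n) * z)) = exp (- (q * L n) * arctan (real i * \<epsilon>))"
          by (simp only: Re_complex_of_real)
        ultimately show ?thesis
          unfolding \<open>Re (exp (- of_real (q * L n) * z)) = _\<close>[symmetric] expand[symmetric] sum_distrib_left
          by (intro sum.cong refl) (simp only: mult_ac)
      qed
      ultimately show ?thesis by (simp only: z_def of_real_mult)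
    qed
    define W where "W l = (\<Sum>i\<le>N. c i * (exp (- l * arctan (real i * \<epsilon>)) / (1 + (real i * \<epsilon>)\<^sup>2)))" for l
    have "(\<lambda>n. \<Sum>i\<le>N. c i * (q / (1 + (real i * \<epsilon>)\<^sup>2)) * (k n * L n * (E n * P n * exp (- (q * L n) * arctan (real i * \<epsilon>))))) sums
      (\<Sum>i\<le>N. c i * (q / (1 + (real i * \<epsilon>)\<^sup>2)) *
         (\<Sum>j\<in>J. b j * Re (- deriv zeta (Complex (1 + q * \<epsilon>) (of_int j * t) + of_real (q * arctan (real i * \<epsilon>))) /
                             zeta (Complex (1 + q * \<epsilon>) (of_int j * t) + of_real (q * arctan (real i * \<epsilon>))))))" (is "_ sums ?T")
      by (intro sums_sum sums_mult s2)
    moreover have "(\<Sum>i\<le>N. c i * (q / (1 + (real i * \<epsilon>)\<^sup>2)) * (k n * L n * (E n * P n * exp (- (q * L n) * arctan (real i * \<epsilon>))))) =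
       k n * (E n * P n) * ((q * L n) * W (q * L n))" for n
      unfolding W_def sum_distrib_left by (intro sum.cong refl) (simp add: mult_ac)
    ultimately have s3: "(\<lambda>n. k n * (E n * P n) * ((q * L n) * W (q * L n))) sums ?T" by (simp only:)
    have "0 \<le> (pi * r / 2) * ?T + (\<Sum>j\<in>J. b j * ln (norm (zeta (Complex (1 + q * \<epsilon>) (of_int j * t) + of_real q * a))))"
    proof (rule sums_le[OF _ sums_zero sums_add[OF sums_mult[OF s3] s1]])
      fix n
      have e: "pi * r / 2 * (k n * (E n * P n) * ((q * L n) * W (q * L n))) + k n * (E n * P n * Re (exp (- of_real (q * L n) * a)))
         = k n * (E n * P n) * (pi * r / 2 * (q * L n) * W (q * L n) + Re (exp (- of_real (q * L n) * a)))"
        by (simp only: distrib_left mult_ac)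
      show "0 \<le> pi * r / 2 * (k n * (E n * P n) * ((q * L n) * W (q * L n))) + k n * (E n * P n * Re (exp (- of_real (q * L n) * a)))"
      proof (cases "n \<le> 1")
        case False
        have l: "q * L n \<ge> 0" using q False by (simp add: L_def)
        have "0 \<le> pi * r / 2 * (q * L n) * W (q * L n) + Re (exp (- of_real (q * L n) * a))"
          unfolding W_def by (rule weight[rule_format, OF \<epsilon> r l a])
        then show ?thesis unfolding e using k0[rule_format, of n] P(2)[of n]
          by (intro mult_nonneg_nonneg) (auto simp: E_def)
      qed (use k1 in simp)
    qed
    then show ?thesis by linarith
  qed
  show ?thesis by (rule exI[of _ \<epsilon>0], rule conjI[OF \<epsilon>0], intro allI impI, rule main)
qed

section \<open>Transport of zeta to the disc\<close>

text \<open>The offset of the centre is written q \<epsilon> so that, after division by q, the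
  distances to the pole and to the zeros are measured by \<epsilon>, the spacing of the evaluation
  points.\<close>

definition strip_map :: "real \<Rightarrow> real \<Rightarrow> real \<Rightarrow> complex \<Rightarrow> complex" where
  "strip_map q \<epsilon> y z = Complex (1 + q * \<epsilon>) y + of_real q * Arctan z"

lemma Re_strip_map: "Re (strip_map q \<epsilon> y z) = 1 + q * \<epsilon> + q * Re (Arctan z)"
  and Im_strip_map: "Im (strip_map q \<epsilon> y z) = y + q * Im (Arctan z)"
  by (simp_all add: strip_map_def)

lemma strip_map_bounds:
  assumes q: "0 < q" "q \<le> 1 / 8" and z: "norm z \<le> 0.993"
  shows "\<bar>Im (strip_map q \<epsilon> y z) - y\<bar> \<le> 1" "Re (strip_map q \<epsilon> y z) \<ge> 1 + q * \<epsilon> - pi / 4 * q"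
    "Re z \<ge> 0 \<Longrightarrow> Re (strip_map q \<epsilon> y z) \<ge> 1 + q * \<epsilon>" "Re z \<le> 0 \<Longrightarrow> Re (strip_map q \<epsilon> y z) \<le> 1 + q * \<epsilon>"
proof -
  have z1: "norm z < 1" using z by simp
  have "\<bar>Im (Arctan z)\<bar> \<le> 3.1" using cmod_Arctan_le[OF z] abs_Im_le_cmod[of "Arctan z"] by linarith
  then have "q * \<bar>Im (Arctan z)\<bar> \<le> 1 / 8 * 3.1" using q by (intro mult_mono) auto
  then show "\<bar>Im (strip_map q \<epsilon> y z) - y\<bar> \<le> 1" using q by (simp add: Im_strip_map abs_mult)
  have "q * (- (pi / 4)) \<le> q * Re (Arctan z)"
    using Arctan_bounds(1)[OF z1] q by (intro mult_left_mono) auto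
  then show "Re (strip_map q \<epsilon> y z) \<ge> 1 + q * \<epsilon> - pi / 4 * q" by (simp add: Re_strip_map mult.commute)
  show "Re (strip_map q \<epsilon> y z) \<ge> 1 + q * \<epsilon>" if "Re z \<ge> 0"
    using Arctan_bounds(3)[OF z1 that] q by (simp add: Re_strip_map)
  show "Re (strip_map q \<epsilon> y z) \<le> 1 + q * \<epsilon>" if "Re z \<le> 0"
  proof -
    have "Re (Arctan (- z)) \<ge> 0" using Arctan_bounds(3)[of "- z"] z1 that by simp
    then have "Re (Arctan z) \<le> 0" unfolding Arctan_minus'[OF z1] by simp
    then show ?thesis using q by (simp add: Re_strip_map mult_nonneg_nonpos)
  qed
qed

text \<open>A height of at least 2 against a vertical deviation of at most 1 keeps the image away
  from the pole.\<close>

lemma zeta_strip_deriv: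
  assumes q: "0 < q" "q \<le> 1 / 8" and z: "norm z \<le> 0.993" and y: "\<bar>y\<bar> \<ge> 2"
  shows "((\<lambda>z. zeta (strip_map q \<epsilon> y z)) has_field_derivative
     deriv zeta (strip_map q \<epsilon> y z) * (of_real q * inverse (1 + z\<^sup>2))) (at z)"
proof -
  have "\<bar>Im (strip_map q \<epsilon> y z)\<bar> \<ge> 1" using strip_map_bounds(1)[OF q z, of \<epsilon> y] y by linarith
  then have "strip_map q \<epsilon> y z \<noteq> 1" by auto
  then have "(zeta has_field_derivative deriv zeta (strip_map q \<epsilon> y z)) (at (strip_map q \<epsilon> y z))"
    by (intro holomorphic_derivI[OF zeta_holomorphic]) auto
  moreover have "\<bar>Im z\<bar> < 1" using abs_Im_le_cmod[of z] z by simp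
  then have "(strip_map q \<epsilon> y has_field_derivative of_real q * inverse (1 + z\<^sup>2)) (at z)"
    unfolding strip_map_def [abs_def] by (auto intro!: derivative_eq_intros has_field_derivative_Arctan)
  ultimately show ?thesis by (rule DERIV_chain2)
qed

lemma zeta_strip_holomorphic:
  assumes "0 < q" "q \<le> 1 / 8" "\<bar>y\<bar> \<ge> 2"
  shows "(\<lambda>z. zeta (strip_map q \<epsilon> y z)) holomorphic_on ball 0 0.993"
  unfolding holomorphic_on_open[OF open_ball]
proof
  fix z :: complex assume "z \<in> ball 0 0.993"
  then show "\<exists>D. ((\<lambda>z. zeta (strip_map q \<epsilon> y z)) has_field_derivative D) (at z)"
    using zeta_strip_deriv[OF assms(1,2) _ assms(3), of z \<epsilon>] by auto
qed

text \<open>A point at least \<open>\<nu>0\<close> q \<epsilon> to the left of Re s = 1 pulls back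
  to Re (Arctan z) <= - (1 + \<open>\<nu>0\<close>) \<epsilon>, the 1 coming from the offset of the
  centre. Passing from Arctan z to z costs the factor 1 - |z|^2, which near the centre is covered by
  the gap between \<open>\<nu>\<close> and \<open>\<nu>0\<close>.\<close>

lemma zeta_strip_zero:
  assumes q: "0 < q" "q \<le> 1 / 8" and z: "norm z \<le> 0.993" and \<epsilon>: "\<epsilon> > 0" and \<nu>: "1 + \<nu> < 1 + \<nu>0" "1 + \<nu> > 0"
    and Re: "Re (strip_map q \<epsilon> y z) \<le> 1 - \<nu>0 * (q * \<epsilon>)"
    and \<kappa>: "\<kappa>\<^sup>2 \<le> (\<nu>0 - \<nu>) / (1 + \<nu>0)"
  shows "Re z \<le> 0" "norm z < \<kappa> \<Longrightarrow> Re z \<le> - (1 + \<nu>) * \<epsilon>"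
proof -
  have z1: "norm z < 1" using z by simp
  have "q * (\<epsilon> + Re (Arctan z)) \<le> q * (- \<nu>0 * \<epsilon>)" using Re by (simp add: Re_strip_map algebra_simps)
  then have "\<epsilon> + Re (Arctan z) \<le> - \<nu>0 * \<epsilon>" using q(1) by (simp only: mult_le_cancel_left_pos)
  then have A: "Re (Arctan z) \<le> - ((1 + \<nu>0) * \<epsilon>)" by (simp add: algebra_simps)
  have p: "(1 + \<nu>0) * \<epsilon> > 0" using \<epsilon> \<nu> by simp
  show neg: "Re z \<le> 0" using Arctan_bounds(3)[OF z1] A p by (cases "Re z \<ge> 0") auto
  assume zk: "norm z < \<kappa>"
  have pos: "1 - (norm z)\<^sup>2 > 0" using z1 by (simp add: power_less_one_iff abs_square_less_1)
  have "(norm z)\<^sup>2 \<le> \<kappa>\<^sup>2" using zk by (intro power_mono) auto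
  then have "(norm z)\<^sup>2 \<le> (\<nu>0 - \<nu>) / (1 + \<nu>0)" using \<kappa> by linarith
  then have "(norm z)\<^sup>2 * (1 + \<nu>0) \<le> \<nu>0 - \<nu>" using \<nu> by (simp add: pos_le_divide_eq)
  then have "1 + \<nu> \<le> (1 + \<nu>0) * (1 - (norm z)\<^sup>2)" by (simp add: algebra_simps)
  then have "(1 + \<nu>) * \<epsilon> \<le> (1 + \<nu>0) * (1 - (norm z)\<^sup>2) * \<epsilon>" using \<epsilon> by (intro mult_right_mono) auto
  also have "\<dots> = ((1 + \<nu>0) * \<epsilon>) * (1 - (norm z)\<^sup>2)" by simp
  also have "\<dots> \<le> \<bar>Re (Arctan z)\<bar> * (1 - (norm z)\<^sup>2)" using A p pos by (intro mult_right_mono) auto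
  also have "\<dots> \<le> \<bar>Re z\<bar>" using abs_Re_Arctan_le[OF z1] pos by (simp add: le_divide_eq)
  finally show "Re z \<le> - (1 + \<nu>) * \<epsilon>" using neg by (simp add: algebra_simps)
qed

lemma strip_map_minus_tan:
  assumes "\<bar>x\<bar> < pi / 2"
  shows "strip_map q \<epsilon> y (of_real (- tan x)) = Complex (1 + q * \<epsilon> - q * x) y"
  using assms by (simp add: strip_map_def Arctan_of_real arctan_tan arctan_minus complex_eq_iff flip: of_real_minus)

text \<open>The hypothesis concerns the powers, so that a factor with exponent 0 may vanish.\<close>

lemma ln_norm_prod_power:
  fixes F :: "'b \<Rightarrow> complex"
  assumes "finite J" "\<And>j. j \<in> J \<Longrightarrow> F j ^ \<beta> j \<noteq> 0"
  shows "ln (norm (\<Prod>j\<in>J. F j ^ \<beta> j)) = (\<Sum>j\<in>J. real (\<beta> j) * ln (norm (F j)))"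
  using assms
proof (induction J rule: finite_induct)
  case (insert y J)
  have nz: "norm (F y) ^ \<beta> y > 0" "norm (\<Prod>j\<in>J. F j ^ \<beta> j) > 0"
    using insert.prems[of y] insert by (simp_all add: prod_zero_iff zero_less_power_eq flip: norm_power)
  then have "ln (norm (F y) ^ \<beta> y * norm (\<Prod>j\<in>J. F j ^ \<beta> j)) = ln (norm (F y) ^ \<beta> y) + ln (norm (\<Prod>j\<in>J. F j ^ \<beta> j))"
    by (intro ln_mult_pos)
  moreover have "ln (norm (F y) ^ \<beta> y) = real (\<beta> y) * ln (norm (F y))"
    using insert.prems[of y] by (cases "\<beta> y = 0") (auto simp: ln_realpow)
  ultimately show ?case using insert by (simp add: norm_mult norm_power)
qed auto

text \<open>Finitely many zeros cannot meet the circles of all radii in an interval.\<close>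

lemma circle_without_zeros:
  assumes f: "f holomorphic_on ball 0 R" "f 0 \<noteq> 0" and ab: "0 < a" "a < b" "b < R"
  obtains r where "a < r" "r < b" "\<And>z. norm z = r \<Longrightarrow> f z \<noteq> 0"
proof (cases "f constant_on ball 0 R")
  case True
  then obtain k where k: "\<And>z. z \<in> ball 0 R \<Longrightarrow> f z = k" by (auto simp: constant_on_def)
  show ?thesis
  proof (rule that[of "(a + b) / 2"])
    fix z :: complex assume "norm z = (a + b) / 2"
    then have "f z = f 0" using k[of z] k[of 0] ab by simp
    then show "f z \<noteq> 0" using f by simp
  qed (use ab in auto)
next
  case False
  have "finite {z \<in> cball 0 b. f z = 0}"
    by (rule holomorphic_compact_finite_zeros[OF f(1) _ _ _ _ False]) (use ab in auto)
  then have "finite (norm ` {z \<in> cball 0 b. f z = 0})" by (rule finite_imageI)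
  moreover have "infinite {a<..<b}" using ab by (rule_tac infinite_Ioo) 
  ultimately obtain r where r: "r \<in> {a<..<b}" "r \<notin> norm ` {z \<in> cball 0 b. f z = 0}"
    by (meson finite_subset subsetI)
  show ?thesis
  proof (rule that[of r])
    fix z :: complex assume "norm z = r"
    then show "f z \<noteq> 0" using r by (auto simp: image_iff)
  qed (use r in auto)
qed

lemma holomorphic_zero_factor:
  assumes g: "g holomorphic_on S" "open S" "\<rho> \<in> S" "g \<rho> = 0"
  obtains h where "h holomorphic_on S" "\<And>z. z \<in> S \<Longrightarrow> g z = (z - \<rho>) * h z"
proof
  show "(\<lambda>z. if z = \<rho> then deriv g \<rho> else (g z - g \<rho>) / (z - \<rho>)) holomorphic_on S"
    by (rule pole_lemma_open[OF g(1,2)])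
qed (use g in auto)

text \<open>Controls the preimage - tan x of the assumed zero: its distance from the centre exceeds
  x by a relative error of order x^2 only.\<close>

lemma tan_bounds_small:
  fixes x :: real
  assumes x: "0 < x" "x \<le> 1"
  shows "x \<le> tan x" "tan x * (1 - x\<^sup>2 / 2) \<le> x"
proof -
  have x2: "x < pi / 2" using x pi_gt3 by linarith
  have c: "cos x > 0" using x x2 by (intro cos_gt_zero) auto
  have t: "tan x > 0" using x x2 by (intro tan_gt_zero) auto
  have "arctan (tan x) \<le> tan x" using arctan_le_self[of "tan x"] t by simp
  then show "x \<le> tan x" using x x2 by (simp add: arctan_tan)
  have "\<bar>sin (x / 2)\<bar> \<le> \<bar>x / 2\<bar>" by (rule abs_sin_x_le_abs_x)
  then have "(sin (x / 2))\<^sup>2 \<le> (x / 2)\<^sup>2" by (rule abs_le_square_iff[THEN iffD1])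
  moreover have "cos x = 1 - 2 * (sin (x / 2))\<^sup>2" using cos_double_sin[of "x / 2"] by simp
  ultimately have "1 - x\<^sup>2 / 2 \<le> cos x" by (simp add: power2_eq_square)
  then have "tan x * (1 - x\<^sup>2 / 2) \<le> tan x * cos x" using t by (intro mult_left_mono) auto
  also have "\<dots> = sin x" using c by (simp add: tan_def)
  also have "\<dots> \<le> x" using x by (intro sin_x_le_x) auto
  finally show "tan x * (1 - x\<^sup>2 / 2) \<le> x" .
qed

section \<open>The inequality forced by a zero\<close>

text \<open>The weighted sum \<open>TJ\<close> of logarithmic derivatives over the strips j \<noteq>
  0 occurs twice: it is expressed through the zeros and the regular part, and it stands in the lower
  bound on the right half circle. The factor pi r / 2 there meets 2 / (pi r) from
  \<open>Re_deriv_ge_of_half_circles\<close>, so \<open>TJ\<close> cancels, and the pole, the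
  assumed zero, \<open>U\<close> and \<open>Z\<close> remain.\<close>

lemma detector_inequality:
  fixes c :: "nat \<Rightarrow> real" and J :: "int set" and \<beta> :: "int \<Rightarrow> nat" and \<beta>0 :: real
  assumes c1: "(\<Sum>i\<le>N. c i) = 1" and \<mu>: "\<mu> > 0"
    and c: "\<forall>y\<in>{0..1}. (\<Sum>i\<le>N. c i * y ^ i) \<ge> \<mu>"
    and \<nu>: "1 + \<nu> > 0" "\<nu> < \<nu>0" "\<nu>0 \<le> \<nu>1" "\<nu>1 < \<nu>2"
    and F: "\<forall>w::complex. Re w \<ge> 1 + \<nu> \<longrightarrow> \<mu> * Re (1 / w) \<le> Re (\<Sum>i\<le>N. c i / (w + of_nat i))"
    and \<Phi>: "\<forall>w::real. 1 + \<nu> \<le> w \<longrightarrow> w \<le> 1 + \<nu>2 \<longrightarrow> \<Phi>0 \<le> (\<Sum>i\<le>N. c i / (w + real i))"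
    and J: "finite J" "1 \<in> J" "- 1 \<in> J" "0 \<notin> J" and \<beta>0: "\<beta>0 \<ge> 0"
    and trig: "\<And>v. \<exists>p\<ge>0. of_real \<beta>0 + (\<Sum>j\<in>J. of_nat (\<beta> j) * cis (of_int j * v)) = complex_of_real p"
  shows "\<exists>C>0. \<exists>\<epsilon>0>0. \<forall>q \<epsilon> t U b Z. 0 < q \<longrightarrow> q \<le> 1 / 8 \<longrightarrow> 0 < \<epsilon> \<longrightarrow> \<epsilon> \<le> \<epsilon>0 \<longrightarrow> t \<ge> 2 \<longrightarrow> U \<ge> 0 \<longrightarrow>
     Z = ln (norm (zeta (of_real (1 + q * \<epsilon>)))) \<longrightarrow>
     (\<forall>j\<in>J. \<forall>s. \<bar>Im s - of_int j * t\<bar> \<le> 1 \<longrightarrow> 1 - pi / 4 * q \<le> Re s \<longrightarrow> Re s \<le> 1 + q * \<epsilon> \<longrightarrow> ln (norm (zeta s)) \<le> U) \<longrightarrow>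
     (\<forall>j\<in>J. \<forall>s. \<bar>Im s - of_int j * t\<bar> \<le> 1 \<longrightarrow> zeta s = 0 \<longrightarrow> Re s \<le> 1 - \<nu>0 * (q * \<epsilon>)) \<longrightarrow>
     zeta (Complex b t) = 0 \<longrightarrow> \<nu>0 * (q * \<epsilon>) \<le> 1 - b \<longrightarrow> 1 - b \<le> \<nu>1 * (q * \<epsilon>) \<longrightarrow>
     (1 / \<epsilon>) * (real (\<beta> 1 + \<beta> (- 1)) * \<Phi>0 - \<beta>0 * (\<Sum>i\<le>N. c i / real (i + 1)))
       \<le> 2 / (pi * 0.992) * (real (\<Sum>j\<in>J. \<beta> j) * U + \<beta>0 * Z) + C * \<epsilon> * (U + Z) + C"
proof -
  \<comment> \<open>As \<kappa> <= 1/4, \<kappa>^2 <= \<kappa>, so linear bounds suffice for the two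
    quadratic conditions.\<close>
  define \<kappa> where "\<kappa> = min (1 / 4) (min (\<mu> / 4) ((\<nu>0 - \<nu>) / (1 + \<nu>0)))"
  have \<kappa>: "0 < \<kappa>" "\<kappa> \<le> 1 / 4" unfolding \<kappa>_def using \<mu> \<nu> by (simp_all only: min.cobounded1) simp
  have "\<kappa>\<^sup>2 \<le> \<kappa>" using \<kappa> by (simp add: power2_eq_square mult_left_le)
  then have \<kappa>2: "4 * \<kappa>\<^sup>2 \<le> \<mu>" "\<kappa>\<^sup>2 \<le> (\<nu>0 - \<nu>) / (1 + \<nu>0)"
    unfolding \<kappa>_def by linarith+
  \<comment> \<open>j = 0 takes part in the prime estimate, whose positivity needs the constant
    term, but not in \<open>ff\<close>, where it would bring the pole into the disc.\<close>
  define b' where "b' j = (if j = 0 then \<beta>0 else real (\<beta> j))" for j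
  have b'J: "(\<Sum>j\<in>J. b' j * g j) = (\<Sum>j\<in>J. real (\<beta> j) * g j)" for g :: "int \<Rightarrow> real"
    using J by (intro sum.cong refl) (auto simp: b'_def)
  have b'I: "(\<Sum>j\<in>insert 0 J. b' j * g j) = \<beta>0 * g 0 + (\<Sum>j\<in>J. real (\<beta> j) * g j)" for g :: "int \<Rightarrow> real"
    using J by (simp add: b'J) (simp add: b'_def)
  have trig': "\<exists>p\<ge>0. (\<Sum>j\<in>insert 0 J. of_real (b' j) * cis (of_int j * v)) = complex_of_real p" for v
  proof -
    have "(\<Sum>j\<in>J. of_real (b' j) * cis (of_int j * v)) = (\<Sum>j\<in>J. of_nat (\<beta> j) * cis (of_int j * v))"
      using J by (intro sum.cong refl) (auto simp: b'_def)
    then have "(\<Sum>j\<in>insert 0 J. of_real (b' j) * cis (of_int j * v)) =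
        of_real \<beta>0 + (\<Sum>j\<in>J. of_nat (\<beta> j) * cis (of_int j * v))"
      using J by simp (simp add: b'_def)
    then show ?thesis using trig[of v] by simp
  qed
  obtain C1 \<epsilon>1 where C1: "C1 > 0" and \<epsilon>1: "\<epsilon>1 > 0"
    and zeros: "\<forall>\<epsilon> r \<rho>. 0 < \<epsilon> \<longrightarrow> \<epsilon> \<le> \<epsilon>1 \<longrightarrow> 1 / 2 \<le> r \<longrightarrow> r \<le> 1 \<longrightarrow> norm \<rho> < r \<longrightarrow> Re \<rho> \<le> 0 \<longrightarrow>
     (norm \<rho> < \<kappa> \<longrightarrow> Re \<rho> \<le> - (1 + \<nu>) * \<epsilon>) \<longrightarrow>
     Re (\<Sum>i\<le>N. c i * (1 / (of_real (real i * \<epsilon>) - \<rho>) + cnj \<rho> / (of_real (r\<^sup>2) - cnj \<rho> * of_real (real i * \<epsilon>))))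
       \<ge> - C1 * \<epsilon> * (r\<^sup>2 - (norm \<rho>)\<^sup>2)"
    using zero_contribution_ge[OF c1 \<mu> \<nu>(1) F \<kappa> \<kappa>2(1)] by (elim exE conjE) (rule that)
  obtain \<epsilon>2 where \<epsilon>2: "\<epsilon>2 > 0"
    and comb: "\<forall>q \<epsilon> r t a. 0 < q \<longrightarrow> 0 < \<epsilon> \<longrightarrow> \<epsilon> \<le> \<epsilon>2 \<longrightarrow> 0.992 \<le> r \<longrightarrow> Re a \<ge> 0 \<longrightarrow> norm a \<le> 3.1 \<longrightarrow>
     (\<Sum>j\<in>insert 0 J. b' j * ln (norm (zeta (Complex (1 + q * \<epsilon>) (of_int j * t) + of_real q * a)))) \<ge>
     - (pi * r / 2) * (\<Sum>i\<le>N. c i * (q / (1 + (real i * \<epsilon>)\<^sup>2)) *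
         (\<Sum>j\<in>insert 0 J. b' j * Re (- deriv zeta (Complex (1 + q * \<epsilon>) (of_int j * t) + of_real (q * arctan (real i * \<epsilon>))) /
                             zeta (Complex (1 + q * \<epsilon>) (of_int j * t) + of_real (q * arctan (real i * \<epsilon>))))))"
    using log_zeta_combination_ge[OF c1 \<mu> c finite.insertI[OF J(1)] trig'] by (elim exE conjE) (rule that)
  obtain C3 \<epsilon>3 where C3: "C3 > 0" and \<epsilon>3: "\<epsilon>3 > 0"
    and pole: "\<forall>q \<epsilon>. 0 < q \<longrightarrow> q \<le> 1 / 8 \<longrightarrow> 0 < \<epsilon> \<longrightarrow> \<epsilon> \<le> \<epsilon>3 \<longrightarrow>
     (\<Sum>i\<le>N. c i * (q / (1 + (real i * \<epsilon>)\<^sup>2)) *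
        Re (- deriv zeta (of_real (1 + q * \<epsilon> + q * arctan (real i * \<epsilon>))) / zeta (of_real (1 + q * \<epsilon> + q * arctan (real i * \<epsilon>)))))
     \<le> (1 / \<epsilon>) * (\<Sum>i\<le>N. c i / real (i + 1)) + C3"
    using pole_contribution[of c N] by (elim exE conjE) (rule that)
  define A where "A = (\<Sum>i\<le>N. \<bar>c i\<bar>)"
  have A: "A \<ge> 0" by (simp add: A_def sum_nonneg)
  define B where "B = real (\<Sum>j\<in>J. \<beta> j)"
  have B: "B \<ge> 0" unfolding B_def by (rule of_nat_0_le_iff)
  define m where "m = \<beta> 1 + \<beta> (- 1)"
  \<comment> \<open>Room for the distortion by tan: since 1 + \<open>\<nu>1\<close> is 1 +
    \<open>\<nu>2\<close> shrunk by 1 - \<open>\<delta>\<close>, the preimage of a zero within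
    \<open>\<nu>1\<close> stays within \<open>\<nu>2\<close>.\<close>
  define \<delta> where "\<delta> = (\<nu>2 - \<nu>1) / (1 + \<nu>2)"
  have \<delta>: "0 < \<delta>" "\<delta> \<le> 1" "(1 + \<nu>2) * (1 - \<delta>) = 1 + \<nu>1" using \<nu> by (auto simp: \<delta>_def field_simps)
  define \<epsilon>0 where "\<epsilon>0 = Min {\<epsilon>1, \<epsilon>2, \<epsilon>3, \<delta> / (1 + \<nu>1), 1 / (2 * (1 + \<nu>2)), 1 / (8 * (real N + 1))}"
  have \<epsilon>0: "\<epsilon>0 > 0" using \<epsilon>1 \<epsilon>2 \<epsilon>3 \<delta> \<nu> by (simp add: \<epsilon>0_def)
  have \<epsilon>0': "\<epsilon>0 \<le> \<epsilon>1" "\<epsilon>0 \<le> \<epsilon>2" "\<epsilon>0 \<le> \<epsilon>3" "\<epsilon>0 \<le> \<delta> / (1 + \<nu>1)" "\<epsilon>0 \<le> 1 / (2 * (1 + \<nu>2))" "\<epsilon>0 \<le> 1 / (8 * (real N + 1))"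
    unfolding \<epsilon>0_def by simp_all
  define C where "C = 4 * C1 * B + 224 * A * N * B + 112 * A * N + 2 * A * m + \<beta>0 * C3 + 1"
  have C: "C > 0" unfolding C_def using A B C1 C3 \<beta>0 by (intro add_nonneg_pos add_nonneg_nonneg mult_nonneg_nonneg) auto
  have main: "(1 / \<epsilon>) * (real (\<beta> 1 + \<beta> (- 1)) * \<Phi>0 - \<beta>0 * (\<Sum>i\<le>N. c i / real (i + 1)))
       \<le> 2 / (pi * 0.992) * (real (\<Sum>j\<in>J. \<beta> j) * U + \<beta>0 * Z) + C * \<epsilon> * (U + Z) + C"
    if q: "0 < q" "q \<le> 1 / 8" and \<epsilon>: "0 < \<epsilon>" "\<epsilon> \<le> \<epsilon>0" and t: "t \<ge> 2" and U: "U \<ge> 0"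
     and Z_eq: "Z = ln (norm (zeta (of_real (1 + q * \<epsilon>))))"
     and UB: "\<forall>j\<in>J. \<forall>s. \<bar>Im s - of_int j * t\<bar> \<le> 1 \<longrightarrow> 1 - pi / 4 * q \<le> Re s \<longrightarrow> Re s \<le> 1 + q * \<epsilon> \<longrightarrow> ln (norm (zeta s)) \<le> U"
     and ZF: "\<forall>j\<in>J. \<forall>s. \<bar>Im s - of_int j * t\<bar> \<le> 1 \<longrightarrow> zeta s = 0 \<longrightarrow> Re s \<le> 1 - \<nu>0 * (q * \<epsilon>)"
     and b: "zeta (Complex b t) = 0" "\<nu>0 * (q * \<epsilon>) \<le> 1 - b" "1 - b \<le> \<nu>1 * (q * \<epsilon>)"
   for q \<epsilon> t U b Z
  proof -
    have qe: "q * \<epsilon> > 0" using q \<epsilon> by simp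
    have \<epsilon>le: "\<epsilon> \<le> \<epsilon>1" "\<epsilon> \<le> \<epsilon>2" "\<epsilon> \<le> \<epsilon>3" "(1 + \<nu>1) * \<epsilon> \<le> \<delta>" "(1 + \<nu>2) * \<epsilon> \<le> 1 / 2" "(real N + 1) * \<epsilon> \<le> 1 / 8"
    proof -
      have "\<epsilon> \<le> \<delta> / (1 + \<nu>1)" "\<epsilon> \<le> 1 / (2 * (1 + \<nu>2))" "\<epsilon> \<le> 1 / (8 * (real N + 1))" using \<epsilon> \<epsilon>0' by linarith+
      then show "(1 + \<nu>1) * \<epsilon> \<le> \<delta>" "(1 + \<nu>2) * \<epsilon> \<le> 1 / 2" "(real N + 1) * \<epsilon> \<le> 1 / 8"
        using \<nu> by (simp_all add: le_divide_eq mult_ac)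
    qed (use \<epsilon> \<epsilon>0' in linarith)+
    define sm where "sm j z = strip_map q \<epsilon> (of_int j * t) z" for j :: int and z
    define ff where "ff z = (\<Prod>j\<in>J. zeta (sm j z) ^ \<beta> j)" for z
    have Y: "\<bar>of_int j * t\<bar> \<ge> 2" if "j \<in> J" for j
    proof -
      have "\<bar>j\<bar> \<ge> 1" using that J by (cases "j = 0") auto
      then have "1 * 2 \<le> \<bar>real_of_int j\<bar> * \<bar>t\<bar>" using t by (intro mult_mono) auto
      then show ?thesis by (simp add: abs_mult)
    qed
    have hol1: "(\<lambda>z. zeta (sm j z)) holomorphic_on ball 0 0.993" if "j \<in> J" for j
      unfolding sm_def by (rule zeta_strip_holomorphic[OF q Y[OF that]])
    have hol: "ff holomorphic_on ball 0 0.993"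
      unfolding ff_def by (intro holomorphic_intros hol1)
    have sm_right: "Re (sm j z) \<ge> 1 + q * \<epsilon>" if "norm z \<le> 0.993" "Re z \<ge> 0" for j z
      unfolding sm_def by (rule strip_map_bounds(3)[OF q that])
    have Zb: "\<bar>ln (norm (zeta (sm j z)))\<bar> \<le> Z" if "norm z \<le> 0.993" "Re z \<ge> 0" for j z
      unfolding Z_eq by (rule abs_ln_zeta_le) (use sm_right[OF that, of j] qe in linarith)+
    have Z: "Z \<ge> 0" by (rule order.trans[OF abs_ge_zero Zb[of 0 0]]) auto
    have nz: "zeta (sm j z) \<noteq> 0" if "norm z \<le> 0.993" "Re z \<ge> 0" for j z
      by (rule zeta_nonzero) (use sm_right[OF that, of j] qe in linarith)
    have ffnz: "ff z \<noteq> 0" if "norm z \<le> 0.993" "Re z \<ge> 0" for z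
      unfolding ff_def using nz[OF that] J by simp
    have ln_ff: "ln (norm (ff z)) = (\<Sum>j\<in>J. real (\<beta> j) * ln (norm (zeta (sm j z))))" if "ff z \<noteq> 0" for z
      unfolding ff_def
    proof (rule ln_norm_prod_power[OF J(1)])
      fix j assume "j \<in> J"
      then show "zeta (sm j z) ^ \<beta> j \<noteq> 0" using that J(1) unfolding ff_def by (simp add: prod_zero_iff)
    qed
    obtain r where r: "0.992 < r" "r < 0.9928" and rnz: "\<And>z. norm z = r \<Longrightarrow> ff z \<noteq> 0"
      using circle_without_zeros[OF hol ffnz, of "0.992" "0.9928"] by auto
    have bound_sum: "(\<Sum>j\<in>J. real (\<beta> j) * g j) \<le> B * x" if "\<And>j. j \<in> J \<Longrightarrow> g j \<le> x" for g x
    proof -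
      have "(\<Sum>j\<in>J. real (\<beta> j) * g j) \<le> (\<Sum>j\<in>J. real (\<beta> j) * x)"
        by (intro sum_mono mult_left_mono that) auto
      then show ?thesis by (simp add: B_def sum_distrib_right)
    qed
    have U1: "ln (norm (ff z)) \<le> B * U" if z: "norm z = r" "Re z \<le> 0" for z
      unfolding ln_ff[OF rnz[OF z(1)]]
    proof (rule bound_sum)
      fix j assume j: "j \<in> J"
      have zr: "norm z \<le> 0.993" using z r by simp
      have "1 - pi / 4 * q \<le> Re (sm j z)" using strip_map_bounds(2)[OF q zr, of \<epsilon> "of_int j * t"] qe unfolding sm_def by linarith
      then show "ln (norm (zeta (sm j z))) \<le> U"
        using UB[rule_format, OF j, of "sm j z"] strip_map_bounds(1,4)[OF q zr] z(2) unfolding sm_def by blast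
    qed
    have U2: "ln (norm (ff z)) \<le> B * Z" if z: "norm z = r" "Re z \<ge> 0" for z
      unfolding ln_ff[OF rnz[OF z(1)]]
      by (rule bound_sum, rule order.trans[OF abs_ge_self Zb]) (use z r in auto)
    \<comment> \<open>This crude bound on the whole circle enters only the zero count and the
      variation of the regular part, and there it is multiplied by \<epsilon>.\<close>
    have U3: "ln (norm (ff z)) \<le> B * (U + Z)" if z: "norm z = r" for z
    proof (cases "Re z \<le> 0")
      case True
      have "0 \<le> B * Z" using B Z by simp
      then show ?thesis using U1[OF z True] by (simp add: distrib_left)
    next
      case False
      have "0 \<le> B * U" using B U by simp
      then show ?thesis using U2[OF z] False by (simp add: distrib_left)
    qed
    have ff0nz: "ff 0 \<noteq> 0" by (rule ffnz) auto
    have ff0: "- ln (norm (ff 0)) \<le> B * Z"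
    proof -
      have "- ln (norm (ff 0)) = (\<Sum>j\<in>J. real (\<beta> j) * - ln (norm (zeta (sm j 0))))"
        using ln_ff[OF ffnz[of 0]] by (simp add: sum_negf)
      also have "\<dots> \<le> B * Z"
        by (rule bound_sum, rule order.trans[OF abs_ge_minus_self Zb]) auto
      finally show ?thesis .
    qed
    have ff0u: "ln (norm (ff 0)) \<le> B * Z"
      unfolding ln_ff[OF ff0nz] by (rule bound_sum, rule order.trans[OF abs_ge_self Zb]) auto
    define P0 where "P0 i = Re (- deriv zeta (of_real (1 + q * \<epsilon> + q * arctan (real i * \<epsilon>))) / zeta (of_real (1 + q * \<epsilon> + q * arctan (real i * \<epsilon>))))" for i
    define PJ where "PJ i = (\<Sum>j\<in>J. real (\<beta> j) * Re (- deriv zeta (sm j (of_real (real i * \<epsilon>))) / zeta (sm j (of_real (real i * \<epsilon>)))))" for i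
    define h0 where "h0 i = q / (1 + (real i * \<epsilon>)\<^sup>2)" for i
    define T0 where "T0 = (\<Sum>i\<le>N. c i * h0 i * P0 i)"
    define TJ where "TJ = (\<Sum>i\<le>N. c i * h0 i * PJ i)"
    have T0: "T0 \<le> (1 / \<epsilon>) * (\<Sum>i\<le>N. c i / real (i + 1)) + C3"
      unfolding T0_def h0_def P0_def by (rule pole[rule_format, OF q \<epsilon>(1) \<epsilon>le(3)])
    \<comment> \<open>The term j = 0 of the prime estimate is moved to the other side, where
      \<open>Z\<close> bounds it. The sum \<open>TJ\<close> is kept as it is and never
      estimated.\<close>
    have V: "ln (norm (ff z)) \<ge> - (pi * r / 2 * (\<beta>0 * T0 + TJ) + \<beta>0 * Z)" if z: "norm z = r" "Re z \<ge> 0" for z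
    proof -
      have zr: "norm z \<le> 0.993" using z r by simp
      have a: "Re (Arctan z) \<ge> 0" "norm (Arctan z) \<le> 3.1" using Arctan_bounds(3)[of z] cmod_Arctan_le[OF zr] z r by auto
      have i0: "sm 0 (of_real (real i * \<epsilon>)) = of_real (1 + q * \<epsilon> + q * arctan (real i * \<epsilon>))" for i
        unfolding sm_def strip_map_def Arctan_of_real by (simp add: complex_eq_iff)
      have ij: "Complex (1 + q * \<epsilon>) (of_int j * t) + of_real (q * arctan (real i * \<epsilon>)) = sm j (of_real (real i * \<epsilon>))" for i j
        unfolding sm_def strip_map_def Arctan_of_real by (simp only: of_real_mult)
      have ij': "Complex (1 + q * \<epsilon>) (of_int j * t) + of_real q * Arctan z = sm j z" for j
        by (simp only: sm_def strip_map_def)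
      have r': "0.992 \<le> r" using r by simp
      have "(\<Sum>j\<in>insert 0 J. b' j * ln (norm (zeta (sm j z)))) \<ge> - (pi * r / 2) * (\<Sum>i\<le>N. c i * h0 i * (\<beta>0 * P0 i + PJ i))"
        using comb[rule_format, OF q(1) \<epsilon>(1) \<epsilon>le(2) r' a, of t] unfolding ij' b'I ij i0 h0_def P0_def PJ_def .
      moreover have "(\<Sum>i\<le>N. c i * h0 i * (\<beta>0 * P0 i + PJ i)) = \<beta>0 * T0 + TJ"
        by (simp add: T0_def TJ_def sum.distrib sum_distrib_left algebra_simps)
      moreover have "\<beta>0 * ln (norm (zeta (sm 0 z))) \<le> \<beta>0 * Z"
        using Zb[OF zr z(2), of 0] \<beta>0 by (intro mult_left_mono) auto
      ultimately show ?thesis unfolding b'I ln_ff[OF rnz[OF z(1)]] by simp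
    qed
    \<comment> \<open>The position of the assumed zero in units of q \<epsilon>. Its distance from
      the centre is then q x with x = (1 + \<xi>) \<epsilon>, so its preimage is - tan x.\<close>
    define \<xi> where "\<xi> = (1 - b) / (q * \<epsilon>)"
    have \<xi>: "\<nu>0 \<le> \<xi>" "\<xi> \<le> \<nu>1" "1 - b = \<xi> * (q * \<epsilon>)"
      using b(2,3) qe by (auto simp: \<xi>_def le_divide_eq divide_le_eq)
    define x where "x = (1 + \<xi>) * \<epsilon>"
    have "x \<le> (1 + \<nu>1) * \<epsilon>" unfolding x_def using \<xi> \<epsilon> by (intro mult_right_mono) auto
    moreover have "0 < x" using \<xi> \<nu> \<epsilon> by (simp add: x_def)
    ultimately have x: "0 < x" "x \<le> \<delta>" "x \<le> 1" using \<epsilon>le(4) \<delta>(2) by linarith+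
    define \<tau> where "\<tau> = tan x"
    have \<tau>: "x \<le> \<tau>" "\<tau> \<le> (1 + \<nu>2) * \<epsilon>"
    proof -
      show "x \<le> \<tau>" unfolding \<tau>_def by (rule tan_bounds_small[OF x(1,3)])
      then have \<tau>0: "\<tau> > 0" using x by linarith
      have "x\<^sup>2 \<le> x" using x by (simp add: power2_eq_square mult_left_le)
      then have 1: "1 - \<delta> \<le> 1 - x\<^sup>2 / 2" using x by simp
      have 2: "1 - x\<^sup>2 / 2 > 0" using \<open>x\<^sup>2 \<le> x\<close> x by simp
      have "\<tau> * (1 - x\<^sup>2 / 2) \<le> x" unfolding \<tau>_def by (rule tan_bounds_small[OF x(1,3)])
      also have "\<dots> \<le> (1 + \<nu>2) * (1 - \<delta>) * \<epsilon>" using \<open>x \<le> (1 + \<nu>1) * \<epsilon>\<close> \<delta>(3) by simp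
      also have "\<dots> = ((1 + \<nu>2) * \<epsilon>) * (1 - \<delta>)" by simp
      also have "\<dots> \<le> ((1 + \<nu>2) * \<epsilon>) * (1 - x\<^sup>2 / 2)" using 1 \<nu> \<epsilon> by (intro mult_left_mono) auto
      finally show "\<tau> \<le> (1 + \<nu>2) * \<epsilon>" using 2 by (simp only: mult_le_cancel_right_pos)
    qed
    have \<tau>': "0 < \<tau>" "\<tau> \<le> 1 / 2" using \<tau> x \<epsilon>le by linarith+
    define \<rho>0 where "\<rho>0 = complex_of_real (- \<tau>)"
    have n\<rho>0: "norm \<rho>0 = \<tau>" using \<tau>' by (simp add: \<rho>0_def)
    have sm\<rho>: "sm j \<rho>0 = Complex b (of_int j * t)" for j
    proof -
      have "\<bar>x\<bar> < pi / 2" using x pi_gt3 by linarith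
      then have "sm j \<rho>0 = Complex (1 + q * \<epsilon> - q * x) (of_int j * t)"
        unfolding sm_def \<rho>0_def \<tau>_def by (rule strip_map_minus_tan)
      moreover have "1 + q * \<epsilon> - q * x = b" using \<xi>(3) by (simp add: x_def algebra_simps)
      ultimately show ?thesis by simp
    qed
    \<comment> \<open>The conjugate zero at height - t has the same real part, hence the same
      preimage; both j = 1 and j = - 1 detect it.\<close>
    have \<rho>zero: "zeta (sm 1 \<rho>0) = 0" "zeta (sm (- 1) \<rho>0) = 0"
    proof -
      show "zeta (sm 1 \<rho>0) = 0" unfolding sm\<rho> using b by simp
      have "zeta (cnj (Complex b t)) = cnj (zeta (Complex b t))" by (rule zeta_cnj) (use t in \<open>auto simp: complex_eq_iff\<close>)
      then show "zeta (sm (- 1) \<rho>0) = 0" unfolding sm\<rho> using b by (simp add: complex_cnj)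
    qed
    have \<rho>ball: "\<rho>0 \<in> ball 0 0.993" using n\<rho>0 \<tau>' by simp
    obtain g1 where g1: "g1 holomorphic_on ball 0 0.993" "\<And>z. z \<in> ball 0 0.993 \<Longrightarrow> zeta (sm 1 z) = (z - \<rho>0) * g1 z"
      using holomorphic_zero_factor[OF hol1[OF J(2)] open_ball \<rho>ball \<rho>zero(1)] by blast
    obtain g2 where g2: "g2 holomorphic_on ball 0 0.993" "\<And>z. z \<in> ball 0 0.993 \<Longrightarrow> zeta (sm (- 1) z) = (z - \<rho>0) * g2 z"
      using holomorphic_zero_factor[OF hol1[OF J(3)] open_ball \<rho>ball \<rho>zero(2)] by blast
    define f1 where "f1 z = g1 z ^ \<beta> 1 * (g2 z ^ \<beta> (- 1) * (\<Prod>j\<in>J - {1} - {- 1}. zeta (sm j z) ^ \<beta> j))" for z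
    have f1: "f1 holomorphic_on ball 0 0.993"
      unfolding f1_def by (intro holomorphic_intros g1 g2 hol1) auto
    have f1eq: "ff z = (z - \<rho>0) ^ m * f1 z" if z: "z \<in> ball 0 0.993" for z
    proof -
      have "ff z = zeta (sm 1 z) ^ \<beta> 1 * (\<Prod>j\<in>J - {1}. zeta (sm j z) ^ \<beta> j)"
        unfolding ff_def by (rule prod.remove[OF J(1,2)])
      also have "(\<Prod>j\<in>J - {1}. zeta (sm j z) ^ \<beta> j) = zeta (sm (- 1) z) ^ \<beta> (- 1) * (\<Prod>j\<in>J - {1} - {- 1}. zeta (sm j z) ^ \<beta> j)"
        using J by (intro prod.remove) auto
      finally show ?thesis unfolding g1(2)[OF z] g2(2)[OF z] f1_def m_def
        by (simp add: power_mult_distrib power_add mult_ac)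
    qed
    have rr: "0 < r" "r < 0.993" "norm \<rho>0 < r" using r n\<rho>0 \<tau>' by auto
    have "\<exists>M h. replicate_mset m \<rho>0 \<subseteq># M \<and> (\<forall>\<rho>\<in>#M. norm \<rho> < r \<and> ff \<rho> = 0) \<and>
       (\<Sum>\<rho>\<in>#M. r\<^sup>2 - (norm \<rho>)\<^sup>2) \<le> 2 * r\<^sup>2 * (B * (U + Z) - ln (norm (ff 0))) \<and>
       (\<forall>x\<in>ball 0 r. ff x \<noteq> 0 \<longrightarrow>
        deriv ff x / ff x = (\<Sum>\<rho>\<in>#M. 1 / (x - \<rho>) + cnj \<rho> / (of_real (r\<^sup>2) - cnj \<rho> * x)) + h x) \<and>
       Re (h 0) \<ge> - (2 / (pi * r)) * (B * U + (pi * r / 2 * (\<beta>0 * T0 + TJ) + \<beta>0 * Z)) \<and>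
       (\<forall>x. norm x \<le> r / 4 \<longrightarrow> norm (h x - h 0) \<le> 56 * (B * (U + Z) - ln (norm (ff 0)) + 1) / r\<^sup>2 * norm x)"
      by (rule log_deriv_disc[OF rr(1,2) hol ff0nz _ f1 _ rr(3)]) (fact rnz f1eq U1 V U3)+
    then obtain M h where M: "replicate_mset m \<rho>0 \<subseteq># M" "\<forall>\<rho>\<in>#M. norm \<rho> < r \<and> ff \<rho> = 0"
       "(\<Sum>\<rho>\<in>#M. r\<^sup>2 - (norm \<rho>)\<^sup>2) \<le> 2 * r\<^sup>2 * (B * (U + Z) - ln (norm (ff 0)))"
      and dec: "\<forall>x\<in>ball 0 r. ff x \<noteq> 0 \<longrightarrow>
        deriv ff x / ff x = (\<Sum>\<rho>\<in>#M. 1 / (x - \<rho>) + cnj \<rho> / (of_real (r\<^sup>2) - cnj \<rho> * x)) + h x"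
      and hre: "Re (h 0) \<ge> - (2 / (pi * r)) * (B * U + (pi * r / 2 * (\<beta>0 * T0 + TJ) + \<beta>0 * Z))"
      and hdiff: "\<forall>x. norm x \<le> r / 4 \<longrightarrow> norm (h x - h 0) \<le> 56 * (B * (U + Z) - ln (norm (ff 0)) + 1) / r\<^sup>2 * norm x"
      by (elim exE conjE) (rule that)
    define G where "G = 2 * B * (U + Z)"
    have G: "B * (U + Z) - ln (norm (ff 0)) \<le> G" "G \<ge> 0" "B * (U + Z) - ln (norm (ff 0)) \<ge> 0"
    proof -
      have "0 \<le> B * U" "0 \<le> B * Z" using B U Z by auto
      moreover have "B * (U + Z) = B * U + B * Z" "G = 2 * (B * U) + 2 * (B * Z)"
        by (auto simp: G_def algebra_simps)
      ultimately show "B * (U + Z) - ln (norm (ff 0)) \<le> G" "G \<ge> 0" "B * (U + Z) - ln (norm (ff 0)) \<ge> 0"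
        using ff0 ff0u by linarith+
    qed
    have r2: "1 / 2 \<le> r\<^sup>2" "r\<^sup>2 \<le> 1"
    proof -
      have "0.992\<^sup>2 \<le> r\<^sup>2" using r by (intro power_mono) auto
      then show "1 / 2 \<le> r\<^sup>2" by (simp add: power2_eq_square)
      show "r\<^sup>2 \<le> 1" using r by (simp add: power_le_one)
    qed
    define W where "W \<rho> = Re (\<Sum>i\<le>N. c i * (1 / (of_real (real i * \<epsilon>) - \<rho>) + cnj \<rho> / (of_real (r\<^sup>2) - cnj \<rho> * of_real (real i * \<epsilon>))))" for \<rho>
    have W\<rho>: "W \<rho> \<ge> - C1 * \<epsilon> * (r\<^sup>2 - (norm \<rho>)\<^sup>2)" if "norm \<rho> < r" "ff \<rho> = 0" for \<rho>
    proof -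
      note asm = that
      have zr: "norm \<rho> \<le> 0.993" using that r by simp
      obtain j where j: "j \<in> J" "zeta (sm j \<rho>) = 0"
        using asm(2) J unfolding ff_def by auto
      have "Re (sm j \<rho>) \<le> 1 - \<nu>0 * (q * \<epsilon>)"
        using ZF j strip_map_bounds(1)[OF q zr] unfolding sm_def by blast
      then have "Re \<rho> \<le> 0" "norm \<rho> < \<kappa> \<Longrightarrow> Re \<rho> \<le> - (1 + \<nu>) * \<epsilon>"
        unfolding sm_def using zeta_strip_zero[OF q zr \<epsilon>(1) _ \<nu>(1) _ \<kappa>2(2)] \<nu>(2) by auto
      then show ?thesis unfolding W_def using zeros \<epsilon> \<epsilon>le(1) that(1) r by auto
    qed
    obtain M' where M': "M = replicate_mset m \<rho>0 + M'" using M(1) by (auto simp: mset_subset_eq_exists_conv)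
    \<comment> \<open>This is the term that grows like 1 / \<epsilon>: \<tau> / \<epsilon> lies in
      the interval where \<open>\<Phi>0\<close> bounds the kernel from below, while the boundary
      fractions amount to at most 2 A.\<close>
    have W0: "W \<rho>0 \<ge> \<Phi>0 / \<epsilon> - 2 * A"
    proof -
      have "W \<rho>0 = (\<Sum>i\<le>N. c i * (1 / (real i * \<epsilon> + \<tau>) - \<tau> / (r\<^sup>2 + \<tau> * (real i * \<epsilon>))))"
      proof -
        have "1 / (of_real (real i * \<epsilon>) - \<rho>0) + cnj \<rho>0 / (of_real (r\<^sup>2) - cnj \<rho>0 * of_real (real i * \<epsilon>)) =
           complex_of_real (1 / (real i * \<epsilon> + \<tau>) - \<tau> / (r\<^sup>2 + \<tau> * (real i * \<epsilon>)))" for i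
          by (simp add: \<rho>0_def)
        then show ?thesis unfolding W_def by simp
      qed
      also have "\<dots> = (\<Sum>i\<le>N. c i * (1 / (real i * \<epsilon> + \<tau>))) - (\<Sum>i\<le>N. c i * (\<tau> / (r\<^sup>2 + \<tau> * (real i * \<epsilon>))))"
        by (simp add: right_diff_distrib sum_subtractf)
      also have "(\<Sum>i\<le>N. c i * (1 / (real i * \<epsilon> + \<tau>))) = (\<Sum>i\<le>N. c i / (\<tau> / \<epsilon> + real i)) / \<epsilon>"
        unfolding sum_divide_distrib
      proof (intro sum.cong refl)
        fix i
        have "real i * \<epsilon> + \<tau> = (\<tau> / \<epsilon> + real i) * \<epsilon>" using \<epsilon> by (simp add: field_simps)
        then show "c i * (1 / (real i * \<epsilon> + \<tau>)) = c i / (\<tau> / \<epsilon> + real i) / \<epsilon>" by simp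
      qed
      finally have e: "W \<rho>0 = (\<Sum>i\<le>N. c i / (\<tau> / \<epsilon> + real i)) / \<epsilon> - (\<Sum>i\<le>N. c i * (\<tau> / (r\<^sup>2 + \<tau> * (real i * \<epsilon>))))" .
      have "1 + \<nu> \<le> \<tau> / \<epsilon>"
      proof -
        have "(1 + \<nu>) * \<epsilon> \<le> x" unfolding x_def using \<nu> \<xi> \<epsilon> by (intro mult_right_mono) auto
        then show ?thesis using \<tau> \<epsilon> by (simp add: le_divide_eq)
      qed
      moreover have "\<tau> / \<epsilon> \<le> 1 + \<nu>2" using \<tau> \<epsilon> by (simp add: divide_le_eq)
      ultimately have "\<Phi>0 \<le> (\<Sum>i\<le>N. c i / (\<tau> / \<epsilon> + real i))" using \<Phi> by blast
      then have 1: "\<Phi>0 / \<epsilon> \<le> (\<Sum>i\<le>N. c i / (\<tau> / \<epsilon> + real i)) / \<epsilon>" using \<epsilon> by (intro divide_right_mono) auto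
      have "(\<Sum>i\<le>N. c i * (\<tau> / (r\<^sup>2 + \<tau> * (real i * \<epsilon>)))) \<le> (\<Sum>i\<le>N. \<bar>c i\<bar> * 2)"
      proof (rule sum_mono)
        fix i
        have d: "1 / 2 \<le> r\<^sup>2 + \<tau> * (real i * \<epsilon>)" using r2 \<tau>' \<epsilon> by (intro add_increasing2 mult_nonneg_nonneg) auto
        then have "\<tau> / (r\<^sup>2 + \<tau> * (real i * \<epsilon>)) \<le> 1 / (1 / 2)" using \<tau>' by (intro frac_le) auto
        moreover have "0 \<le> \<tau> / (r\<^sup>2 + \<tau> * (real i * \<epsilon>))" using \<tau>' d by (intro divide_nonneg_nonneg) auto
        moreover have "c i * (\<tau> / (r\<^sup>2 + \<tau> * (real i * \<epsilon>))) \<le> \<bar>c i\<bar> * (\<tau> / (r\<^sup>2 + \<tau> * (real i * \<epsilon>)))"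
          using calculation(2) by (intro mult_right_mono) auto
        ultimately show "c i * (\<tau> / (r\<^sup>2 + \<tau> * (real i * \<epsilon>))) \<le> \<bar>c i\<bar> * 2"
          using mult_left_mono[of "\<tau> / (r\<^sup>2 + \<tau> * (real i * \<epsilon>))" 2 "\<bar>c i\<bar>"] by simp
      qed
      also have "\<dots> = 2 * A" by (simp add: A_def sum_distrib_right[symmetric])
      finally show ?thesis using e 1 by simp
    qed
    have M'sum: "(\<Sum>\<rho>\<in>#M'. W \<rho>) \<ge> - (4 * C1 * B * \<epsilon> * (U + Z))"
    proof -
      have M'in: "norm \<rho> < r" "ff \<rho> = 0" if "\<rho> \<in># M'" for \<rho> using M(2) that by (auto simp: M')
      have "(\<Sum>\<rho>\<in>#M'. - C1 * \<epsilon> * (r\<^sup>2 - (norm \<rho>)\<^sup>2)) \<le> (\<Sum>\<rho>\<in>#M'. W \<rho>)"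
        by (intro sum_mset_mono W\<rho> M'in)
      also have "(\<Sum>\<rho>\<in>#M'. - C1 * \<epsilon> * (r\<^sup>2 - (norm \<rho>)\<^sup>2)) = - C1 * \<epsilon> * (\<Sum>\<rho>\<in>#M'. r\<^sup>2 - (norm \<rho>)\<^sup>2)"
        by (simp only: sum_mset_distrib_left)
      finally have 1: "- C1 * \<epsilon> * (\<Sum>\<rho>\<in>#M'. r\<^sup>2 - (norm \<rho>)\<^sup>2) \<le> (\<Sum>\<rho>\<in>#M'. W \<rho>)" .
      have "0 \<le> real m * (r\<^sup>2 - (norm \<rho>0)\<^sup>2)"
        using rr(3) by (intro mult_nonneg_nonneg) (auto intro!: power_mono)
      then have "(\<Sum>\<rho>\<in>#M'. r\<^sup>2 - (norm \<rho>)\<^sup>2) \<le> (\<Sum>\<rho>\<in>#M. r\<^sup>2 - (norm \<rho>)\<^sup>2)"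
        unfolding M' by simp
      also have "\<dots> \<le> 2 * r\<^sup>2 * (B * (U + Z) - ln (norm (ff 0)))" by (rule M(3))
      also have "\<dots> \<le> 2 * r\<^sup>2 * G" using G(1) by (intro mult_left_mono) auto
      also have "\<dots> \<le> 2 * 1 * G" using r2 G by (intro mult_right_mono mult_left_mono) auto
      finally have "C1 * \<epsilon> * (\<Sum>\<rho>\<in>#M'. r\<^sup>2 - (norm \<rho>)\<^sup>2) \<le> C1 * \<epsilon> * (2 * 1 * G)"
        using C1 \<epsilon> by (intro mult_left_mono) auto
      also have "\<dots> = 4 * C1 * B * \<epsilon> * (U + Z)" by (simp add: G_def)
      finally show ?thesis using 1 by simp
    qed
    have xr: "norm (complex_of_real (real i * \<epsilon>)) \<le> r / 4" "real i * \<epsilon> \<le> real N * \<epsilon>" if "i \<le> N" for i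
    proof -
      show "real i * \<epsilon> \<le> real N * \<epsilon>" using that \<epsilon> by (intro mult_right_mono) auto
      then show "norm (complex_of_real (real i * \<epsilon>)) \<le> r / 4"
      proof -
        have r8: "1 / 8 \<le> r / 4" using r by simp
        assume a: "real i * \<epsilon> \<le> real N * \<epsilon>"
        have "real i * \<epsilon> \<ge> 0" "real N * \<epsilon> + \<epsilon> \<le> 1 / 8" using \<epsilon>le(6) \<epsilon> by (auto simp: distrib_right)
        then have "\<bar>real i * \<epsilon>\<bar> \<le> r / 4" using a r8 \<epsilon>(1) unfolding abs_of_nonneg[OF \<open>real i * \<epsilon> \<ge> 0\<close>] by linarith
        then show ?thesis unfolding norm_of_real .
      qed
    qed
    have Nsum: "(\<Sum>i\<le>N. c i * Re (h (of_real (real i * \<epsilon>)))) \<ge> Re (h 0) - (224 * A * N * B * \<epsilon> * (U + Z) + 112 * A * N)"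
    proof -
      define E where "E = 112 * (G + 1) * (real N * \<epsilon>)"
      have E: "E \<ge> 0" using G \<epsilon> by (simp add: E_def)
      have close: "\<bar>Re (h (of_real (real i * \<epsilon>))) - Re (h 0)\<bar> \<le> E" if "i \<le> N" for i
      proof -
        have "\<bar>Re (h (of_real (real i * \<epsilon>))) - Re (h 0)\<bar> \<le> norm (h (of_real (real i * \<epsilon>)) - h 0)"
          using abs_Re_le_cmod[of "h (of_real (real i * \<epsilon>)) - h 0"] by simp
        also have "\<dots> \<le> 56 * (B * (U + Z) - ln (norm (ff 0)) + 1) / r\<^sup>2 * norm (complex_of_real (real i * \<epsilon>))"
          using hdiff xr(1)[OF that] by blast
        also have "\<dots> \<le> 56 * (G + 1) / (1 / 2) * (real N * \<epsilon>)"
        proof (intro mult_mono frac_le)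
          show "norm (complex_of_real (real i * \<epsilon>)) \<le> real N * \<epsilon>" unfolding norm_of_real using xr(2)[OF that] \<epsilon> by simp
        qed (use G r2 \<epsilon> in auto)
        finally show ?thesis by (simp add: E_def)
      qed
      have "Re (h 0) - (\<Sum>i\<le>N. c i * Re (h (of_real (real i * \<epsilon>)))) = (\<Sum>i\<le>N. c i * (Re (h 0) - Re (h (of_real (real i * \<epsilon>)))))"
        by (simp add: right_diff_distrib sum_subtractf c1 flip: sum_distrib_right)
      also have "\<dots> \<le> (\<Sum>i\<le>N. \<bar>c i\<bar> * E)"
      proof (rule sum_mono)
        fix i assume i: "i \<in> {..N}"
        have "c i * (Re (h 0) - Re (h (of_real (real i * \<epsilon>)))) \<le> \<bar>c i * (Re (h 0) - Re (h (of_real (real i * \<epsilon>))))\<bar>" by (rule abs_ge_self)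
        also have "\<dots> \<le> \<bar>c i\<bar> * E" unfolding abs_mult using close[of i] i by (intro mult_left_mono) auto
        finally show "c i * (Re (h 0) - Re (h (of_real (real i * \<epsilon>)))) \<le> \<bar>c i\<bar> * E" .
      qed
      also have "\<dots> = A * E" by (simp add: A_def sum_distrib_right)
      also have "\<dots> = 224 * A * N * B * \<epsilon> * (U + Z) + 112 * A * N * \<epsilon>"
        by (simp add: E_def G_def algebra_simps)
      also have "\<dots> \<le> 224 * A * N * B * \<epsilon> * (U + Z) + 112 * A * N * 1"
      proof -
        have "\<epsilon> \<le> (real N + 1) * \<epsilon>" using \<epsilon> by (simp add: algebra_simps)
        then have "\<epsilon> \<le> 1" using \<epsilon>le(6) by linarith
        then show ?thesis using A by (intro add_left_mono mult_left_mono) auto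
      qed
      finally show ?thesis by simp
    qed
    \<comment> \<open>The decomposition of ff' / ff at the points i \<epsilon>, weighted by c_i. The
      chain rule gives the factor \<open>h0 i\<close>, and the sign comes from - zeta' / zeta in
      \<open>TJ\<close>.\<close>
    have ident: "- TJ = real m * W \<rho>0 + (\<Sum>\<rho>\<in>#M'. W \<rho>) + (\<Sum>i\<le>N. c i * Re (h (of_real (real i * \<epsilon>))))"
    proof -
      define S where "S i \<rho> = 1 / (of_real (real i * \<epsilon>) - \<rho>) + cnj \<rho> / (of_real (r\<^sup>2) - cnj \<rho> * of_real (real i * \<epsilon>))" for i \<rho>
      have d: "- (h0 i * PJ i) = Re (\<Sum>\<rho>\<in>#M. S i \<rho>) + Re (h (of_real (real i * \<epsilon>)))" if i: "i \<le> N" for i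
      proof -
        define X where "X = complex_of_real (real i * \<epsilon>)"
        have X: "norm X \<le> 0.993" "Re X \<ge> 0" "X \<in> ball 0 r" using xr(1)[OF i] r \<epsilon> by (auto simp: X_def)
        have "(ff has_field_derivative (\<Prod>j\<in>J. zeta (sm j X) ^ \<beta> j) * (\<Sum>j\<in>J. of_nat (\<beta> j) *
           ((deriv zeta (sm j X) * (of_real q * inverse (1 + X\<^sup>2))) / zeta (sm j X)))) (at X)"
          unfolding ff_def
          by (rule has_field_derivative_prod_power[OF J(1)]) (use nz[OF X(1,2)] zeta_strip_deriv[OF q X(1) Y] in \<open>auto simp: sm_def\<close>)
        then have "deriv ff X = ff X * (\<Sum>j\<in>J. of_nat (\<beta> j) *
           ((deriv zeta (sm j X) * (of_real q * inverse (1 + X\<^sup>2))) / zeta (sm j X)))"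
          unfolding ff_def[of X, symmetric] by (rule DERIV_imp_deriv)
        then have "deriv ff X / ff X = (\<Sum>j\<in>J. of_nat (\<beta> j) *
           ((deriv zeta (sm j X) * (of_real q * inverse (1 + X\<^sup>2))) / zeta (sm j X)))"
          using ffnz[OF X(1,2)] by simp
        also have "\<dots> = of_real (h0 i) * (\<Sum>j\<in>J. of_nat (\<beta> j) * (deriv zeta (sm j X) / zeta (sm j X)))"
        proof -
          have "of_real q * inverse (1 + X\<^sup>2) = of_real (h0 i)" by (simp add: X_def h0_def divide_inverse)
          then show ?thesis unfolding sum_distrib_left by (intro sum.cong refl) simp
        qed
        finally have "Re (deriv ff X / ff X) = h0 i * Re (\<Sum>j\<in>J. of_nat (\<beta> j) * (deriv zeta (sm j X) / zeta (sm j X)))"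
          by (simp only: Re_of_real_mult)
        also have "Re (\<Sum>j\<in>J. of_nat (\<beta> j) * (deriv zeta (sm j X) / zeta (sm j X))) = - PJ i"
        proof -
          have t: "Re (of_nat n * w) = - (real n * Re (- w))" for n w by simp
          then show ?thesis unfolding PJ_def Re_sum X_def[symmetric] sum_negf[symmetric] t by (simp only: minus_divide_left)
        qed
        finally have "Re (deriv ff X / ff X) = - (h0 i * PJ i)" by simp
        moreover have "deriv ff X / ff X = (\<Sum>\<rho>\<in>#M. S i \<rho>) + h X"
          using dec[rule_format, OF X(3) ffnz[OF X(1,2)]] unfolding S_def X_def .
        ultimately show ?thesis by (simp add: X_def)
      qed
      have Remset: "Re (\<Sum>\<rho>\<in>#K. u \<rho>) = (\<Sum>\<rho>\<in>#K. Re (u \<rho>))" for K and u :: "complex \<Rightarrow> complex"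
        by (induction K) auto
      have swap: "(\<Sum>i\<le>N. c i * (\<Sum>\<rho>\<in>#K. Re (S i \<rho>))) = (\<Sum>\<rho>\<in>#K. W \<rho>)" for K
      proof (induction K)
        case (add \<rho> K)
        have "W \<rho> = (\<Sum>i\<le>N. c i * Re (S i \<rho>))" by (simp add: W_def S_def)
        then show ?case using add by (simp add: distrib_left sum.distrib)
      qed auto
      have "- TJ = (\<Sum>i\<le>N. c i * - (h0 i * PJ i))" by (simp add: TJ_def sum_negf mult.assoc)
      also have "\<dots> = (\<Sum>i\<le>N. c i * ((\<Sum>\<rho>\<in>#M. Re (S i \<rho>)) + Re (h (of_real (real i * \<epsilon>)))))"
        by (intro sum.cong refl) (use d Remset in auto)
      also have "\<dots> = (\<Sum>\<rho>\<in>#M. W \<rho>) + (\<Sum>i\<le>N. c i * Re (h (of_real (real i * \<epsilon>))))"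
        by (simp add: distrib_left sum.distrib swap)
      finally show ?thesis by (simp add: M')
    qed
    have pir: "pi * r > 0" using rr by simp
    \<comment> \<open>The two factors involving pi r compensate, so \<open>TJ\<close> appears with
      coefficient 1, as in \<open>ident\<close>.\<close>
    have "(2 / (pi * r)) * (B * U + (pi * r / 2 * (\<beta>0 * T0 + TJ) + \<beta>0 * Z)) =
       (2 / (pi * r)) * (B * U + \<beta>0 * Z) + (\<beta>0 * T0 + TJ)"
    proof -
      have "(2 / (pi * r)) * (pi * r / 2 * Y) = Y" for Y using rr(1) by simp
      from this[of "\<beta>0 * T0 + TJ"] show ?thesis by (simp only: distrib_left)
    qed
    then have h1: "Re (h 0) \<ge> - ((2 / (pi * r)) * (B * U + \<beta>0 * Z)) - (\<beta>0 * T0 + TJ)" using hre by simp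
    have h2: "(2 / (pi * r)) * (B * U + \<beta>0 * Z) \<le> 2 / (pi * 0.992) * (B * U + \<beta>0 * Z)"
      using r B U Z \<beta>0 by (intro mult_right_mono frac_le mult_left_mono) auto
    have h3: "\<beta>0 * T0 \<le> \<beta>0 * ((1 / \<epsilon>) * (\<Sum>i\<le>N. c i / real (i + 1)) + C3)" using T0 \<beta>0 by (rule mult_left_mono)
    have h4: "real m * (\<Phi>0 / \<epsilon> - 2 * A) \<le> real m * W \<rho>0" using W0 by (intro mult_left_mono) auto
    define SF where "SF = (\<Sum>i\<le>N. c i / real (i + 1))"
    define X1 where "X1 = 2 / (pi * 0.992) * (B * U + \<beta>0 * Z)"
    have "real m * (\<Phi>0 / \<epsilon> - 2 * A) - 4 * C1 * B * \<epsilon> * (U + Z) - X1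
        - (224 * A * N * B * \<epsilon> * (U + Z) + 112 * A * N) \<le> \<beta>0 * ((1 / \<epsilon>) * SF + C3)"
    proof -
      \<comment> \<open>Naming the products makes the combination of the estimates linear;
        \<open>TJ\<close> is eliminated in it.\<close>
      define Y1 where "Y1 = 2 / (pi * r) * (B * U + \<beta>0 * Z)"
      define Y2 where "Y2 = (\<Sum>i\<le>N. c i * Re (h (of_real (real i * \<epsilon>))))"
      define Y3 where "Y3 = 224 * A * N * B * \<epsilon> * (U + Z) + 112 * A * N"
      define Y4 where "Y4 = real m * (\<Phi>0 / \<epsilon> - 2 * A)"
      define Y5 where "Y5 = \<beta>0 * ((1 / \<epsilon>) * SF + C3)"
      define Y6 where "Y6 = real m * W \<rho>0"
      define Y7 where "Y7 = 4 * C1 * B * \<epsilon> * (U + Z)"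
      define Y8 where "Y8 = (\<Sum>\<rho>\<in>#M'. W \<rho>)"
      define Y9 where "Y9 = \<beta>0 * T0"
      show ?thesis
        using ident M'sum Nsum h1 h2 h3 h4
        unfolding SF_def[symmetric] X1_def[symmetric] Y1_def[symmetric] Y2_def[symmetric] Y3_def[symmetric]
          Y4_def[symmetric] Y5_def[symmetric] Y6_def[symmetric] Y7_def[symmetric] Y8_def[symmetric] Y9_def[symmetric]
        by linarith
    qed
    then have "(1 / \<epsilon>) * (real m * \<Phi>0 - \<beta>0 * SF) \<le> X1 + (4 * C1 * B + 224 * A * N * B) * (\<epsilon> * (U + Z)) + (112 * A * N + 2 * A * m + \<beta>0 * C3)"
      by (simp add: algebra_simps)
    also have "\<dots> \<le> X1 + C * (\<epsilon> * (U + Z)) + C"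
    proof -
      have "4 * C1 * B + 224 * A * N * B \<le> C" "112 * A * N + 2 * A * m + \<beta>0 * C3 \<le> C"
        unfolding C_def using A B C1 C3 \<beta>0 by auto
      moreover have "0 \<le> \<epsilon> * (U + Z)" using \<epsilon> U Z by simp
      ultimately show ?thesis by (intro add_mono mult_right_mono order.refl)
    qed
    finally show ?thesis by (simp add: SF_def X1_def m_def B_def mult.assoc)
  qed
  show ?thesis
    by (rule exI[of _ C], rule conjI[OF C], rule exI[of _ \<epsilon>0], rule conjI[OF \<epsilon>0], intro allI impI, rule main)
qed

section \<open>The zero-free region\<close>

text \<open>
  The autocorrelation of the sequence \<open>5, 14, 21, 20, 12, 3, -1, -1, 1\<close>, which makes the trigonometric
  polynomial with these coefficients nonnegative.
\<close>

definition fejer_coeff :: "int \<Rightarrow> nat" where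
  "fejer_coeff j = (if \<bar>j\<bar> = 1 then 1057 else if \<bar>j\<bar> = 2 then 681 else if \<bar>j\<bar> = 3 then 302 else
     if \<bar>j\<bar> = 4 then 73 else if \<bar>j\<bar> = 6 then 2 else if \<bar>j\<bar> = 7 then 9 else if \<bar>j\<bar> = 8 then 5 else 0)"

text \<open>0 is left out because of the pole, its coefficient 1218 being handled apart; 5 and - 5
  are left out because the autocorrelation vanishes at this lag.\<close>

definition fejer_support :: "int set" where
  "fejer_support = {1, 2, 3, 4, 6, 7, 8, - 1, - 2, - 3, - 4, - 6, - 7, - 8}"

lemma fejer_support_facts:
  "finite fejer_support" "1 \<in> fejer_support" "- 1 \<in> fejer_support" "0 \<notin> fejer_support"
  "(\<Sum>j\<in>fejer_support. fejer_coeff j) = 4258" "fejer_coeff 1 + fejer_coeff (- 1) = 2114"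
  "j \<in> fejer_support \<Longrightarrow> 1 \<le> \<bar>j\<bar> \<and> \<bar>j\<bar> \<le> 8"
  by (auto simp: fejer_support_def fejer_coeff_def)

lemma fejer_nonneg:
  "\<exists>p\<ge>0. of_real 1218 + (\<Sum>j\<in>fejer_support. of_nat (fejer_coeff j) * cis (of_int j * v)) = complex_of_real p"
proof -
  define z where "z = cis v"
  define w where "w = cis (- v)"
  have zw: "z * w = 1" by (simp add: z_def w_def cis_mult)
  have c: "cis (real n * v) = z ^ n" "cis (- (real n * v)) = w ^ n" for n
    by (simp_all only: z_def w_def Complex.DeMoivre mult_minus_right)
  define Q where "Q x = 5 + 14 * x + 21 * x ^ 2 + 20 * x ^ 3 + 12 * x ^ 4 + 3 * x ^ 5 - x ^ 6 - x ^ 7 + x ^ 8" for x :: complex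
  have "cnj z = w" by (simp add: z_def w_def cis_cnj)
  then have cn: "cnj (Q z) = Q w" by (simp add: Q_def)
  have "(\<Sum>j\<in>fejer_support. of_nat (fejer_coeff j) * cis (of_int j * v)) =
     1057 * (z + w) + 681 * (z ^ 2 + w ^ 2) + 302 * (z ^ 3 + w ^ 3) + 73 * (z ^ 4 + w ^ 4) +
     2 * (z ^ 6 + w ^ 6) + 9 * (z ^ 7 + w ^ 7) + 5 * (z ^ 8 + w ^ 8)"
    using c[of 1] c[of 2] c[of 3] c[of 4] c[of 6] c[of 7] c[of 8]
    by (simp add: fejer_support_def fejer_coeff_def algebra_simps)
  \<comment> \<open>The product Q z Q w reduced by z w = 1; on the unit circle it is |Q
    z|^2.\<close>
  moreover have "1218 + (1057 * (z + w) + 681 * (z ^ 2 + w ^ 2) + 302 * (z ^ 3 + w ^ 3) + 73 * (z ^ 4 + w ^ 4) +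
     2 * (z ^ 6 + w ^ 6) + 9 * (z ^ 7 + w ^ 7) + 5 * (z ^ 8 + w ^ 8)) = Q z * Q w"
    using zw unfolding Q_def by algebra
  moreover have "Q z * Q w = of_real ((norm (Q z))\<^sup>2)"
    using complex_norm_square[of "Q z"] cn by simp
  ultimately show ?thesis by (intro exI[of _ "(norm (Q z))\<^sup>2"]) simp
qed

text \<open>Up to Re s = 1 the growth hypothesis applies, beyond it the bound C ln |t|; hence the
  maximum. The upper bound \<open>u\<close> for the height lets one number serve all strips.\<close>

lemma ln_zeta_strip_le:
  fixes A B :: real
  assumes A: "A > 0" and B: "B > 0"
    and hyp: "\<forall>t \<sigma> :: real. \<bar>t\<bar> \<ge> 3 \<longrightarrow> 1 / 2 \<le> \<sigma> \<longrightarrow> \<sigma> \<le> 1 \<longrightarrow>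
           norm (zeta (Complex \<sigma> t)) \<le> A * \<bar>t\<bar> powr (B * (1 - \<sigma>) powr (3 / 2)) * ln \<bar>t\<bar> powr (2 / 3)"
  shows "\<exists>K\<ge>0. \<forall>(s::complex) u \<eta>. 3 \<le> \<bar>Im s\<bar> \<longrightarrow> \<bar>Im s\<bar> \<le> u \<longrightarrow> 0 \<le> \<eta> \<longrightarrow> \<eta> \<le> 1 / 2 \<longrightarrow> 1 - \<eta> \<le> Re s \<longrightarrow> Re s \<le> 2 \<longrightarrow>
     ln (norm (zeta s)) \<le> K + max (B * \<eta> powr (3 / 2) * ln u + 2 / 3 * ln (ln u)) (ln (ln u))"
proof -
  obtain C where C: "C > 0" and Cb: "\<forall>s. 1 < Re s \<and> Re s \<le> 2 \<and> \<bar>Im s\<bar> \<ge> 3 \<longrightarrow> norm (zeta s) \<le> C * ln \<bar>Im s\<bar>"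
    using zeta_log_bound by (elim exE conjE) (rule that)
  define K where "K = \<bar>ln A\<bar> + \<bar>ln C\<bar>"
  have main: "ln (norm (zeta s)) \<le> K + max (B * \<eta> powr (3 / 2) * ln u + 2 / 3 * ln (ln u)) (ln (ln u))"
    if s: "3 \<le> \<bar>Im s\<bar>" "\<bar>Im s\<bar> \<le> u" and \<eta>: "0 \<le> \<eta>" "\<eta> \<le> 1 / 2" and Re: "1 - \<eta> \<le> Re s" "Re s \<le> 2" for s :: complex and u \<eta>
  proof -
    define v where "v = \<bar>Im s\<bar>"
    have v: "3 \<le> v" "v \<le> u" using s by (auto simp: v_def)
    have lv: "ln v \<ge> 1" "ln v \<le> ln u"
    proof -
      have "exp 1 \<le> v" using exp_le v by linarith
      then show "ln v \<ge> 1" using v by (simp add: ln_ge_iff)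
      show "ln v \<le> ln u" using v by simp
    qed
    have llv: "0 \<le> ln (ln v)" "ln (ln v) \<le> ln (ln u)" using lv by auto
    show ?thesis
    proof (cases "zeta s = 0")
      case True
      \<comment> \<open>At a zero the convention \<open>ln 0 = 0\<close> leaves only the sign of the
        right-hand side to check.\<close>
      then show ?thesis using llv by (simp add: K_def max_def)
    next
      case False
      then have pos: "norm (zeta s) > 0" by simp
      show ?thesis
      proof (cases "Re s \<le> 1")
        case True
        define e where "e = B * (1 - Re s) powr (3 / 2)"
        have e: "0 \<le> e" "e \<le> B * \<eta> powr (3 / 2)"
          unfolding e_def using B True Re \<eta> by (auto intro!: powr_mono2)
        have "norm (zeta s) \<le> A * v powr e * ln v powr (2 / 3)"
          using hyp[rule_format, of "Im s" "Re s"] True Re \<eta> s by (simp add: v_def e_def)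
        then have "ln (norm (zeta s)) \<le> ln (A * v powr e * ln v powr (2 / 3))"
          using pos A v lv by (subst ln_le_cancel_iff) auto
        also have "\<dots> = ln A + e * ln v + 2 / 3 * ln (ln v)"
          using A v lv by (simp add: ln_mult_pos)
        also have "e * ln v \<le> (B * \<eta> powr (3 / 2)) * ln u" using e lv by (intro mult_mono) auto
        finally have "ln (norm (zeta s)) \<le> ln A + B * \<eta> powr (3 / 2) * ln u + 2 / 3 * ln (ln u)" using llv by simp
        then show ?thesis unfolding K_def by linarith
      next
        case F: False
        have "norm (zeta s) \<le> C * ln v" using Cb F Re s by (simp add: v_def)
        then have "ln (norm (zeta s)) \<le> ln (C * ln v)" using pos C lv by (subst ln_le_cancel_iff) auto
        also have "\<dots> = ln C + ln (ln v)" using C lv by (intro ln_mult_pos) auto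
        finally show ?thesis using llv unfolding K_def by linarith
      qed
    qed
  qed
  have "K \<ge> 0" by (simp add: K_def)
  then show ?thesis using main by (intro exI[of _ K]) blast
qed

definition zero_free_width :: "real \<Rightarrow> real" where
  "zero_free_width t = 1 / (ln t powr (2 / 3) * ln (ln t) powr (1 / 3))"

text \<open>The threshold is existential because each step of the iteration may raise it; negative
  heights are covered by conjugation.\<close>

definition zero_free_constant :: "real \<Rightarrow> real \<Rightarrow> bool" where
  "zero_free_constant D m \<longleftrightarrow>
     (\<exists>T. \<forall>t\<ge>T. \<forall>b. zeta (Complex b t) = 0 \<longrightarrow> m * D * zero_free_width t \<le> 1 - b)"

lemma ln_gt_1: "t \<ge> 4 \<Longrightarrow> ln t > (1::real)"
proof -
  assume t: "t \<ge> 4"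
  have "exp 1 < t" using exp_le t by linarith
  then have "ln (exp 1) < ln t" by (subst ln_less_cancel_iff) (use t in auto)
  then show ?thesis by simp
qed

lemma zero_free_width_pos: "t \<ge> 4 \<Longrightarrow> zero_free_width t > 0"
  using ln_gt_1[of t] by (simp add: zero_free_width_def)

lemma zero_free_width_antimono:
  assumes "4 \<le> s" "s \<le> t"
  shows "zero_free_width t \<le> zero_free_width s"
proof -
  have s: "ln s > 1" "ln s \<le> ln t" using ln_gt_1[of s] assms by auto
  then have "ln (ln s) > 0" "ln (ln s) \<le> ln (ln t)" by auto
  then show ?thesis using s unfolding zero_free_width_def by (intro frac_le mult_mono powr_mono2 mult_pos_pos) auto
qed

lemma zero_free_constant_mono:
  assumes "zero_free_constant D m" "m' \<le> m" "D \<ge> 0"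
  shows "zero_free_constant D m'"
proof -
  obtain T where T: "\<forall>t\<ge>T. \<forall>b. zeta (Complex b t) = 0 \<longrightarrow> m * D * zero_free_width t \<le> 1 - b"
    using assms(1) by (auto simp: zero_free_constant_def)
  have "m' * D * zero_free_width t \<le> 1 - b" if "t \<ge> max T 4" "zeta (Complex b t) = 0" for t b
  proof -
    have "m' * D * zero_free_width t \<le> m * D * zero_free_width t"
      using zero_free_width_pos[of t] assms that by (intro mult_right_mono) auto
    then show ?thesis using T that by fastforce
  qed
  then show ?thesis unfolding zero_free_constant_def by blast
qed

lemma zero_free_width_asymptotics:
  "((\<lambda>t. zero_free_width (9 * t) / zero_free_width t) \<longlongrightarrow> 1) at_top"
  "(zero_free_width \<longlongrightarrow> 0) at_top"
  "((\<lambda>t. (ln (ln t) / ln t) powr (2 / 3) :: real) \<longlongrightarrow> 0) at_top"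
  "((\<lambda>t. ln (9 * t) / ln t :: real) \<longlongrightarrow> 1) at_top"
  "((\<lambda>t. ln (ln (9 * t)) / ln (ln t) :: real) \<longlongrightarrow> 1) at_top"
  "((\<lambda>t. ln (ln (ln t)) / ln (ln t) :: real) \<longlongrightarrow> 0) at_top"
  "((\<lambda>t. 1 / ln (ln t) :: real) \<longlongrightarrow> 0) at_top"
  "filterlim (\<lambda>t. ln (ln t) :: real) at_top at_top"
  unfolding zero_free_width_def [abs_def] by real_asymp+

text \<open>The factor 9 comes from 8 t + 1 <= 9 t.\<close>

lemma height_bounds:
  fixes x t :: real
  assumes j: "1 \<le> \<bar>j\<bar>" "\<bar>j\<bar> \<le> (8::int)" and t: "t \<ge> 4" and s: "\<bar>x - of_int j * t\<bar> \<le> 1"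
  shows "t - 1 \<le> \<bar>x\<bar>" "\<bar>x\<bar> \<le> 9 * t"
proof -
  have "1 * t \<le> \<bar>real_of_int j\<bar> * t" "\<bar>real_of_int j\<bar> * t \<le> 8 * t"
    using j t by (auto intro!: mult_right_mono)
  moreover have "\<bar>real_of_int j\<bar> * t = \<bar>of_int j * t\<bar>" using t by (simp add: abs_mult)
  ultimately show "t - 1 \<le> \<bar>x\<bar>" "\<bar>x\<bar> \<le> 9 * t" using s t by linarith+
qed

section \<open>Improving a zero-free region\<close>

text \<open>By contradiction, with q \<epsilon> equal to m' / \<open>\<nu>1\<close> in units of the
  width, so that a zero violating the new constant lies within \<open>\<nu>1\<close> q \<epsilon>. A
  half-width (pi / 4) q of order (ln ln t / ln t)^(2/3) makes the growth hypothesis contribute a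
  multiple of ln ln t, and \<epsilon> is then of order 1 / ln ln t. Divided by ln ln t, the detector
  inequality contradicts \<open>ineq\<close> in the limit.\<close>

lemma zero_free_step:
  fixes A B :: real and c :: "nat \<Rightarrow> real"
  assumes A: "A > 0" and B: "B > 0"
    and hyp: "\<forall>t \<sigma> :: real. \<bar>t\<bar> \<ge> 3 \<longrightarrow> 1 / 2 \<le> \<sigma> \<longrightarrow> \<sigma> \<le> 1 \<longrightarrow>
           norm (zeta (Complex \<sigma> t)) \<le> A * \<bar>t\<bar> powr (B * (1 - \<sigma>) powr (3 / 2)) * ln \<bar>t\<bar> powr (2 / 3)"
    and c1: "(\<Sum>i\<le>N. c i) = 1" and \<mu>: "\<mu> > 0"
    and c: "\<forall>y\<in>{0..1}. (\<Sum>i\<le>N. c i * y ^ i) \<ge> \<mu>"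
    and \<nu>: "1 + \<nu> > 0" "\<nu> < \<nu>0" "0 \<le> \<nu>0" "\<nu>0 \<le> \<nu>1" "0 < \<nu>1" "\<nu>1 < \<nu>2"
    and F: "\<forall>w::complex. Re w \<ge> 1 + \<nu> \<longrightarrow> \<mu> * Re (1 / w) \<le> Re (\<Sum>i\<le>N. c i / (w + of_nat i))"
    and \<Phi>: "\<forall>w::real. 1 + \<nu> \<le> w \<longrightarrow> w \<le> 1 + \<nu>2 \<longrightarrow> \<Phi>0 \<le> (\<Sum>i\<le>N. c i / (w + real i))"
    and m': "m' > 0"
    and old: "\<nu>0 = 0 \<or> zero_free_constant (B powr (- 2 / 3)) m \<and> \<nu>0 * m' < \<nu>1 * m"
    and ineq: "m' / \<nu>1 * (4258 * (1.197 ^ 3 + 2 / 3) + 1218 * (2 / 3)) <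
       2 * 0.992 * 1.197\<^sup>2 * (2114 * \<Phi>0 - 1218 * (\<Sum>i\<le>N. c i / real (i + 1)))"
  shows "zero_free_constant (B powr (- 2 / 3)) m'"
proof -
  define W where "W = zero_free_width"
  define D where "D = B powr (- 2 / 3)"
  have D: "D > 0" using B by (simp add: D_def)
  \<comment> \<open>1.197 stands for s = sqrt \<open>\<theta>\<close>. The gain is proportional to
    s^2 and the cost to 4258 (s^3 + 2/3) + 1218 (2/3); the quotient is largest at s^3 = 4 (4258 +
    1218) / (3 * 4258), which is s = 1.1969 approximately.\<close>
  define \<Theta> :: real where "\<Theta> = 1.197 ^ 3"
  define \<theta> :: real where "\<theta> = 1.197\<^sup>2"
  have \<theta>: "\<theta> > 0" by (simp add: \<theta>_def)
  have \<Theta>: "\<Theta> \<ge> 1" by (simp add: \<Theta>_def power3_eq_cube)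
  have \<theta>\<Theta>: "\<theta> powr (3 / 2) = \<Theta>"
  proof -
    have e: "1.197 powr 2 = \<theta>" "1.197 powr (2 * (3 / 2)) = \<Theta>" by (simp_all add: \<theta>_def \<Theta>_def)
    then show ?thesis using powr_powr[of "1.197" 2 "3 / 2"] unfolding e by simp
  qed
  define \<kappa> where "\<kappa> = m' / \<nu>1"
  have \<kappa>: "\<kappa> > 0" "\<nu>1 * \<kappa> = m'" using m' \<nu> by (auto simp: \<kappa>_def)
  define X where "X = 2114 * \<Phi>0 - 1218 * (\<Sum>i\<le>N. c i / real (i + 1))"
  define Q :: real where "Q = 4258 * (\<Theta> + 2 / 3) + 1218 * (2 / 3)"
  have ineq': "\<kappa> * Q < 2 * 0.992 * \<theta> * X"
    using ineq by (simp only: \<kappa>_def Q_def \<theta>_def \<Theta>_def X_def)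
  have p1218: "(0::real) \<le> 1218" by simp
  obtain C \<epsilon>0 where C: "C > 0" and \<epsilon>0: "\<epsilon>0 > 0"
    and det: "\<forall>q \<epsilon> t U b Z. 0 < q \<longrightarrow> q \<le> 1 / 8 \<longrightarrow> 0 < \<epsilon> \<longrightarrow> \<epsilon> \<le> \<epsilon>0 \<longrightarrow> t \<ge> 2 \<longrightarrow> U \<ge> 0 \<longrightarrow>
     Z = ln (norm (zeta (of_real (1 + q * \<epsilon>)))) \<longrightarrow>
     (\<forall>j\<in>fejer_support. \<forall>s. \<bar>Im s - of_int j * t\<bar> \<le> 1 \<longrightarrow> 1 - pi / 4 * q \<le> Re s \<longrightarrow> Re s \<le> 1 + q * \<epsilon> \<longrightarrow> ln (norm (zeta s)) \<le> U) \<longrightarrow>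
     (\<forall>j\<in>fejer_support. \<forall>s. \<bar>Im s - of_int j * t\<bar> \<le> 1 \<longrightarrow> zeta s = 0 \<longrightarrow> Re s \<le> 1 - \<nu>0 * (q * \<epsilon>)) \<longrightarrow>
     zeta (Complex b t) = 0 \<longrightarrow> \<nu>0 * (q * \<epsilon>) \<le> 1 - b \<longrightarrow> 1 - b \<le> \<nu>1 * (q * \<epsilon>) \<longrightarrow>
     (1 / \<epsilon>) * (real (fejer_coeff 1 + fejer_coeff (- 1)) * \<Phi>0 - 1218 * (\<Sum>i\<le>N. c i / real (i + 1)))
       \<le> 2 / (pi * 0.992) * (real (\<Sum>j\<in>fejer_support. fejer_coeff j) * U + 1218 * Z) + C * \<epsilon> * (U + Z) + C"
    using detector_inequality[OF c1 \<mu> c \<nu>(1,2,4,6) F \<Phi> fejer_support_facts(1-4) p1218 fejer_nonneg]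
    by (elim exE conjE) (rule that)
  obtain K1 where K1: "K1 \<ge> 0" and strip: "\<forall>(s::complex) u \<eta>. 3 \<le> \<bar>Im s\<bar> \<longrightarrow> \<bar>Im s\<bar> \<le> u \<longrightarrow> 0 \<le> \<eta> \<longrightarrow> \<eta> \<le> 1 / 2 \<longrightarrow> 1 - \<eta> \<le> Re s \<longrightarrow> Re s \<le> 2 \<longrightarrow>
     ln (norm (zeta s)) \<le> K1 + max (B * \<eta> powr (3 / 2) * ln u + 2 / 3 * ln (ln u)) (ln (ln u))"
    using ln_zeta_strip_le[OF A B hyp] by (elim exE conjE) (rule that)
  obtain C2 d where C2: "C2 > 0" and d: "d > 0" and near: "\<forall>\<sigma>. 1 < \<sigma> \<and> \<sigma> < 1 + d \<longrightarrow>
     norm (deriv zeta (of_real \<sigma>) / zeta (of_real \<sigma>) + 1 / of_real (\<sigma> - 1)) \<le> C2 \<and>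
     norm (zeta (of_real \<sigma>)) \<le> C2 / (\<sigma> - 1)"
    using zeta_near_1 by (elim exE conjE) (rule that)
  define y where "y t = ln (ln t)" for t :: real
  \<comment> \<open>For \<eta> = (pi / 4) q this gives B \<eta>^(3/2) ln t = \<Theta> ln ln t; the
    factor D = B^(-2/3) is there to cancel B.\<close>
  define q where "q t = 4 / pi * (\<theta> * D * (y t / ln t) powr (2 / 3))" for t
  define k where "k = \<kappa> * pi / (4 * \<theta>)"
  have k: "k > 0" using \<kappa> \<theta> by (simp add: k_def)
  define \<epsilon> where "\<epsilon> t = k * (1 / y t)" for t
  define U where "U t = K1 + \<Theta> * y t * (ln (9 * t) / ln t) + 2 / 3 * ln (ln (9 * t))" for t
  define Z where "Z t = ln C2 - ln (\<kappa> * D) + 2 / 3 * y t + 1 / 3 * ln (y t)" for t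
  have ly: "ln t > 1" "y t > 0" "W t > 0" if "t \<ge> 4" for t
    using ln_gt_1[OF that] zero_free_width_pos[OF that] by (auto simp: y_def W_def)
  have q\<epsilon>: "q t * \<epsilon> t = \<kappa> * D * W t" if t: "t \<ge> 4" for t
  proof -
    have "y t = y t powr (2 / 3) * y t powr (1 / 3)"
      using ly[OF t] by (simp flip: powr_add)
    then have e: "y t powr (2 / 3) / y t = 1 / y t powr (1 / 3)"
      using ly[OF t] by (metis divide_divide_eq_left divide_self_if order_less_irrefl powr_gt_zero)
    have "q t * \<epsilon> t = \<kappa> * D * ((y t / ln t) powr (2 / 3) / y t)"
      using \<theta> by (simp add: q_def \<epsilon>_def k_def)
    also have "(y t / ln t) powr (2 / 3) = y t powr (2 / 3) / ln t powr (2 / 3)"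
      using ly[OF t] by (simp add: powr_divide)
    also have "\<dots> / y t = (y t powr (2 / 3) / y t) / ln t powr (2 / 3)" by simp
    finally show ?thesis unfolding e by (simp add: W_def zero_free_width_def y_def mult.commute)
  qed
  have "((\<lambda>t. 4 / pi * (\<theta> * D * (ln (ln t) / ln t) powr (2 / 3))) \<longlongrightarrow> 4 / pi * (\<theta> * D * 0)) at_top"
    by (intro tendsto_mult tendsto_const zero_free_width_asymptotics)
  then have "(q \<longlongrightarrow> 0) at_top" by (simp add: q_def [abs_def] y_def)
  then have E2: "eventually (\<lambda>t. q t < 1 / 8) at_top" by (rule order_tendstoD) simp
  have y0: "((\<lambda>t. 1 / y t) \<longlongrightarrow> 0) at_top" unfolding y_def by (rule zero_free_width_asymptotics)
  have \<epsilon>lim: "(\<epsilon> \<longlongrightarrow> k * 0) at_top"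
    unfolding \<epsilon>_def [abs_def] by (intro tendsto_mult tendsto_const y0)
  then have E3: "eventually (\<lambda>t. \<epsilon> t < \<epsilon>0) at_top" by (rule order_tendstoD) (use \<epsilon>0 in simp)
  have y9: "((\<lambda>t. ln (ln (9 * t)) / y t) \<longlongrightarrow> 1) at_top" unfolding y_def by (rule zero_free_width_asymptotics)
  then have E4: "eventually (\<lambda>t. ln (ln (9 * t)) / y t < 2) at_top" by (rule order_tendstoD) simp
  have "((\<lambda>t. \<kappa> * D * W t) \<longlongrightarrow> \<kappa> * D * 0) at_top"
    unfolding W_def by (intro tendsto_mult tendsto_const zero_free_width_asymptotics)
  then have E5: "eventually (\<lambda>t. \<kappa> * D * W t < min d 1) at_top" by (rule order_tendstoD) (use d in simp)
  \<comment> \<open>For \<open>\<nu>0 = 0\<close> nonvanishing in Re s > 1 is enough. Otherwise the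
    old region is used at heights up to 9 t; the widths at t and 9 t have ratio tending to 1, which
    the strict inequality between \<open>\<nu>0\<close> m' and \<open>\<nu>1\<close> m
    absorbs.\<close>
  have E6: "eventually (\<lambda>t. \<forall>s. t - 1 \<le> \<bar>Im s\<bar> \<longrightarrow> \<bar>Im s\<bar> \<le> 9 * t \<longrightarrow> zeta s = 0 \<longrightarrow> Re s \<le> 1 - \<nu>0 * (\<kappa> * D * W t)) at_top"
    using old
  proof
    assume z: "\<nu>0 = 0"
    show ?thesis
    proof (rule always_eventually, intro allI impI)
      fix t :: real and s :: complex assume "zeta s = 0"
      then show "Re s \<le> 1 - \<nu>0 * (\<kappa> * D * W t)" using zeta_nonzero[of s] z by (cases "Re s > 1") auto
    qed
  next
    assume a: "zero_free_constant (B powr (- 2 / 3)) m \<and> \<nu>0 * m' < \<nu>1 * m"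
    then obtain T where T: "\<forall>t\<ge>T. \<forall>b. zeta (Complex b t) = 0 \<longrightarrow> m * D * W t \<le> 1 - b"
      unfolding zero_free_constant_def D_def W_def by blast
    have "\<nu>1 * m > 0" using a \<nu>(3) m' mult_nonneg_nonneg[of \<nu>0 m'] by linarith
    then have m: "m > 0" using \<nu>(5) by (simp add: zero_less_mult_iff)
    have "\<nu>0 * \<kappa> * \<nu>1 < m * \<nu>1" using a unfolding \<kappa>(2)[symmetric] by (simp add: mult_ac)
    then have "\<nu>0 * \<kappa> < m" using \<nu>(5) by simp
    then have "\<nu>0 * \<kappa> / m < 1" using m by simp
    then have "eventually (\<lambda>t. \<nu>0 * \<kappa> / m < W (9 * t) / W t) at_top"
      unfolding W_def by (rule order_tendstoD[OF zero_free_width_asymptotics(1)])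
    then show ?thesis using eventually_ge_at_top[of "max T 5 + 1"]
    proof (eventually_elim, intro allI impI)
      fix t :: real and s :: complex
      assume w: "\<nu>0 * \<kappa> / m < W (9 * t) / W t" and t: "t \<ge> max T 5 + 1"
        and s: "t - 1 \<le> \<bar>Im s\<bar>" "\<bar>Im s\<bar> \<le> 9 * t" "zeta s = 0"
      have Wt: "W t > 0" using ly t by auto
      have "\<nu>0 * \<kappa> * W t \<le> m * W (9 * t)" using w Wt m by (simp add: field_simps)
      also have "\<dots> \<le> m * W \<bar>Im s\<bar>"
        unfolding W_def using zero_free_width_antimono[of "\<bar>Im s\<bar>" "9 * t"] s t m by (intro mult_left_mono) auto
      finally have "\<nu>0 * \<kappa> * W t * D \<le> m * W \<bar>Im s\<bar> * D" using D by (intro mult_right_mono) auto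
      moreover have "zeta (Complex (Re s) \<bar>Im s\<bar>) = 0"
      proof (cases "Im s \<ge> 0")
        case True
        then show ?thesis using s by simp
      next
        case False
        have "s \<noteq> 1" using False by auto
        then have "zeta (cnj s) = 0" using zeta_cnj[of s] s by simp
        moreover have "cnj s = Complex (Re s) \<bar>Im s\<bar>" using False by (simp add: complex_eq_iff)
        ultimately show ?thesis by simp
      qed
      then have "m * D * W \<bar>Im s\<bar> \<le> 1 - Re s" using T s t by auto
      ultimately show "Re s \<le> 1 - \<nu>0 * (\<kappa> * D * W t)" by (simp add: mult_ac)
    qed
  qed
  define R where "R t = 2 / (pi * 0.992) * (4258 * U t + 1218 * Z t) + C * \<epsilon> t * (U t + Z t) + C" for t
  \<comment> \<open>U / y tends to \<open>\<Theta>\<close> + 2/3 and Z / y to 2/3, so the limit of R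
    / y lies below X / k by \<open>ineq\<close>, and the strict inequality holds for all large
    t.\<close>
  have E7: "eventually (\<lambda>t. R t / y t < X / k) at_top"
  proof -
    define u where "u t = K1 * (1 / y t) + \<Theta> * (ln (9 * t) / ln t) + 2 / 3 * (ln (ln (9 * t)) / y t)" for t
    define z where "z t = (ln C2 - ln (\<kappa> * D)) * (1 / y t) + 2 / 3 + 1 / 3 * (ln (y t) / y t)" for t
    have ylim: "((\<lambda>t. ln (y t) / y t) \<longlongrightarrow> 0) at_top" unfolding y_def by (rule zero_free_width_asymptotics)
    have u: "(u \<longlongrightarrow> K1 * 0 + \<Theta> * 1 + 2 / 3 * 1) at_top"
      unfolding u_def [abs_def] by (intro tendsto_intros y0 y9 zero_free_width_asymptotics)
    have z: "(z \<longlongrightarrow> (ln C2 - ln (\<kappa> * D)) * 0 + 2 / 3 + 1 / 3 * 0) at_top"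
      unfolding z_def [abs_def] by (intro tendsto_mult tendsto_add tendsto_const y0 ylim)
    have "((\<lambda>t. 2 / (pi * 0.992) * (4258 * u t + 1218 * z t) + C * \<epsilon> t * (u t + z t) + C * (1 / y t)) \<longlongrightarrow>
       2 / (pi * 0.992) * (4258 * (K1 * 0 + \<Theta> * 1 + 2 / 3 * 1) + 1218 * ((ln C2 - ln (\<kappa> * D)) * 0 + 2 / 3 + 1 / 3 * 0)) +
        C * (k * 0) * ((K1 * 0 + \<Theta> * 1 + 2 / 3 * 1) + ((ln C2 - ln (\<kappa> * D)) * 0 + 2 / 3 + 1 / 3 * 0)) + C * 0) at_top"
      by (intro tendsto_mult tendsto_add tendsto_const u z \<epsilon>lim y0)
    moreover have "2 / (pi * 0.992) * (4258 * (K1 * 0 + \<Theta> * 1 + 2 / 3 * 1) + 1218 * ((ln C2 - ln (\<kappa> * D)) * 0 + 2 / 3 + 1 / 3 * 0)) +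
        C * (k * 0) * ((K1 * 0 + \<Theta> * 1 + 2 / 3 * 1) + ((ln C2 - ln (\<kappa> * D)) * 0 + 2 / 3 + 1 / 3 * 0)) + C * 0 < X / k"
    proof -
      have "2 / (pi * 0.992) * Q = 2 * (\<kappa> * Q) / (pi * 0.992 * \<kappa>)" using \<kappa> by simp
      also have "\<dots> < 2 * (2 * 0.992 * \<theta> * X) / (pi * 0.992 * \<kappa>)"
        using ineq' \<kappa> by (intro divide_strict_right_mono mult_strict_left_mono) auto
      also have "\<dots> = X / k" using \<kappa> \<theta> by (simp add: k_def field_simps)
      finally show ?thesis by (simp add: Q_def)
    qed
    ultimately have "eventually (\<lambda>t. 2 / (pi * 0.992) * (4258 * u t + 1218 * z t) + C * \<epsilon> t * (u t + z t) + C * (1 / y t) < X / k) at_top"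
      by (rule order_tendstoD)
    then show ?thesis using eventually_ge_at_top[of "4::real"]
    proof eventually_elim
      fix t :: real
      assume a: "2 / (pi * 0.992) * (4258 * u t + 1218 * z t) + C * \<epsilon> t * (u t + z t) + C * (1 / y t) < X / k" and t: "t \<ge> 4"
      have "U t = u t * y t" "Z t = z t * y t" using ly[OF t] by (simp_all add: U_def Z_def u_def z_def distrib_right)
      then have "R t = (2 / (pi * 0.992) * (4258 * u t + 1218 * z t) + C * \<epsilon> t * (u t + z t) + C * (1 / y t)) * y t"
        using ly[OF t] by (simp add: R_def algebra_simps)
      then have "R t / y t = 2 / (pi * 0.992) * (4258 * u t + 1218 * z t) + C * \<epsilon> t * (u t + z t) + C * (1 / y t)"
        using ly[OF t] by simp
      then show "R t / y t < X / k" using a by simp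
    qed
  qed
  have "eventually (\<lambda>t. \<forall>b. zeta (Complex b t) = 0 \<longrightarrow> m' * D * W t \<le> 1 - b) at_top"
  proof (rule eventually_mono[OF eventually_conj[OF E2 eventually_conj[OF E3 eventually_conj[OF E4 eventually_conj[OF E5
      eventually_conj[OF E6 eventually_conj[OF E7 eventually_ge_at_top[of "4::real"]]]]]]]],
      elim conjE, intro allI impI, rule ccontr)
    fix t b :: real
    assume q8: "q t < 1 / 8" and \<epsilon>t: "\<epsilon> t < \<epsilon>0" and y9: "ln (ln (9 * t)) / y t < 2" and lam: "\<kappa> * D * W t < min d 1"
      and zf: "\<forall>s. t - 1 \<le> \<bar>Im s\<bar> \<longrightarrow> \<bar>Im s\<bar> \<le> 9 * t \<longrightarrow> zeta s = 0 \<longrightarrow> Re s \<le> 1 - \<nu>0 * (\<kappa> * D * W t)"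
      and fin: "R t / y t < X / k" and t: "4 \<le> t" and b: "zeta (Complex b t) = 0" and nb: "\<not> m' * D * W t \<le> 1 - b"
    note ly = ly[OF t]
    note q\<epsilon> = q\<epsilon>[OF t]
    define l where "l = \<kappa> * D * W t"
    have l: "0 < l" "l < d" "l < 1" using lam \<kappa> D ly by (auto simp: l_def)
    have q0: "0 < q t" using ly \<theta> D by (simp add: q_def)
    have \<epsilon>p: "0 < \<epsilon> t" using k ly by (simp add: \<epsilon>_def)
    have L9: "ln (9 * t) \<ge> ln t" using t by simp
    then have r9: "ln (9 * t) / ln t \<ge> 1" using ly by simp
    \<comment> \<open>With ln ln (9 t) <= 2 y, a third of ln ln (9 t) is below y, hence below the
      \<open>\<Theta>\<close> term. So the growth bound dominates C ln |t|, and \<open>U\<close>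
      covers both cases of \<open>strip\<close>.\<close>
    have y9': "0 < ln (ln (9 * t))" "ln (ln (9 * t)) \<le> 2 * y t" using y9 ly L9 by (auto simp: divide_less_eq)
    have Ty: "\<Theta> * y t * (ln (9 * t) / ln t) \<ge> 1 * y t * 1" using \<Theta> r9 ly by (intro mult_mono) auto
    have Ut: "U t \<ge> 0" using K1 Ty y9' ly by (simp add: U_def)
    define \<eta> where "\<eta> = pi / 4 * q t"
    have \<eta>: "0 \<le> \<eta>" "\<eta> \<le> 1 / 2"
    proof -
      show "0 \<le> \<eta>" using q0 by (simp add: \<eta>_def)
      have "\<eta> \<le> 1 * (1 / 8)" unfolding \<eta>_def using q8 q0 pi_less_4 by (intro mult_mono) auto
      then show "\<eta> \<le> 1 / 2" by simp
    qed
    have B\<eta>: "B * \<eta> powr (3 / 2) * ln (9 * t) = \<Theta> * y t * (ln (9 * t) / ln t)"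
    proof -
      have "\<eta> = \<theta> * D * (y t / ln t) powr (2 / 3)" by (simp add: \<eta>_def q_def)
      then have "\<eta> powr (3 / 2) = \<theta> powr (3 / 2) * D powr (3 / 2) * ((y t / ln t) powr (2 / 3)) powr (3 / 2)"
        using \<theta> D ly by (simp add: powr_mult)
      also have "((y t / ln t) powr (2 / 3)) powr (3 / 2) = y t / ln t" using ly by (simp add: powr_powr)
      also have "D powr (3 / 2) = B powr (- 1)" unfolding D_def powr_powr by simp
      also have "B powr (- 1) = 1 / B" using B by (simp add: powr_minus_divide)
      finally show ?thesis using B \<theta>\<Theta> by simp
    qed
    have UB: "\<forall>j\<in>fejer_support. \<forall>s. \<bar>Im s - of_int j * t\<bar> \<le> 1 \<longrightarrow> 1 - pi / 4 * q t \<le> Re s \<longrightarrow> Re s \<le> 1 + q t * \<epsilon> t \<longrightarrow> ln (norm (zeta s)) \<le> U t"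
    proof (intro ballI allI impI)
      fix j s assume j: "j \<in> fejer_support" and s: "\<bar>Im s - of_int j * t\<bar> \<le> 1" "1 - pi / 4 * q t \<le> Re s" "Re s \<le> 1 + q t * \<epsilon> t"
      have h: "t - 1 \<le> \<bar>Im s\<bar>" "\<bar>Im s\<bar> \<le> 9 * t" using height_bounds[OF _ _ t s(1)] fejer_support_facts(7)[OF j] by auto
      have "ln (norm (zeta s)) \<le> K1 + max (B * \<eta> powr (3 / 2) * ln (9 * t) + 2 / 3 * ln (ln (9 * t))) (ln (ln (9 * t)))"
        by (rule strip[rule_format]) (use h t \<eta> s l in \<open>auto simp: \<eta>_def q\<epsilon> l_def\<close>)
      also have "\<dots> \<le> U t" unfolding U_def B\<eta> using Ty y9' by (simp add: max_def)
      finally show "ln (norm (zeta s)) \<le> U t" .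
    qed
    have ZF: "\<forall>j\<in>fejer_support. \<forall>s. \<bar>Im s - of_int j * t\<bar> \<le> 1 \<longrightarrow> zeta s = 0 \<longrightarrow> Re s \<le> 1 - \<nu>0 * (q t * \<epsilon> t)"
    proof (intro ballI allI impI)
      fix j s assume j: "j \<in> fejer_support" and s: "\<bar>Im s - of_int j * t\<bar> \<le> 1" "zeta s = 0"
      have h: "t - 1 \<le> \<bar>Im s\<bar>" "\<bar>Im s\<bar> \<le> 9 * t" using height_bounds[OF _ _ t s(1)] fejer_support_facts(7)[OF j] by auto
      then show "Re s \<le> 1 - \<nu>0 * (q t * \<epsilon> t)" unfolding q\<epsilon> using zf s by blast
    qed
    have b1: "\<nu>0 * (q t * \<epsilon> t) \<le> 1 - b"
      using ZF[rule_format, OF fejer_support_facts(2), of "Complex b t"] b by simp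
    \<comment> \<open>This is the choice of \<open>\<kappa>\<close>: violating the new constant
      means being within \<open>\<nu>1\<close> q \<epsilon> of the line Re s = 1.\<close>
    have "\<nu>1 * (q t * \<epsilon> t) = m' * D * W t" unfolding q\<epsilon> using \<kappa>(2) by (simp flip: mult.assoc)
    then have b2: "1 - b \<le> \<nu>1 * (q t * \<epsilon> t)" using nb by linarith
    define Z' where "Z' = ln (norm (zeta (of_real (1 + q t * \<epsilon> t))))"
    have Z'le: "Z' \<le> Z t"
    proof -
      have nz: "norm (zeta (of_real (1 + l))) > 0" using zeta_nonzero[of "of_real (1 + l)"] l by simp
      have "norm (zeta (of_real (1 + l))) \<le> C2 / (1 + l - 1)"
        by (rule near[rule_format, THEN conjunct2]) (use l in auto)
      then have "ln (norm (zeta (of_real (1 + l)))) \<le> ln (C2 / l)" using nz C2 l by (subst ln_le_cancel_iff) auto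
      also have "\<dots> = ln C2 - ln l" using C2 l by (intro ln_divide_pos) auto
      also have "ln l = ln (\<kappa> * D) + ln (W t)" unfolding l_def using \<kappa> D ly by (intro ln_mult_pos) auto
      also have "ln (W t) = - (2 / 3 * y t + 1 / 3 * ln (y t))"
        using ly by (simp add: W_def zero_free_width_def y_def ln_divide_pos ln_mult_pos)
      finally show ?thesis by (simp add: Z'_def Z_def q\<epsilon> l_def)
    qed
    have "(1 / \<epsilon> t) * (real (fejer_coeff 1 + fejer_coeff (- 1)) * \<Phi>0 - 1218 * (\<Sum>i\<le>N. c i / real (i + 1)))
       \<le> 2 / (pi * 0.992) * (real (\<Sum>j\<in>fejer_support. fejer_coeff j) * U t + 1218 * Z') + C * \<epsilon> t * (U t + Z') + C"
      by (rule det[rule_format, OF q0 _ \<epsilon>p _ _ Ut Z'_def _ _ b b1 b2]) (use q8 \<epsilon>t t UB ZF in auto)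
    then have "(1 / \<epsilon> t) * X \<le> 2 / (pi * 0.992) * (4258 * U t + 1218 * Z') + C * \<epsilon> t * (U t + Z') + C"
      unfolding fejer_support_facts X_def by simp
    also have "\<dots> \<le> R t" unfolding R_def using Z'le C \<epsilon>p by (intro add_mono mult_left_mono order.refl) auto
    finally have "y t * (X / k) \<le> R t" by (simp add: \<epsilon>_def mult.commute)
    then have "X / k \<le> R t / y t" using ly by (simp add: le_divide_eq mult.commute)
    then show False using fin by linarith
  qed
  then show ?thesis unfolding zero_free_constant_def D_def W_def eventually_at_top_linorder .
qed

text \<open>The classical argument with one evaluation point: the kernel 1 / w is positive in the
  whole right half-plane, so nothing is needed about zeros beyond Re s <= 1. A zero within \<lambda>
  / 4 has w <= 3/2 after distortion, and 2114 * (2/3) > 1218.\<close>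

lemma zero_free_initial:
  fixes A B :: real
  assumes A: "A > 0" and B: "B > 0"
    and hyp: "\<forall>t \<sigma> :: real. \<bar>t\<bar> \<ge> 3 \<longrightarrow> 1 / 2 \<le> \<sigma> \<longrightarrow> \<sigma> \<le> 1 \<longrightarrow>
           norm (zeta (Complex \<sigma> t)) \<le> A * \<bar>t\<bar> powr (B * (1 - \<sigma>) powr (3 / 2)) * ln \<bar>t\<bar> powr (2 / 3)"
  shows "zero_free_constant (B powr (- 2 / 3)) 0.001"
proof (rule zero_free_step[OF A B hyp, where N = 0 and c = "\<lambda>_. 1" and \<mu> = 1 and \<nu> = "- 1 / 2" and ?\<nu>0.0 = 0 and ?\<nu>1.0 = "1 / 4"
    and ?\<nu>2.0 = "1 / 2" and ?\<Phi>0.0 = "2 / 3"])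
  show "\<forall>w::real. 1 + - 1 / 2 \<le> w \<longrightarrow> w \<le> 1 + 1 / 2 \<longrightarrow> 2 / 3 \<le> (\<Sum>i\<le>0. 1 / (w + real i))"
    by (auto simp: field_simps)
qed (simp_all add: power2_eq_square power3_eq_cube)

text \<open>The kernel inequality is strict at w = 2 and persists slightly to the right of it. This
  gives room for 1 < \<open>\<nu>0\<close> < \<open>\<nu>1\<close> < \<open>\<nu>2\<close>. The
  possible gain \<open>\<nu>1\<close> / \<open>\<nu>0\<close> > 1 does not depend on m, so finitely
  many steps suffice.\<close>

lemma zero_free_final:
  fixes A B :: real
  assumes A: "A > 0" and B: "B > 0"
    and hyp: "\<forall>t \<sigma> :: real. \<bar>t\<bar> \<ge> 3 \<longrightarrow> 1 / 2 \<le> \<sigma> \<longrightarrow> \<sigma> \<le> 1 \<longrightarrow>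
           norm (zeta (Complex \<sigma> t)) \<le> A * \<bar>t\<bar> powr (B * (1 - \<sigma>) powr (3 / 2)) * ln \<bar>t\<bar> powr (2 / 3)"
  shows "zero_free_constant (B powr (- 2 / 3)) 0.0551"
proof -
  define zf where "zf = zero_free_constant (B powr (- 2 / 3))"
  obtain N c \<mu> where \<mu>: "\<mu> > 0" and c: "\<forall>y\<in>{0..1}. (\<Sum>i\<le>N. c i * y ^ i) \<ge> \<mu>"
    and F: "\<forall>w::complex. Re w \<ge> 2 \<longrightarrow> \<mu> * Re (1 / w) \<le> Re (\<Sum>i\<le>N. c i / (w + of_nat i))"
    and c1: "(\<Sum>i\<le>N. c i) = 1"
    and num: "106.3 < 1057 * (\<Sum>i\<le>N. c i / real (i + 2)) - 609 * (\<Sum>i\<le>N. c i / real (i + 1))"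
    using kernel_exists by (elim exE conjE) (rule that)
  define F0 where "F0 = (\<Sum>i\<le>N. c i / real (i + 1))"
  \<comment> \<open>Solves 1057 \<open>\<Phi>0\<close> - 609 \<open>F0\<close> = 106.3, and so lies
    strictly below the kernel value at 2.\<close>
  define \<Phi>0 where "\<Phi>0 = (106.3 + 609 * F0) / 1057"
  define g where "g w = (\<Sum>i\<le>N. c i / (w + real i))" for w
  have "isCont g 2" unfolding g_def by (intro continuous_intros) (auto simp: add_nonneg_eq_0_iff)
  then have "(g \<longlongrightarrow> g 2) (nhds 2)" by (simp add: isCont_def tendsto_at_iff_tendsto_nhds)
  moreover have "g 2 = (\<Sum>i\<le>N. c i / real (i + 2))" by (simp add: g_def add.commute)
  then have "\<Phi>0 < g 2" using num by (simp add: \<Phi>0_def F0_def)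
  ultimately have "eventually (\<lambda>w. \<Phi>0 < g w) (nhds 2)" by (rule order_tendstoD)
  then obtain d where d: "d > 0" "\<forall>w. dist w 2 < d \<longrightarrow> \<Phi>0 < g w" unfolding eventually_nhds_metric by blast
  define e where "e = min d 1"
  have e: "0 < e" "e \<le> 1" "e \<le> d" using d by (auto simp: e_def)
  define \<nu>0 where "\<nu>0 = 1 + e / 4"
  define \<nu>1 where "\<nu>1 = 1 + e / 3"
  define \<nu>2 where "\<nu>2 = 1 + e / 2"
  note \<nu>_defs = \<nu>0_def \<nu>1_def \<nu>2_def
  \<comment> \<open>Halfway between 1 and the possible gain, since \<open>zero_free_step\<close>
    asks for a strict inequality.\<close>
  define h where "h = (1 + \<nu>1 / \<nu>0) / 2"
  have h: "h > 1" "\<nu>0 * h < \<nu>1"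
  proof -
    have "0 < \<nu>0" "\<nu>0 < \<nu>1" using e by (auto simp: \<nu>_defs)
    then show "h > 1" "\<nu>0 * h < \<nu>1" by (auto simp: h_def field_simps)
  qed
  have \<Phi>: "\<forall>w::real. 1 + 1 \<le> w \<longrightarrow> w \<le> 1 + \<nu>2 \<longrightarrow> \<Phi>0 \<le> (\<Sum>i\<le>N. c i / (w + real i))"
  proof (intro allI impI)
    fix w assume "1 + 1 \<le> w" "w \<le> 1 + \<nu>2"
    then have "dist w 2 < d" using e by (auto simp: dist_real_def \<nu>_defs)
    then show "\<Phi>0 \<le> (\<Sum>i\<le>N. c i / (w + real i))" using d(2) unfolding g_def by (simp add: order_less_imp_le)
  qed
  have F': "\<forall>w::complex. Re w \<ge> 1 + 1 \<longrightarrow> \<mu> * Re (1 / w) \<le> Re (\<Sum>i\<le>N. c i / (w + of_nat i))" using F by simp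
  have step: "zf (min (h * m) 0.0551)" if m: "m > 0" "zf m" for m
    unfolding zf_def
  proof (rule zero_free_step[OF A B hyp c1 \<mu> c _ _ _ _ _ _ F' \<Phi>])
    define m' where "m' = min (h * m) 0.0551"
    have "\<nu>0 * m' \<le> \<nu>0 * (h * m)" using e by (intro mult_left_mono) (auto simp: m'_def \<nu>_defs)
    also have "\<dots> = (\<nu>0 * h) * m" by simp
    also have "\<dots> < \<nu>1 * m" using h(2) m by (intro mult_strict_right_mono) auto
    finally show "\<nu>0 = 0 \<or> zero_free_constant (B powr (- 2 / 3)) m \<and> \<nu>0 * min (h * m) 0.0551 < \<nu>1 * m"
      using m by (simp add: zf_def m'_def)
    have "0 < m'" using h m by (simp add: m'_def)
    then show "0 < min (h * m) 0.0551" by (simp add: m'_def)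
    have "m' / \<nu>1 \<le> 0.0551 / 1" using \<open>0 < m'\<close> e by (intro frac_le) (auto simp: m'_def \<nu>_defs)
    then have "m' / \<nu>1 * (4258 * (1.197 ^ 3 + 2 / 3) + 1218 * (2 / 3)) \<le> 0.0551 / 1 * (4258 * (1.197 ^ 3 + 2 / 3) + 1218 * (2 / 3))"
      by (intro mult_right_mono) (auto simp: power3_eq_cube)
    \<comment> \<open>The two sides are about 603.5 and 604.4, so the cap 0.0551 is close to the
      largest constant that this kernel admits.\<close>
    also have "\<dots> < 2 * 0.992 * 1.197\<^sup>2 * (2 * 106.3)" by (simp add: power2_eq_square power3_eq_cube)
    also have "2 * 106.3 = 2114 * \<Phi>0 - 1218 * F0" by (simp add: \<Phi>0_def field_simps)
    finally show "min (h * m) 0.0551 / \<nu>1 * (4258 * (1.197 ^ 3 + 2 / 3) + 1218 * (2 / 3)) <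
       2 * 0.992 * 1.197\<^sup>2 * (2114 * \<Phi>0 - 1218 * (\<Sum>i\<le>N. c i / real (i + 1)))"
      by (simp only: m'_def F0_def)
  qed (use e in \<open>auto simp: \<nu>_defs\<close>)
  have iter: "zf (min (h ^ n * 0.001) 0.0551)" for n
  proof (induction n)
    case 0
    show ?case using zero_free_initial[OF A B hyp] by (simp add: zf_def)
  next
    case (Suc n)
    define m where "m = min (h ^ n * 0.001) 0.0551"
    have "m > 0" using h by (simp add: m_def)
    then have "zf (min (h * m) 0.0551)" using Suc by (intro step) (auto simp: m_def)
    moreover have "min (h ^ Suc n * 0.001) 0.0551 \<le> min (h * m) 0.0551"
    proof (cases "h ^ n * 0.001 \<le> 0.0551")
      case True
      then show ?thesis by (simp add: m_def mult_ac)
    next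
      case False
      then have "m = 0.0551" by (simp add: m_def)
      have "1 * m \<le> h * m" using h \<open>m > 0\<close> by (intro mult_right_mono) auto
      then have "0.0551 \<le> h * m" using \<open>m = 0.0551\<close> by (simp only: mult_1)
      then show ?thesis by simp
    qed
    ultimately show ?case unfolding zf_def by (rule zero_free_constant_mono) simp
  qed
  obtain n where "100 < h ^ n" using real_arch_pow[OF h(1)] by blast
  then have "min (h ^ n * 0.001) 0.0551 = 0.0551" by (simp add: min_def)
  then show ?thesis using iter[of n] by (simp add: zf_def)
qed

theorem theorem1:
  fixes A B :: real
  assumes "A > 0" and "B > 0"
    and "\<And>t \<sigma> :: real. \<bar>t\<bar> \<ge> 3 \<Longrightarrow> 1 / 2 \<le> \<sigma> \<Longrightarrow> \<sigma> \<le> 1 \<Longrightarrow>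
           norm (zeta (Complex \<sigma> t)) \<le>
             A * \<bar>t\<bar> powr (B * (1 - \<sigma>) powr (3 / 2)) * ln \<bar>t\<bar> powr (2 / 3)"
  shows "\<exists>T>0. \<forall>t \<beta> :: real. \<bar>t\<bar> \<ge> T \<longrightarrow>
           1 - \<beta> \<le> 0.05507 * B powr (- 2 / 3) /
                    (ln \<bar>t\<bar> powr (2 / 3) * ln (ln \<bar>t\<bar>) powr (1 / 3)) \<longrightarrow>
           zeta (Complex \<beta> t) \<noteq> 0"
proof -
  define D where "D = B powr (- 2 / 3)"
  have D: "D > 0" using assms(2) by (simp add: D_def)
  have "zero_free_constant D 0.0551"
    unfolding D_def by (rule zero_free_final[OF assms(1,2)]) (use assms(3) in blast)
  then obtain T where T: "\<forall>t\<ge>T. \<forall>b. zeta (Complex b t) = 0 \<longrightarrow> 0.0551 * D * zero_free_width t \<le> 1 - b"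
    unfolding zero_free_constant_def by (elim exE) (rule that)
  have "zeta (Complex \<beta> t) \<noteq> 0"
    if t: "\<bar>t\<bar> \<ge> max T 4" and \<beta>: "1 - \<beta> \<le> 0.05507 * D / (ln \<bar>t\<bar> powr (2 / 3) * ln (ln \<bar>t\<bar>) powr (1 / 3))" for t \<beta> :: real
  proof
    assume z: "zeta (Complex \<beta> t) = 0"
    have "zeta (Complex \<beta> \<bar>t\<bar>) = 0"
    proof (cases "t \<ge> 0")
      case False
      then have "Complex \<beta> t \<noteq> 1" by (auto simp: complex_eq_iff)
      then have "zeta (cnj (Complex \<beta> t)) = 0" using zeta_cnj z by simp
      then show ?thesis using False by (simp add: complex_cnj)
    qed (use z in simp)
    then have "0.0551 * (D * zero_free_width \<bar>t\<bar>) \<le> 1 - \<beta>" using T t by (auto simp: mult.assoc)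
    moreover have "1 - \<beta> \<le> 0.05507 * (D * zero_free_width \<bar>t\<bar>)" using \<beta> by (simp add: zero_free_width_def)
    moreover have "D * zero_free_width \<bar>t\<bar> > 0" using D zero_free_width_pos[of "\<bar>t\<bar>"] t by simp
    \<comment> \<open>Both bounds are non-strict; the contradiction comes from the margin between
      the two constants.\<close>
    ultimately have "0.0551 * (D * zero_free_width \<bar>t\<bar>) \<le> 0.05507 * (D * zero_free_width \<bar>t\<bar>)"
      and "D * zero_free_width \<bar>t\<bar> > 0" by (auto intro: order.trans)
    then show False by simp
  qed
  then show ?thesis unfolding D_def by (intro exI[of _ "max T 4"]) auto
qed

end
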